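(* The space-time discontinuous Galerkin Trefftz method defined in the context is a consistent and well-defined implicit time-stepping scheme, and its approximations satisfy a discrete energy dissipation relation. That is: (1) (Well-defined implicit scheme) For every $n\ge1$ the linear variational problem $$B^n(\mathbf{E}_h^n,\mathbf{H}_h^n;\mathbf{v},\mathbf{w})=R^n(\mathbf{E}_h^{n-1},\mathbf{H}_h^{n-1};\mathbf{v},\mathbf{w})\quad\text{for all }(\mathbf{v},\mathbf{w})\in\mathbb{T}_p(\Omega_h\times I^n)$$ has a unique solution $(\mathbf{E}_h^n,\mathbf{H}_h^n)\in\mathbb{T}_p(\Omega_h\times I^n)$, so that the approximations are determined consecutively, $(\mathbf{E}_h^n,\mathbf{H}_h^n)$ depending only on $(\mathbf{E}_h^{n-1},\mathbf{H}_h^{n-1})$ and $\mathbf{g}|_{\partial\Omega\times I^n}$. (2) (Consistency) If $(\mathbf{E},\mathbf{H})$ is a piecewise smooth solution of $$\epsilon\,\partial_t \mathbf{E}-\mathrm{curl}\,\mathbf{H}=\mathbf{0},\qquad \mu\,\partial_t\mathbf{H}+\mathrm{curl}\,\mathbf{E}=\mathbf{0}\quad\text{in }\Omega\times(0,T),$$ $$\mathbf{E}(0)=\mathbf{E}^0,\quad \mathbf{H}(0)=\mathbf{H}^0\ \text{ on }\Omega,\qquad \mathbf{n}\times\mathbf{E}+\beta\,\mathbf{n}\times(\mathbf{n}\times\mathbf{H})=\mathbf{n}\times\mathbf{g}\ \text{ on }\partial\Omega\times(0,T),$$ then $B^n(\mathbf{E},\mathbf{H};\mathbf{v},\mathbf{w})=R^n(\mathbf{E},\mathbf{H};\mathbf{v},\mathbf{w})$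 for all $(\mathbf{v},\mathbf{w})\in\mathbb{T}_p(\Omega_h\times I^n)$ and all $n\ge1$. (3) (Energy dissipation) For every $n\ge1$, $$\tfrac12\big(\|\epsilon^{1/2}\mathbf{E}_h^n(t^n)\|_\Omega^2+\|\mu^{1/2}\mathbf{H}_h^n(t^n)\|_\Omega^2\big)-\tfrac12\big(\|\epsilon^{1/2}\mathbf{E}_h^{n-1}(t^{n-1})\|_\Omega^2+\|\mu^{1/2}\mathbf{H}_h^{n-1}(t^{n-1})\|_\Omega^2\big)$$ $$=-\int_{\partial\Omega\times I^n}\Big(\beta|\mathbf{n}\times\mathbf{H}_h^n|^2+\mathbf{n}\times\mathbf{g}\cdot\mathbf{H}_h^n\Big)-\sum_{K\in\Omega_h}\Big(\tfrac{\epsilon}{2}\|\mathbf{E}_h^n(t^{n-1})-\mathbf{E}_h^{n-1}(t^{n-1})\|_K^2+\tfrac{\mu}{2}\|\mathbf{H}_h^n(t^{n-1})-\mathbf{H}_h^{n-1}(t^{n-1})\|_K^2\Big).$$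
   Context: Setting. $\Omega\subset\mathbb{R}^3$ is a bounded polyhedral Lipschitz domain and $\Omega_h=\{K\}$ is a non-overlapping partition of $\Omega$ into finitely many simple regular polyhedral elements $K$ (tetrahedra, parallelepipeds, prisms, etc.). $\mathcal{F}_h^{int}$ is the set of interior interfaces $f=\partial K_1\cap\partial K_2$, $K_1\neq K_2\in\Omega_h$, and $\mathcal{F}_h^{\partial}$ the set of boundary faces $f=\partial K\cap\partial\Omega$. $0=t^0<t^1<\dots<t^N=T$ and $I^n=[t^{n-1},t^n]$. The material parameters $\epsilon,\mu>0$ are time-independent and constant on each element $K$; $\beta\ge 0$ is a constant; $\mathbf{E}^0,\mathbf{H}^0\in L^2(\Omega)^3$ are initial data and $\mathbf{g}\in L^2(\partial\Omega\times(0,T))^3$ is the boundary excitation. $\mathbf{n}$ is the outward unit normal on $\partial K$ or $\partial\Omega$, and $\|\cdot\|_D$ is the $L^2(D)$-norm. On $f=\partial K_1\cap\partial K_2$ with traces $\mathbf{E}_1,\mathbf{E}_2$ and outward normals $\mathbf{n}_1,\mathbf{n}_2$ of $K_1,K_2$, $$\{\mathbf{E}\}=\tfrac12(\mathbf{E}_1+\mathbf{E}_2),\qquad[\mathbf{n}\times\mathbf{E}]=\mathbf{n}_1\times\mathbf{E}_1+\mathbf{n}_2\times\mathbf{E}_2.$$ Spaces. $p\ge0$ is an integer and $\mathbb{P}_p(D)$ denotes the real polynomials on $D$ of total degree at most $p$. The local space of Trefftz polynomials is $$\mathbb{T}_p(K\times I^n)=\{(\mathbf{E},\mathbf{H})\in\mathbb{P}_p(K\times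 I^n)^6:\ \epsilon\partial_t\mathbf{E}-\mathrm{curl}\,\mathbf{H}=0,\ \mu\partial_t\mathbf{H}+\mathrm{curl}\,\mathbf{E}=0\},$$ and $\mathbb{T}_p(\Omega_h\times I^n)$ is the space of $L^2(\Omega\times I^n)$ functions (with six components) whose restriction to each $K\times I^n$ lies in $\mathbb{T}_p(K\times I^n)$; no continuity between elements is required. Space-time discontinuous Galerkin Trefftz method. Set $\mathbf{E}_h^0=\mathbf{E}^0$, $\mathbf{H}_h^0=\mathbf{H}^0$ (regarded as values at $t^0=0$). For $n\ge1$ find $(\mathbf{E}_h^n,\mathbf{H}_h^n)\in\mathbb{T}_p(\Omega_h\times I^n)$ such that $B^n(\mathbf{E}_h^n,\mathbf{H}_h^n;\mathbf{v},\mathbf{w})=R^n(\mathbf{E}_h^{n-1},\mathbf{H}_h^{n-1};\mathbf{v},\mathbf{w})$ for all $(\mathbf{v},\mathbf{w})\in\mathbb{T}_p(\Omega_h\times I^n)$, where $$B^n(\mathbf{E},\mathbf{H};\mathbf{v},\mathbf{w})=\sum_{f\in\mathcal{F}_h^{int}}\int_{f\times I^n}[\mathbf{n}\times\mathbf{H}]\cdot\{\mathbf{v}\}-[\mathbf{n}\times\mathbf{E}]\cdot\{\mathbf{w}\}$$ $$+\sum_{f\in\mathcal{F}_h^{\partial}}\int_{f\times I^n}\beta(\mathbf{n}\times\mathbf{H})\cdot(\mathbf{n}\times\mathbf{w})-\mathbf{n}\times\mathbf{E}\cdot\mathbf{w}+\sum_{K\in\Omega_h}\int_K\epsilon\mathbf{E}(t^{n-1})\cdot\mathbf{v}(t^{n-1})+\mu\mathbf{H}(t^{n-1})\cdot\mathbf{w}(t^{n-1}),$$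 $$R^n(\mathbf{E},\mathbf{H};\mathbf{v},\mathbf{w})=-\sum_{f\in\mathcal{F}_h^{\partial}}\int_{f\times I^n}\mathbf{n}\times\mathbf{g}\cdot\mathbf{w}+\sum_{K\in\Omega_h}\int_K\epsilon\mathbf{E}(t^{n-1})\cdot\mathbf{v}(t^{n-1})+\mu\mathbf{H}(t^{n-1})\cdot\mathbf{w}(t^{n-1}).$$ In $R^n(\mathbf{E}_h^{n-1},\mathbf{H}_h^{n-1};\cdot,\cdot)$ the value $\mathbf{E}_h^{n-1}(t^{n-1})$ is that at the final time of slab $n-1$; $\mathbf{E}_h^n(t^{n-1})$ is the value at the initial time of slab $n$. A piecewise smooth solution is a pair $(\mathbf{E},\mathbf{H})$ that is smooth up to the boundary on each $K\times I^n$, satisfies Maxwell's equations pointwise there, has tangential components $\mathbf{n}\times\mathbf{E}$, $\mathbf{n}\times\mathbf{H}$ continuous across interior interfaces, is continuous in time across each $t^n$, and satisfies the initial and boundary conditions. *)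

theory Defs
  imports "HOL-Analysis.Analysis"
begin

type_synonym vec3 = "real^3"

text \<open>Space-time points are pairs \<open>(x, s)\<close>. A discontinuous (broken) field assigns to each mesh
  element its own function; its values at \<open>x \<in> frontier K\<close> are the traces from \<open>K\<close>.
  A pair \<open>(E, H)\<close> of broken fields represents an electromagnetic field.\<close>

type_synonym field = "vec3 \<times> real \<Rightarrow> vec3"
type_synonym broken = "vec3 set \<Rightarrow> field"

definition planes :: "vec3 set set" where
  "planes = {P. affine P \<and> aff_dim P = 2}"

definition polyhedral_boundary :: "vec3 set \<Rightarrow> bool" where
  "polyhedral_boundary D \<longleftrightarrow> (\<exists>\<P>. finite \<P> \<and> \<P> \<subseteq> planes \<and> frontier D \<subseteq> \<Union>\<P>)"

text \<open>Near each boundary point the domain is the set below the graph of a Lipschitz function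
  over the hyperplane orthogonal to some direction \<open>e\<close>.\<close>

definition lipschitz_domain :: "vec3 set \<Rightarrow> bool" where
  "lipschitz_domain \<Omega> \<longleftrightarrow> open \<Omega> \<and> connected \<Omega> \<and> \<Omega> \<noteq> {} \<and>
     (\<forall>x\<in>frontier \<Omega>. \<exists>U e L \<gamma>. open U \<and> x \<in> U \<and> norm e = 1 \<and>
        L-lipschitz_on {y. y \<bullet> e = 0} \<gamma> \<and>
        \<Omega> \<inter> U = {y\<in>U. y \<bullet> e < \<gamma> (y - (y \<bullet> e) *\<^sub>R e)})"

text \<open>Closed polyhedra, not necessarily convex. Every convex polytope with nonempty interior
  (tetrahedron, parallelepiped, prism, ...) is of this kind.\<close>

definition polyhedral_element :: "vec3 set \<Rightarrow> bool" where
  "polyhedral_element K \<longleftrightarrow>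
     compact K \<and> K \<noteq> {} \<and> K = closure (interior K) \<and> polyhedral_boundary K"

definition polyhedral_mesh :: "vec3 set \<Rightarrow> vec3 set set \<Rightarrow> bool" where
  "polyhedral_mesh \<Omega> M \<longleftrightarrow> finite M \<and> (\<forall>K\<in>M. polyhedral_element K) \<and> \<Union>M = closure \<Omega> \<and>
     (\<forall>K1\<in>M. \<forall>K2\<in>M. K1 \<noteq> K2 \<longrightarrow> interior K1 \<inter> interior K2 = {})"

text \<open>Near \<open>x\<close>, the set \<open>D\<close> is a half ball with outward normal \<open>n\<close>, up to points of the bounding
  plane (so that open and closed sets are treated alike). For a polyhedron such a vector is
  unique if it exists, and exists at all boundary points off its edges.\<close>

definition is_outward_normal :: "vec3 set \<Rightarrow> vec3 \<Rightarrow> vec3 \<Rightarrow> bool" where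
  "is_outward_normal D x n \<longleftrightarrow> norm n = 1 \<and>
     (\<exists>r>0. \<forall>y\<in>ball x r. (n \<bullet> (y - x) < 0 \<longrightarrow> y \<in> D) \<and> (n \<bullet> (y - x) > 0 \<longrightarrow> y \<notin> D))"

definition outward_normal :: "vec3 set \<Rightarrow> vec3 \<Rightarrow> vec3" where
  "outward_normal D x = (THE n. is_outward_normal D x n)"

text \<open>An interior interface is given by the unordered pair \<open>{K1, K2}\<close> of elements sharing it.
  Pairs touching only in edges, in vertices or not at all have interfaces of surface measure
  zero, which do not contribute to any integral.\<close>

definition interfaces :: "vec3 set set \<Rightarrow> vec3 set set set" where
  "interfaces M = {e. e \<subseteq> M \<and> card e = 2}"

definition interface_set :: "vec3 set set \<Rightarrow> vec3 set" where
  "interface_set e = (\<Inter>K\<in>e. frontier K)"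

definition boundary_face :: "vec3 set \<Rightarrow> vec3 set \<Rightarrow> vec3 set" where
  "boundary_face \<Omega> K = frontier K \<inter> frontier \<Omega>"

definition average :: "vec3 set set \<Rightarrow> broken \<Rightarrow> field" where
  "average e F z = (1/2) *\<^sub>R (\<Sum>K\<in>e. F K z)"

definition tangential_jump :: "vec3 set set \<Rightarrow> broken \<Rightarrow> field" where
  "tangential_jump e F z = (\<Sum>K\<in>e. cross3 (outward_normal K (fst z)) (F K z))"

text \<open>Two-dimensional Lebesgue measure on an affine plane, transported by an isometric
  parametrisation; it does not depend on the choice of the latter.\<close>

definition plane_measure :: "vec3 set \<Rightarrow> vec3 measure" where
  "plane_measure P = distr (lborel :: (real^2) measure) borel
     (SOME \<phi>. (\<forall>a b. dist (\<phi> a) (\<phi> b) = dist a b) \<and> range \<phi> = P)"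

text \<open>Surface measure on a polyhedral surface \<open>S\<close>. If \<open>S\<close> is contained in finitely many planes,
  only these contribute to the sum over all planes: other planes meet \<open>S\<close> in null sets.\<close>

definition surface_measure :: "vec3 set \<Rightarrow> vec3 measure" where
  "surface_measure S = measure_of UNIV (sets borel)
     (\<lambda>A. \<integral>\<^sup>+P. emeasure (plane_measure P) (A \<inter> S) \<partial>count_space planes)"

text \<open>The completion makes the product measure insensitive to changes on arbitrary subsets of
  null sets, such as the values of a boundary datum at the end points of a time interval.\<close>

definition face_time_measure :: "vec3 set \<Rightarrow> (vec3 \<times> real) measure" where
  "face_time_measure S = completion (surface_measure S \<Otimes>\<^sub>M lborel)"

definition face_time_integral :: "vec3 set \<Rightarrow> real set \<Rightarrow> (vec3 \<times> real \<Rightarrow> real) \<Rightarrow> real" where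
  "face_time_integral f I F = (LINT z : f \<times> I | face_time_measure f. F z)"

definition L2_on :: "'a measure \<Rightarrow> 'a set \<Rightarrow> ('a \<Rightarrow> vec3) \<Rightarrow> bool" where
  "L2_on M A f \<longleftrightarrow> set_borel_measurable M A f \<and> set_integrable M A (\<lambda>z. (norm (f z))\<^sup>2)"

definition L2_norm_on :: "vec3 set \<Rightarrow> (vec3 \<Rightarrow> vec3) \<Rightarrow> real" where
  "L2_norm_on D f = sqrt (LINT x : D | lebesgue. (norm (f x))\<^sup>2)"

text \<open>The \<open>L\<^sup>2(\<Omega>)\<close>-norm of a piecewise defined function, given by its restrictions to the elements.\<close>

definition L2_norm_mesh :: "vec3 set set \<Rightarrow> (vec3 set \<Rightarrow> vec3 \<Rightarrow> vec3) \<Rightarrow> real" where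
  "L2_norm_mesh M f = sqrt (\<Sum>K\<in>M. (L2_norm_on K (f K))\<^sup>2)"

definition time_deriv :: "field \<Rightarrow> field" where
  "time_deriv F z = frechet_derivative F (at z) (0, 1)"

definition space_deriv :: "3 \<Rightarrow> field \<Rightarrow> field" where
  "space_deriv i F z = frechet_derivative F (at z) (axis i 1, 0)"

definition curl :: "field \<Rightarrow> field" where
  "curl F z = vector [space_deriv 2 F z $ 3 - space_deriv 3 F z $ 2,
                      space_deriv 3 F z $ 1 - space_deriv 1 F z $ 3,
                      space_deriv 1 F z $ 2 - space_deriv 2 F z $ 1]"

definition maxwell_at :: "real \<Rightarrow> real \<Rightarrow> field \<Rightarrow> field \<Rightarrow> vec3 \<times> real \<Rightarrow> bool" where
  "maxwell_at \<epsilon> \<mu> E H z \<longleftrightarrow>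
     \<epsilon> *\<^sub>R time_deriv E z - curl H z = 0 \<and> \<mu> *\<^sub>R time_deriv H z + curl E z = 0"

text \<open>\<open>f\<close> is of class \<open>C\<^sup>k\<close> up to the boundary of \<open>D\<close>: all partial derivatives of order at most \<open>k\<close>
  exist in the interior and extend continuously to \<open>D\<close>.\<close>

primrec Ck_upto_boundary ::
    "nat \<Rightarrow> 'a::euclidean_space set \<Rightarrow> ('a \<Rightarrow> 'b::real_normed_vector) \<Rightarrow> bool" where
  "Ck_upto_boundary 0 D f \<longleftrightarrow> continuous_on D f"
| "Ck_upto_boundary (Suc k) D f \<longleftrightarrow> continuous_on D f \<and>
     (\<forall>z\<in>interior D. f differentiable (at z)) \<and>
     (\<forall>v. \<exists>f'. Ck_upto_boundary k D f' \<and>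
        (\<forall>z\<in>interior D. frechet_derivative f (at z) v = f' z))"

definition smooth_upto_boundary ::
    "'a::euclidean_space set \<Rightarrow> ('a \<Rightarrow> 'b::real_normed_vector) \<Rightarrow> bool" where
  "smooth_upto_boundary D f \<longleftrightarrow> (\<forall>k. Ck_upto_boundary k D f)"

abbreviation slab :: "(nat \<Rightarrow> real) \<Rightarrow> nat \<Rightarrow> real set" where
  "slab t n \<equiv> {t (n - 1)..t n}"

text \<open>The element-wise fields live on \<open>K \<times> {0..T}\<close> and are thus single-valued in time across slabs.
  The trace condition on interfaces is imposed wherever both elements have a normal.\<close>

definition piecewise_smooth_solution ::
    "vec3 set \<Rightarrow> vec3 set set \<Rightarrow> (vec3 set \<Rightarrow> real) \<Rightarrow> (vec3 set \<Rightarrow> real) \<Rightarrow> real \<Rightarrow> nat \<Rightarrow> real \<Rightarrow>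
     (nat \<Rightarrow> real) \<Rightarrow> (vec3 \<Rightarrow> vec3) \<Rightarrow> (vec3 \<Rightarrow> vec3) \<Rightarrow> field \<Rightarrow> broken \<times> broken \<Rightarrow> bool" where
  "piecewise_smooth_solution \<Omega> M \<epsilon> \<mu> \<beta> N T t E0 H0 g = (\<lambda>(E, H).
     (\<forall>K\<in>M. \<forall>n\<in>{1..N}.
        smooth_upto_boundary (K \<times> slab t n) (E K) \<and> smooth_upto_boundary (K \<times> slab t n) (H K) \<and>
        (\<forall>z\<in>interior (K \<times> slab t n). maxwell_at (\<epsilon> K) (\<mu> K) (E K) (H K) z)) \<and>
     (\<forall>K1\<in>M. \<forall>K2\<in>M. \<forall>x\<in>frontier K1 \<inter> frontier K2. \<forall>s\<in>{0..T}. \<forall>n.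
        K1 \<noteq> K2 \<and> is_outward_normal K1 x n \<and> is_outward_normal K2 x (- n) \<longrightarrow>
        cross3 n (E K1 (x, s)) = cross3 n (E K2 (x, s)) \<and>
        cross3 n (H K1 (x, s)) = cross3 n (H K2 (x, s))) \<and>
     (\<forall>K\<in>M. \<forall>x\<in>K. continuous_on {0..T} (\<lambda>s. E K (x, s)) \<and> continuous_on {0..T} (\<lambda>s. H K (x, s))) \<and>
     (\<forall>K\<in>M. AE x in lebesgue. x \<in> K \<longrightarrow> E K (x, 0) = E0 x \<and> H K (x, 0) = H0 x) \<and>
     (\<forall>K\<in>M. AE z in face_time_measure (boundary_face \<Omega> K).
        z \<in> boundary_face \<Omega> K \<times> {0<..<T} \<longrightarrow>
        (let \<nu> = outward_normal \<Omega> (fst z)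
         in cross3 \<nu> (E K z) + \<beta> *\<^sub>R cross3 \<nu> (cross3 \<nu> (H K z)) = cross3 \<nu> (g z))))"

text \<open>Polynomials on \<open>K \<times> I\<close> are
  identified with their unique polynomial extension to the whole space, \<open>K \<times> I\<close> having nonempty
  interior.\<close>

definition polys :: "nat \<Rightarrow> (vec3 \<times> real \<Rightarrow> real) set" where
  "polys p = {f. \<exists>c. \<forall>x s. f (x, s) =
     (\<Sum>(i, j, k, l) \<in> {(i, j, k, l). i + j + k + l \<le> p}.
        c i j k l * (x $ 1) ^ i * (x $ 2) ^ j * (x $ 3) ^ k * s ^ l)}"

definition local_trefftz :: "real \<Rightarrow> real \<Rightarrow> nat \<Rightarrow> (vec3 \<times> real) set \<Rightarrow> (field \<times> field) set" where
  "local_trefftz \<epsilon> \<mu> p D = {(E, H).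
     (\<forall>i. (\<lambda>z. E z $ i) \<in> polys p \<and> (\<lambda>z. H z $ i) \<in> polys p) \<and>
     (\<forall>z\<in>D. maxwell_at \<epsilon> \<mu> E H z)}"

definition trefftz_space ::
    "vec3 set set \<Rightarrow> (vec3 set \<Rightarrow> real) \<Rightarrow> (vec3 set \<Rightarrow> real) \<Rightarrow> nat \<Rightarrow> (nat \<Rightarrow> real) \<Rightarrow> nat \<Rightarrow>
     (broken \<times> broken) set" where
  "trefftz_space M \<epsilon> \<mu> p t n = {(E, H). E \<in> extensional M \<and> H \<in> extensional M \<and>
     (\<forall>K\<in>M. (E K, H K) \<in> local_trefftz (\<epsilon> K) (\<mu> K) p (K \<times> slab t n))}"

definition mass_term ::
    "vec3 set set \<Rightarrow> (vec3 set \<Rightarrow> real) \<Rightarrow> (vec3 set \<Rightarrow> real) \<Rightarrow> real \<Rightarrow>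
     broken \<times> broken \<Rightarrow> broken \<times> broken \<Rightarrow> real" where
  "mass_term M \<epsilon> \<mu> s = (\<lambda>(E, H) (v, w). \<Sum>K\<in>M. LINT x : K | lebesgue.
     \<epsilon> K * (E K (x, s) \<bullet> v K (x, s)) + \<mu> K * (H K (x, s) \<bullet> w K (x, s)))"

definition dg_B ::
    "vec3 set \<Rightarrow> vec3 set set \<Rightarrow> (vec3 set \<Rightarrow> real) \<Rightarrow> (vec3 set \<Rightarrow> real) \<Rightarrow> real \<Rightarrow> (nat \<Rightarrow> real) \<Rightarrow> nat \<Rightarrow>
     broken \<times> broken \<Rightarrow> broken \<times> broken \<Rightarrow> real" where
  "dg_B \<Omega> M \<epsilon> \<mu> \<beta> t n = (\<lambda>(E, H) (v, w).
     (\<Sum>e\<in>interfaces M. face_time_integral (interface_set e) (slab t n)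
        (\<lambda>z. tangential_jump e H z \<bullet> average e v z - tangential_jump e E z \<bullet> average e w z)) +
     (\<Sum>K\<in>M. face_time_integral (boundary_face \<Omega> K) (slab t n)
        (\<lambda>z. let \<nu> = outward_normal \<Omega> (fst z)
             in \<beta> * (cross3 \<nu> (H K z) \<bullet> cross3 \<nu> (w K z)) - cross3 \<nu> (E K z) \<bullet> w K z)) +
     mass_term M \<epsilon> \<mu> (t (n - 1)) (E, H) (v, w))"

definition dg_R ::
    "vec3 set \<Rightarrow> vec3 set set \<Rightarrow> (vec3 set \<Rightarrow> real) \<Rightarrow> (vec3 set \<Rightarrow> real) \<Rightarrow> (nat \<Rightarrow> real) \<Rightarrow> field \<Rightarrow> nat \<Rightarrow>
     broken \<times> broken \<Rightarrow> broken \<times> broken \<Rightarrow> real" where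
  "dg_R \<Omega> M \<epsilon> \<mu> t g n = (\<lambda>(E, H) (v, w).
     - (\<Sum>K\<in>M. face_time_integral (boundary_face \<Omega> K) (slab t n)
          (\<lambda>z. cross3 (outward_normal \<Omega> (fst z)) (g z) \<bullet> w K z)) +
     mass_term M \<epsilon> \<mu> (t (n - 1)) (E, H) (v, w))"

text \<open>The problem on slab \<open>n\<close>: \<open>u\<close> is a solution for the field \<open>u'\<close> of the previous slab.\<close>

definition dg_step ::
    "vec3 set \<Rightarrow> vec3 set set \<Rightarrow> (vec3 set \<Rightarrow> real) \<Rightarrow> (vec3 set \<Rightarrow> real) \<Rightarrow> real \<Rightarrow> nat \<Rightarrow> (nat \<Rightarrow> real) \<Rightarrow>
     field \<Rightarrow> nat \<Rightarrow> broken \<times> broken \<Rightarrow> broken \<times> broken \<Rightarrow> bool" where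
  "dg_step \<Omega> M \<epsilon> \<mu> \<beta> p t g n u' u \<longleftrightarrow> u \<in> trefftz_space M \<epsilon> \<mu> p t n \<and>
     (\<forall>\<phi>\<in>trefftz_space M \<epsilon> \<mu> p t n. dg_B \<Omega> M \<epsilon> \<mu> \<beta> t n u \<phi> = dg_R \<Omega> M \<epsilon> \<mu> t g n u' \<phi>)"

text \<open>Only the values at the initial time matter for the initial field.\<close>

definition initial_field :: "(vec3 \<Rightarrow> vec3) \<Rightarrow> (vec3 \<Rightarrow> vec3) \<Rightarrow> broken \<times> broken" where
  "initial_field E0 H0 = (\<lambda>K z. E0 (fst z), \<lambda>K z. H0 (fst z))"

definition dg_scheme ::
    "vec3 set \<Rightarrow> vec3 set set \<Rightarrow> (vec3 set \<Rightarrow> real) \<Rightarrow> (vec3 set \<Rightarrow> real) \<Rightarrow> real \<Rightarrow> nat \<Rightarrow> nat \<Rightarrow> (nat \<Rightarrow> real) \<Rightarrow>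
     (vec3 \<Rightarrow> vec3) \<Rightarrow> (vec3 \<Rightarrow> vec3) \<Rightarrow> field \<Rightarrow> (nat \<Rightarrow> broken \<times> broken) \<Rightarrow> bool" where
  "dg_scheme \<Omega> M \<epsilon> \<mu> \<beta> p N t E0 H0 g U \<longleftrightarrow> U 0 = initial_field E0 H0 \<and>
     (\<forall>n\<in>{1..N}. dg_step \<Omega> M \<epsilon> \<mu> \<beta> p t g n (U (n - 1)) (U n))"

definition previous_fields ::
    "vec3 set set \<Rightarrow> (vec3 set \<Rightarrow> real) \<Rightarrow> (vec3 set \<Rightarrow> real) \<Rightarrow> nat \<Rightarrow> (nat \<Rightarrow> real) \<Rightarrow>
     (vec3 \<Rightarrow> vec3) \<Rightarrow> (vec3 \<Rightarrow> vec3) \<Rightarrow> nat \<Rightarrow> (broken \<times> broken) set" where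
  "previous_fields M \<epsilon> \<mu> p t E0 H0 n =
     (if n = 1 then {initial_field E0 H0} else trefftz_space M \<epsilon> \<mu> p t (n - 1))"

definition energy ::
    "vec3 set set \<Rightarrow> (vec3 set \<Rightarrow> real) \<Rightarrow> (vec3 set \<Rightarrow> real) \<Rightarrow> real \<Rightarrow> broken \<times> broken \<Rightarrow> real" where
  "energy M \<epsilon> \<mu> s = (\<lambda>(E, H). 1/2 *
     ((L2_norm_mesh M (\<lambda>K x. sqrt (\<epsilon> K) *\<^sub>R E K (x, s)))\<^sup>2 +
      (L2_norm_mesh M (\<lambda>K x. sqrt (\<mu> K) *\<^sub>R H K (x, s)))\<^sup>2))"

end

theory Submission
  imports Defs
begin

text \<open>Consistency is pointwise: the mass terms of \<open>B\<close> and \<open>R\<close> coincide, the tangential jumps of a piecewise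
  smooth solution vanish almost everywhere on the interfaces, and on the boundary the integrands agree
  by the boundary condition.

  For a Trefftz polynomial \<open>u = (E, H)\<close>, Poynting's theorem on each element expresses the change of the
  mass over a time slab through the integral of \<open>2 (n \<times> H) \<bullet> E\<close> over \<open>\<partial>K \<times> I\<close>. On an
  interface the two contributions add up to twice \<open>[n \<times> H] \<bullet> {E} - [n \<times> E] \<bullet> {H}\<close>, so that
  \<open>B(u, u)\<close> is half the sum of the masses at both ends of the slab plus \<open>\<beta>\<close> times the integral of
  \<open>|n \<times> H|\<^sup>2\<close> over the boundary. With \<open>B(u, u) = R(u', u)\<close> this is the energy identity.
  If \<open>B(u, u) = 0\<close>, then \<open>u\<close> vanishes at the final time of the slab, hence everywhere because it is a
  polynomial solution of Maxwell's equations; so the finite-dimensional problem is uniquely solvable.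

  The divergence theorem on a polyhedron is obtained one coordinate at a time: almost every line parallel
  to an axis crosses the boundary transversally, in finitely many points that lie on a single plane
  each, and the surface element of a plane projects to area with the Jacobian \<open>|n\<^sub>i|\<close>.\<close>

subsection \<open>Planes\<close>

text \<open>The obstacle is measure-theoretic: the surface measure is a sum over uncountably many
  planes, its product with time is completed, and \<open>outward_normal\<close> is a definite
  description that is meaningful only off the edges and not obviously measurable. Therefore all
  planes carrying the boundaries of the domain and of the elements are gathered in one finite
  family, and face integrals are rewritten over a single \<sigma>-finite measure,
  \<open>sheets\<close>, with a Borel substitute for the normal. Almost every point of
  \<open>sheets\<close> lies on one plane only. An element with such a point on its frontier is a
  half ball near it, so the combinatorics of faces reduces to counting half balls, and no list of
  faces, edges or vertices appears; nonconvex elements and hanging nodes are covered alike.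
  Polynomials live on all of space-time, so identities known on one element continue beyond it. This
  turns the vanishing of a field at one time into a Cauchy problem on the whole space, free of
  boundary conditions.\<close>

lemma isometry_affine_linear:
  fixes f :: "'a::real_inner \<Rightarrow> 'b::real_inner"
  assumes "\<And>x y. dist (f x) (f y) = dist x y"
  shows "linear (\<lambda>x. f x - f 0)" and "(f x - f 0) \<bullet> (f y - f 0) = x \<bullet> y"
proof -
  define h where "h = (\<lambda>x. f x - f 0)"
  have n: "norm (h x - h y) = norm (x - y)" for x y
    using assms[of x y] by (simp add: h_def dist_norm)
  have n0: "norm (h x) = norm x" for x
    using n[of x 0] by (simp add: h_def)
  have ip: "h x \<bullet> h y = x \<bullet> y" for x y
    using n[of x y] n0[of x] n0[of y] by (simp add: dot_norm_neg)
  show "(f x - f 0) \<bullet> (f y - f 0) = x \<bullet> y"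
    using ip[of x y] by (simp add: h_def)
  \<comment> \<open>By \<open>ip\<close>, inner products of values of \<open>h\<close> may be
    computed with the arguments instead, so this is the squared norm of
    \<open>x + y - x - y\<close>.\<close>
  have "(h (x + y) - h x - h y) \<bullet> (h (x + y) - h x - h y) = 0" for x y
    by (simp add: inner_diff_left inner_diff_right inner_add_left inner_add_right ip inner_commute)
  then have add: "h (x + y) = h x + h y" for x y
    using inner_eq_zero_iff[of "h (x + y) - h x - h y"] by (simp add: algebra_simps)
  have "(h (r *\<^sub>R x) - r *\<^sub>R h x) \<bullet> (h (r *\<^sub>R x) - r *\<^sub>R h x) = 0" for r x
    by (simp add: inner_diff_left inner_diff_right ip inner_commute)
  then have "h (r *\<^sub>R x) = r *\<^sub>R h x" for r x
    using inner_eq_zero_iff[of "h (r *\<^sub>R x) - r *\<^sub>R h x" for r x] by simp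
  then show "linear (\<lambda>x. f x - f 0)"
    using add unfolding h_def[symmetric] by (intro linearI) auto
qed

text \<open>The very choice made inside \<open>plane_measure\<close>, given a name so that surface
  integrals can be computed in it.\<close>

definition plane_chart :: "vec3 set \<Rightarrow> real^2 \<Rightarrow> vec3" where
  "plane_chart P = (SOME \<phi>. (\<forall>a b. dist (\<phi> a) (\<phi> b) = dist a b) \<and> range \<phi> = P)"

text \<open>Its orientation is that of an arbitrary chart, so outward normals are compared with it
  only up to sign.\<close>

definition plane_normal :: "vec3 set \<Rightarrow> vec3" where
  "plane_normal P = cross3 (plane_chart P (axis 1 1) - plane_chart P 0) (plane_chart P (axis 2 1) - plane_chart P 0)"

lemma plane_measure_chart: "plane_measure P = distr lborel borel (plane_chart P)"
  by (simp add: plane_measure_def plane_chart_def)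

text \<open>The direction space of a plane is a subspace of dimension 2, hence an isometric image of
  \<open>real^2\<close>; translating back by a point of the plane gives a chart, and the choice
  operator then picks one.\<close>

lemma plane_chart:
  assumes "P \<in> planes"
  shows dist_plane_chart: "dist (plane_chart P a) (plane_chart P b) = dist a b"
    and range_plane_chart: "range (plane_chart P) = P"
proof -
  have P: "affine P" "aff_dim P = 2" using assms by (auto simp: planes_def)
  then have "P \<noteq> {}" by auto
  then obtain c where c: "c \<in> P" by auto
  define S where "S = (\<lambda>x. -c + x) ` P"
  have S: "subspace S" unfolding S_def
    using P c by (metis subspace_affine affine_translation ab_left_minus image_eqI)
  have "int (dim S) = aff_dim P"
    unfolding S_def by (simp add: aff_dim_dim_affine_diffs [OF \<open>affine P\<close> c] uminus_add_conv_diff)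
  then have "dim (UNIV :: (real^2) set) = dim S" using P by simp
  then obtain f g where fg: "linear f" "f ` (UNIV :: (real^2) set) = S" "\<And>x. norm (f x) = norm x"
    using isometries_subspaces[OF subspace_UNIV S] by (metis UNIV_I)
  have "\<exists>\<phi> :: real^2 \<Rightarrow> vec3. (\<forall>a b. dist (\<phi> a) (\<phi> b) = dist a b) \<and> range \<phi> = P"
  proof (intro exI conjI allI)
    show "dist (c + f a) (c + f b) = dist a b" for a b
      by (simp add: dist_norm linear_diff[OF fg(1), symmetric] fg(3))
    have "range (\<lambda>y. c + f y) = (\<lambda>x. c + x) ` S"
      using fg(2) by (auto simp: image_def)
    also have "\<dots> = P" by (simp add: S_def image_image)
    finally show "range (\<lambda>y. c + f y) = P" .
  qed
  then have *: "(\<forall>a b. dist (plane_chart P a) (plane_chart P b) = dist a b) \<and> range (plane_chart P) = P"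
    unfolding plane_chart_def by (rule someI_ex)
  then show "dist (plane_chart P a) (plane_chart P b) = dist a b" "range (plane_chart P) = P" by auto
qed

lemma continuous_plane_chart: "P \<in> planes \<Longrightarrow> continuous_on S (plane_chart P)"
  by (auto simp: continuous_on_iff dist_plane_chart)

lemma plane_chart_in: "P \<in> planes \<Longrightarrow> plane_chart P y \<in> P"
  using range_plane_chart by blast

lemma measurable_plane_chart [measurable]: "P \<in> planes \<Longrightarrow> plane_chart P \<in> borel_measurable borel"
  by (intro borel_measurable_continuous_onI continuous_plane_chart)

lemma plane_chart_expand:
  assumes "P \<in> planes"
  shows "plane_chart P y = plane_chart P 0 + (y $ 1) *\<^sub>R (plane_chart P (axis 1 1) - plane_chart P 0)
     + (y $ 2) *\<^sub>R (plane_chart P (axis 2 1) - plane_chart P 0)"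
proof -
  let ?h = "\<lambda>x. plane_chart P x - plane_chart P 0"
  have l: "linear ?h" using isometry_affine_linear(1)[of "plane_chart P"] dist_plane_chart[OF assms] by blast
  have "y = (y $ 1) *\<^sub>R axis 1 1 + (y $ 2) *\<^sub>R axis 2 1"
    by (simp add: vec_eq_iff forall_2 axis_def)
  then have "?h y = (y $ 1) *\<^sub>R ?h (axis 1 1) + (y $ 2) *\<^sub>R ?h (axis 2 1)"
    using linear_add[OF l] linear_scale[OF l] by metis
  then show ?thesis by (simp add: algebra_simps)
qed

lemma plane_axes:
  assumes "P \<in> planes"
  defines "e1 \<equiv> plane_chart P (axis 1 1) - plane_chart P 0" and "e2 \<equiv> plane_chart P (axis 2 1) - plane_chart P 0"
  shows "e1 \<bullet> e1 = 1" "e2 \<bullet> e2 = 1" "e1 \<bullet> e2 = 0"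
  using isometry_affine_linear(2)[of "plane_chart P"] dist_plane_chart[OF assms(1)]
  unfolding e1_def e2_def by (simp_all add: inner_axis_axis)

lemma norm_plane_normal: assumes "P \<in> planes" shows "norm (plane_normal P) = 1"
proof -
  have "(norm (plane_normal P))\<^sup>2 = 1"
    using norm_cross_dot[of "plane_chart P (axis 1 1) - plane_chart P 0" "plane_chart P (axis 2 1) - plane_chart P 0"]
      plane_axes[OF assms] unfolding plane_normal_def by (simp add: norm_eq_sqrt_inner)
  then show ?thesis using norm_ge_zero[of "plane_normal P"] by (auto simp: power2_eq_1_iff simp del: norm_ge_zero)
qed

lemma plane_normal_chart:
  assumes "P \<in> planes"
  shows "plane_normal P \<bullet> plane_chart P y = plane_normal P \<bullet> plane_chart P 0"
  by (subst plane_chart_expand[OF assms]) (simp add: plane_normal_def inner_add_right dot_cross_self)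

text \<open>Only one inclusion is computed. An affine set contained in another one of the same
  dimension equals it.\<close>

lemma plane_eq_hyperplane:
  assumes "P \<in> planes"
  shows "P = {x. plane_normal P \<bullet> x = plane_normal P \<bullet> plane_chart P 0}" (is "P = ?H")
proof -
  have n: "plane_normal P \<noteq> 0" using norm_plane_normal[OF assms] by auto
  have sub: "P \<subseteq> ?H" using plane_normal_chart[OF assms] by (subst range_plane_chart[OF assms, symmetric]) auto
  have "affine P" "affine ?H" "aff_dim P = aff_dim ?H" "P \<noteq> {}"
    using assms n by (auto simp: planes_def affine_hyperplane aff_dim_hyperplane)
  then show ?thesis using sub affine_dim_equal by blast
qed

lemma plane_eqI:
  assumes "P \<in> planes" "x \<in> P"
  shows "P = {y. plane_normal P \<bullet> (y - x) = 0}"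
proof -
  have "plane_normal P \<bullet> x = plane_normal P \<bullet> plane_chart P 0"
    using plane_eq_hyperplane[OF assms(1)] assms(2) by blast
  then show ?thesis by (subst plane_eq_hyperplane[OF assms(1)]) (auto simp: inner_diff_right)
qed

lemma closed_plane: "P \<in> planes \<Longrightarrow> closed P"
  by (subst plane_eq_hyperplane) (auto simp: closed_hyperplane)

lemma borel_plane [measurable]: "P \<in> planes \<Longrightarrow> P \<in> sets borel"
  by (simp add: closed_plane borel_closed)

text \<open>In cyclic order, the shadow that a plane casts in direction \<open>i\<close> has as Jacobian exactly the
  \<open>i\<close>-th component of the normal.\<close>

definition cyclic :: "3 \<Rightarrow> 3 \<Rightarrow> 3 \<Rightarrow> bool" where
  "cyclic i j k \<longleftrightarrow> (i, j, k) \<in> {(1, 2, 3), (2, 3, 1), (3, 1, 2)}"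

lemma cyclic_ex: "\<exists>j k. cyclic i j k"
  using exhaust_3[of i] by (auto simp: cyclic_def)

lemma cyclic_UNIV: assumes "cyclic i j k" shows "UNIV = {i, j, k}" "i \<noteq> j" "j \<noteq> k" "i \<noteq> k"
proof -
  have "(1::3) \<noteq> 2" "(2::3) \<noteq> 3" "(1::3) \<noteq> 3" by simp_all
  then show "i \<noteq> j" "j \<noteq> k" "i \<noteq> k" using assms unfolding cyclic_def by force+
  show "UNIV = {i, j, k}"
    using assms UNIV_3 unfolding cyclic_def by blast
qed

text \<open>The projection along the remaining coordinate axis onto the coordinate plane of
  \<open>j\<close> and \<open>k\<close>.\<close>

definition shadow :: "3 \<Rightarrow> 3 \<Rightarrow> vec3 \<Rightarrow> real^2" where
  "shadow j k x = vector [x $ j, x $ k]"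

lemma shadow_nth [simp]: "shadow j k x $ 1 = x $ j" "shadow j k x $ 2 = x $ k"
  by (simp_all add: shadow_def)

lemma linear_shadow: "linear (shadow j k)"
  by (rule linearI) (simp_all add: vec_eq_iff forall_2)

text \<open>The change of variables formula for an affine bijection, in the preimage form that
  pushed-forward measures ask for. Boundedness of \<open>B\<close> keeps all measures finite, so
  that the image formula for Lebesgue measurable sets can be applied to the preimage.\<close>

lemma emeasure_linear_vimage_box:
  fixes g :: "real^'n::{finite,wellorder} \<Rightarrow> real^'n::_"
  assumes g: "linear g" "det (matrix g) \<noteq> 0" and B: "B \<in> sets borel" "bounded B"
  shows "ennreal \<bar>det (matrix g)\<bar> * emeasure lborel ((\<lambda>x. c + g x) -` B) = emeasure lborel B"
proof -
  obtain h where h: "linear h" "\<And>x. h (g x) = x" "\<And>x. g (h x) = x"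
    using linear_injective_isomorphism[OF g(1)] g(2) det_nz_iff_inj[OF g(1)] by blast
  let ?S = "(\<lambda>x. c + g x) -` B"
  have meas: "(\<lambda>x. c + g x) \<in> borel_measurable borel"
    by (intro borel_measurable_continuous_onI continuous_intros linear_continuous_on linear_conv_bounded_linear[THEN iffD1] g)
  have SB: "?S \<in> sets borel" using measurable_sets_borel[OF meas B(1)] .
  have eq: "?S = h ` ((\<lambda>x. x - c) ` B)"
  proof (intro equalityI subsetI)
    fix x assume "x \<in> ?S"
    then have "c + g x \<in> B" by simp
    moreover have "x = h ((c + g x) - c)" using h by simp
    ultimately show "x \<in> h ` ((\<lambda>x. x - c) ` B)" by blast
  qed (use h in auto)
  have "bounded ((\<lambda>x. x - c) ` B)" using bounded_translation_minus[OF B(2)] .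
  then have "bounded ?S" unfolding eq using bounded_linear_image linear_conv_bounded_linear h(1) by blast
  then have Sm: "?S \<in> lmeasurable" using SB by (simp add: bounded_set_imp_lmeasurable)
  have "g ` ?S = (\<lambda>x. x - c) ` B" unfolding eq image_image using h by auto
  then have "measure lebesgue ((\<lambda>x. x - c) ` B) = \<bar>det (matrix g)\<bar> * measure lebesgue ?S"
    using measure_linear_image[OF g(1) Sm] by simp
  then have m: "measure lebesgue B = \<bar>det (matrix g)\<bar> * measure lebesgue ?S"
    by (simp add: measure_translation_subtract)
  have "emeasure lborel ?S = ennreal (measure lebesgue ?S)"
    using Sm SB by (simp add: fmeasurable_def emeasure_eq_ennreal_measure)
  moreover have "emeasure lborel B = ennreal (measure lebesgue B)"
    using B bounded_set_imp_lmeasurable[of B] by (simp add: fmeasurable_def emeasure_eq_ennreal_measure)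
  ultimately show ?thesis using m by (simp add: ennreal_mult)
qed

lemma det_shadow_plane:
  assumes "P \<in> planes" "cyclic i j k"
  shows "det (matrix (\<lambda>y. shadow j k (plane_chart P y - plane_chart P 0))) = plane_normal P $ i"
  using assms(2) by (auto simp: cyclic_def det_2 matrix_def plane_normal_def cross3_def)

text \<open>Lebesgue measure is determined by its values on boxes, where this is the change of
  variables for the chart followed by the shadow, an affine map whose determinant is a component of
  the normal. If that component were 0, the plane would be parallel to axis \<open>i\<close> and its
  shadow a line.\<close>

lemma lborel_shadow_plane:
  assumes P: "P \<in> planes" and c: "cyclic i j k" and nz: "plane_normal P $ i \<noteq> 0"
  shows "lborel = density (distr lborel borel (\<lambda>y. shadow j k (plane_chart P y))) (\<lambda>_. ennreal \<bar>plane_normal P $ i\<bar>)"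
    (is "_ = density (distr _ _ ?\<psi>) _")
proof (rule lborel_eqI)
  let ?g = "\<lambda>y. shadow j k (plane_chart P y - plane_chart P 0)"
  have g: "linear ?g"
    using linear_compose[OF isometry_affine_linear(1)[of "plane_chart P"] linear_shadow[of j k]]
      dist_plane_chart[OF P] by (simp add: o_def)
  have eq: "?\<psi> = (\<lambda>y. shadow j k (plane_chart P 0) + ?g y)"
    by (simp add: linear_diff[OF linear_shadow])
  have meas[measurable]: "?\<psi> \<in> borel_measurable borel"
    by (intro borel_measurable_continuous_onI continuous_on_compose2[OF linear_continuous_on continuous_plane_chart[OF P]])
      (auto intro: linear_shadow simp: linear_conv_bounded_linear[symmetric])
  fix l u :: "real^2" assume lu: "\<And>b. b \<in> Basis \<Longrightarrow> l \<bullet> b \<le> u \<bullet> b"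
  have "emeasure (density (distr lborel borel ?\<psi>) (\<lambda>_. ennreal \<bar>plane_normal P $ i\<bar>)) (box l u)
      = ennreal \<bar>plane_normal P $ i\<bar> * emeasure lborel (?\<psi> -` box l u)"
    by (simp add: emeasure_density nn_integral_cmult emeasure_distr)
  also have "\<dots> = emeasure lborel (box l u)"
    unfolding det_shadow_plane[OF P c, symmetric] eq
    using det_shadow_plane[OF P c] nz
    by (intro emeasure_linear_vimage_box g) auto
  also have "\<dots> = (\<Prod>b\<in>Basis. (u - l) \<bullet> b)" using lu by (simp add: emeasure_lborel_box)
  finally show "emeasure (density (distr lborel borel ?\<psi>) (\<lambda>_. ennreal \<bar>plane_normal P $ i\<bar>)) (box l u) = (\<Prod>b\<in>Basis. (u - l) \<bullet> b)" .
qed simp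

subsection \<open>Surface measures\<close>

text \<open>In chart coordinates \<open>Q\<close> has the equation \<open>a \<bullet> y = b\<close>,
  which describes a line or the empty set unless \<open>a\<close> and \<open>b\<close> both vanish.
  In that case \<open>P\<close> is contained in \<open>Q\<close>, and equality of dimensions gives
  \<open>P = Q\<close>.\<close>

lemma null_plane_vimage:
  assumes P: "P \<in> planes" and Q: "Q \<in> planes" and "P \<noteq> Q"
  shows "plane_chart P -` Q \<in> null_sets lborel"
proof -
  define a :: "real^2" where "a = vector [plane_normal Q \<bullet> (plane_chart P (axis 1 1) - plane_chart P 0),
     plane_normal Q \<bullet> (plane_chart P (axis 2 1) - plane_chart P 0)]"
  define b where "b = plane_normal Q \<bullet> plane_chart Q 0 - plane_normal Q \<bullet> plane_chart P 0"
  have ab: "plane_normal Q \<bullet> plane_chart P y = plane_normal Q \<bullet> plane_chart P 0 + a \<bullet> y" for y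
  proof -
    have "a \<bullet> y = a $ 1 * y $ 1 + a $ 2 * y $ 2" by (simp add: inner_vec_def sum_2)
    moreover have "a $ 1 = plane_normal Q \<bullet> (plane_chart P (axis 1 1) - plane_chart P 0)"
      "a $ 2 = plane_normal Q \<bullet> (plane_chart P (axis 2 1) - plane_chart P 0)"
      by (simp_all add: a_def)
    ultimately show ?thesis
      unfolding plane_chart_expand[OF P, of y] inner_add_right inner_scaleR_right by (simp only: mult.commute add.assoc)
  qed
  have eq: "plane_chart P -` Q = {y. a \<bullet> y = b}"
  proof -
    have "plane_chart P y \<in> Q \<longleftrightarrow> a \<bullet> y = b" for y
    proof -
      have "plane_chart P y \<in> Q \<longleftrightarrow> plane_normal Q \<bullet> plane_chart P y = plane_normal Q \<bullet> plane_chart Q 0"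
        using plane_eq_hyperplane[OF Q] by blast
      then show ?thesis unfolding ab[of y] b_def by linarith
    qed
    then show ?thesis by auto
  qed
  have "\<not> (a = 0 \<and> b = 0)"
  proof
    assume "a = 0 \<and> b = 0"
    then have "plane_chart P y \<in> Q" for y using eq by auto
    then have "range (plane_chart P) \<subseteq> Q" by auto
    then have "P \<subseteq> Q" using range_plane_chart[OF P] by simp
    moreover have "P \<noteq> {}" using plane_chart_in[OF P] by blast
    ultimately show False
      using affine_dim_equal[of P Q] P Q \<open>P \<noteq> Q\<close> by (simp add: planes_def)
  qed
  then have "negligible {y. a \<bullet> y = b}"
    using negligible_hyperplane[of a b] by (cases "a = 0") auto
  moreover have "{y. a \<bullet> y = b} \<in> sets borel" by (simp add: closed_hyperplane)
  ultimately show ?thesis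
    unfolding eq negligible_iff_null_sets by (simp add: null_sets_completion_iff)
qed

text \<open>All surface measures are restrictions of this \<open>\<sigma>\<close>-finite measure.\<close>

definition sheets :: "vec3 set set \<Rightarrow> vec3 measure" where
  "sheets \<P> = distr (count_space \<P> \<Otimes>\<^sub>M lborel) borel (\<lambda>(P, y). plane_chart P y)"

lemma sets_sheets [simp, measurable_cong]: "sets (sheets \<P>) = sets borel"
  and space_sheets [simp]: "space (sheets \<P>) = UNIV"
  by (simp_all add: sheets_def)

locale plane_family =
  fixes \<P> :: "vec3 set set"
  assumes finite_family: "finite \<P>" and family_planes: "\<P> \<subseteq> planes"
begin

lemma measurable_charts:
  "(\<lambda>(P, y). plane_chart P y) \<in> borel_measurable (count_space \<P> \<Otimes>\<^sub>M lborel)"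
proof (rule measurable_pair_measure_countable1)
  show "countable \<P>" using finite_family by (rule countable_finite)
  fix P assume "P \<in> \<P>"
  then have "P \<in> planes" using family_planes by auto
  then show "(\<lambda>y. case (P, y) of (P, y) \<Rightarrow> plane_chart P y) \<in> borel_measurable lborel"
    by simp
qed

lemma nn_integral_sheets:
  assumes [measurable]: "f \<in> borel_measurable borel"
  shows "(\<integral>\<^sup>+x. f x \<partial>sheets \<P>) = (\<Sum>P\<in>\<P>. \<integral>\<^sup>+y. f (plane_chart P y) \<partial>lborel)"
proof -
  note measurable_charts[measurable]
  have "(\<integral>\<^sup>+x. f x \<partial>sheets \<P>) = (\<integral>\<^sup>+z. f (case z of (P, y) \<Rightarrow> plane_chart P y) \<partial>(count_space \<P> \<Otimes>\<^sub>M lborel))"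
    unfolding sheets_def by (rule nn_integral_distr) measurable
  also have "\<dots> = (\<integral>\<^sup>+P. \<integral>\<^sup>+y. f (plane_chart P y) \<partial>lborel \<partial>count_space \<P>)"
    by (subst lborel.nn_integral_fst[symmetric]) simp_all
  finally show ?thesis using finite_family by (simp add: nn_integral_count_space_finite)
qed

lemma emeasure_sheets:
  assumes "A \<in> sets borel"
  shows "emeasure (sheets \<P>) A = (\<Sum>P\<in>\<P>. emeasure lborel (plane_chart P -` A))"
proof -
  have m: "plane_chart P -` A \<in> sets borel" if "P \<in> \<P>" for P
    using measurable_sets_borel[OF measurable_plane_chart assms] that family_planes by blast
  have "emeasure (sheets \<P>) A = (\<Sum>P\<in>\<P>. \<integral>\<^sup>+y. indicator A (plane_chart P y) \<partial>lborel)"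
    using assms by (simp add: nn_integral_indicator[symmetric] nn_integral_sheets del: nn_integral_indicator)
  also have "\<dots> = (\<Sum>P\<in>\<P>. \<integral>\<^sup>+y. indicator (plane_chart P -` A) y \<partial>lborel)"
    by (simp add: indicator_def)
  finally show ?thesis using m by simp
qed

lemma integral_sheets:
  fixes f :: "vec3 \<Rightarrow> real"
  assumes "integrable (sheets \<P>) f"
  shows "(LINT x|sheets \<P>. f x) = (\<Sum>P\<in>\<P>. LINT y|lborel. f (plane_chart P y))"
proof -
  note measurable_charts[measurable]
  have [measurable]: "f \<in> borel_measurable borel" using assms by auto
  interpret C: sigma_finite_measure "count_space \<P>"
    by (rule sigma_finite_measure_count_space_finite[OF finite_family])
  interpret CL: pair_sigma_finite "count_space \<P>" lborel ..
  have "integrable (count_space \<P> \<Otimes>\<^sub>M lborel) (\<lambda>z. f (case z of (P, y) \<Rightarrow> plane_chart P y))"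
    using assms unfolding sheets_def by (subst (asm) integrable_distr_eq) auto
  from CL.integral_fst'[OF this]
  have "(LINT z|(count_space \<P> \<Otimes>\<^sub>M lborel). f (case z of (P, y) \<Rightarrow> plane_chart P y))
     = (LINT P|count_space \<P>. LINT y|lborel. f (plane_chart P y))" by simp
  moreover have "(LINT x|sheets \<P>. f x) = (LINT z|(count_space \<P> \<Otimes>\<^sub>M lborel). f (case z of (P, y) \<Rightarrow> plane_chart P y))"
    unfolding sheets_def by (rule integral_distr) measurable
  ultimately show ?thesis using finite_family by (simp add: lebesgue_integral_count_space_finite)
qed

text \<open>Charts are isometries, so preimages of balls are bounded and have finite area; there are
  finitely many charts.\<close>

lemma emeasure_sheets_bounded:
  assumes "bounded A"
  shows "emeasure (sheets \<P>) A < \<infinity>"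
proof -
  obtain r where "\<forall>x\<in>A. norm x \<le> r" using assms by (auto simp: bounded_iff)
  then have r: "A \<subseteq> cball 0 r" by auto
  have "bounded (plane_chart P -` cball 0 r)" if "P \<in> \<P>" for P
  proof -
    have "P \<in> planes" using that family_planes by auto
    then have "norm y \<le> r + norm (plane_chart P 0)" if "norm (plane_chart P y) \<le> r" for y
      using dist_plane_chart[of P y 0] norm_triangle_ineq4[of "plane_chart P y" "plane_chart P 0"] that
      by (simp add: dist_norm)
    then show ?thesis unfolding bounded_iff by (intro exI[of _ "r + norm (plane_chart P 0)"]) auto
  qed
  then have "emeasure lborel (plane_chart P -` cball 0 r) < \<infinity>" if "P \<in> \<P>" for P
    using that emeasure_bounded_finite by blast
  then have "emeasure (sheets \<P>) (cball 0 r) < \<infinity>"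
    using finite_family by (simp add: emeasure_sheets)
  moreover have "emeasure (sheets \<P>) A \<le> emeasure (sheets \<P>) (cball 0 r)"
    using r by (intro emeasure_mono) auto
  ultimately show ?thesis by (rule le_less_trans[rotated])
qed

sublocale sheets: sigma_finite_measure "sheets \<P>"
proof
  show "\<exists>A. countable A \<and> A \<subseteq> sets (sheets \<P>) \<and> \<Union>A = space (sheets \<P>) \<and> (\<forall>a\<in>A. emeasure (sheets \<P>) a \<noteq> \<infinity>)"
  proof (intro exI[of _ "range (\<lambda>n. cball 0 (real n))"] conjI ballI)
    show "\<Union>(range (\<lambda>n. cball (0::vec3) (real n))) = space (sheets \<P>)"
    proof -
      have "x \<in> \<Union>(range (\<lambda>n. cball (0::vec3) (real n)))" for x
        using real_arch_simple[of "norm x"] by auto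
      then show ?thesis unfolding space_sheets by blast
    qed
    show "emeasure (sheets \<P>) a \<noteq> \<infinity>" if "a \<in> range (\<lambda>n. cball (0::vec3) (real n))" for a
      using emeasure_sheets_bounded[of a] that by auto
  qed auto
qed

sublocale space_time: pair_sigma_finite "sheets \<P>" lborel
  by unfold_locales

text \<open>A plane outside the family meets \<open>S\<close> only inside its intersections with the
  finitely many members, and these are null in its chart. So the sum over all planes collapses to a
  sum over the family.\<close>

lemma surface_measure_sheets:
  assumes S: "S \<in> sets borel" "S \<subseteq> \<Union>\<P>"
  shows "surface_measure S = density (sheets \<P>) (indicator S)"
proof -
  let ?D = "density (sheets \<P>) (indicator S)"
  have D: "emeasure ?D A = emeasure (sheets \<P>) (A \<inter> S)" if "A \<in> sets borel" for A
    using that S by (simp add: emeasure_density indicator_inter_arith[symmetric] Int_commute)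
  have *: "(\<integral>\<^sup>+P. emeasure (plane_measure P) (A \<inter> S) \<partial>count_space planes) = emeasure ?D A"
    if A: "A \<in> sets borel" for A
  proof -
    have e: "emeasure (plane_measure P) (A \<inter> S) = emeasure lborel (plane_chart P -` (A \<inter> S))" if "P \<in> planes" for P
      using that A S by (simp add: plane_measure_chart emeasure_distr)
    have "plane_chart P -` (A \<inter> S) \<in> null_sets lborel" if P: "P \<in> planes" "P \<notin> \<P>" for P
    proof (rule null_sets_subset)
      show "(\<Union>Q\<in>\<P>. plane_chart P -` Q) \<in> null_sets lborel"
        using P family_planes by (intro null_sets_UN' countable_finite finite_family null_plane_vimage) auto
      show "plane_chart P -` (A \<inter> S) \<in> sets lborel"
        using measurable_sets_borel[OF measurable_plane_chart[OF P(1)], of "A \<inter> S"] A S by simp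
    qed (use S in auto)
    then have z: "emeasure (plane_measure P) (A \<inter> S) = 0" if "P \<in> planes" "P \<notin> \<P>" for P
      using that e by auto
    have "(\<integral>\<^sup>+P. emeasure (plane_measure P) (A \<inter> S) \<partial>count_space planes)
       = (\<Sum>P\<in>\<P>. emeasure (plane_measure P) (A \<inter> S))"
      using family_planes z finite_family by (intro nn_integral_count_space') auto
    also have "\<dots> = emeasure (sheets \<P>) (A \<inter> S)"
      using A S e family_planes by (subst emeasure_sheets) (auto intro!: sum.cong)
    finally show ?thesis using D[OF A] by simp
  qed
  have sig: "sigma_sets UNIV (sets borel) = sets (borel :: vec3 measure)"
    using sets.sigma_sets_eq[of "borel :: vec3 measure"] by simp
  \<comment> \<open>\<open>measure_of\<close> would return the zero measure if the given set
    function were not a measure; here it agrees on Borel sets with one.\<close>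
  have "surface_measure S = measure_of UNIV (sets borel) (emeasure ?D)"
    unfolding surface_measure_def using * sig by (intro measure_of_eq) auto
  also have "\<dots> = measure_of (space ?D) (sets ?D) (emeasure ?D)" by simp
  also have "\<dots> = ?D" by (rule measure_of_of_measure)
  finally show ?thesis .
qed

end

section \<open>Integrals with respect to completed measures\<close>

lemma completion_measurable_cong_AE:
  fixes f g :: "'a \<Rightarrow> 'b::topological_space"
  assumes ae: "AE x in M. f x = g x"
  shows "f \<in> borel_measurable (completion M) \<longleftrightarrow> g \<in> borel_measurable (completion M)"
proof -
  have *: "g \<in> borel_measurable (completion M)"
    if f: "f \<in> borel_measurable (completion M)" and ae: "AE x in M. f x = g x" for f g :: "'a \<Rightarrow> 'b"
  proof (rule measurableI)
    fix A :: "'b set" assume A: "A \<in> sets borel"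
    show "g -` A \<inter> space (completion M) \<in> sets (completion M)"
    proof (rule completion.in_sets_AE)
      show "f -` A \<inter> space (completion M) \<in> sets (completion M)" using f A by (rule measurable_sets)
      show "AE x in completion M. (x \<in> f -` A \<inter> space (completion M)) = (x \<in> g -` A \<inter> space (completion M))"
        using AE_completion[OF ae] by eventually_elim auto
    qed auto
  qed auto
  have "AE x in M. g x = f x" using ae by eventually_elim simp
  then show ?thesis using *[of f g] *[of g f] ae by blast
qed

text \<open>Over a completion, measurability depends only on the class of a function modulo null
  sets. Hence two almost equal functions are both measurable or both not, and in the second case
  both integrals have the default value 0. Face integrals can therefore be compared before anything
  is known about integrability.\<close>

lemma completion_integral_cong_AE:
  fixes f g :: "'a \<Rightarrow> real"
  assumes ae: "AE x in M. f x = g x"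
  shows "integral\<^sup>L (completion M) f = integral\<^sup>L (completion M) g"
proof (cases "f \<in> borel_measurable (completion M)")
  case True
  then show ?thesis
    using AE_completion[OF ae] completion_measurable_cong_AE[OF ae] by (intro integral_cong_AE) auto
next
  case False
  then have "\<not> integrable (completion M) f" "\<not> integrable (completion M) g"
    using completion_measurable_cong_AE[OF ae] by (auto dest: borel_measurable_integrable)
  then show ?thesis by (simp add: not_integrable_integral_eq)
qed

text \<open>Restricting a measure to \<open>A\<close> does not affect the measurability of functions vanishing outside
  \<open>A\<close>; for non-measurable \<open>f\<close> both integrals have the junk value 0.\<close>

lemma completion_integral_density_indicator:
  fixes f :: "'a \<Rightarrow> real"
  assumes A[measurable]: "A \<in> sets M" and f0: "\<And>x. x \<notin> A \<Longrightarrow> f x = 0"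
  shows "integral\<^sup>L (completion (density M (indicator A))) f = integral\<^sup>L (completion M) f"
proof (cases "f \<in> borel_measurable (completion (density M (indicator A)))")
  case True
  from completion_ex_borel_measurable_real[OF True] obtain f'
    where "f' \<in> borel_measurable (density M (indicator A))" and ae: "AE x in density M (indicator A). f x = f' x"
    by blast
  then have f'[measurable]: "f' \<in> borel_measurable M" by simp
  have "AE x in M. f x = indicator A x * f' x"
    using ae f0 by (subst (asm) AE_density) (auto elim!: eventually_mono split: split_indicator)
  then have "integral\<^sup>L (completion M) f = (LINT x|completion M. indicator A x * f' x)"
    by (rule completion_integral_cong_AE)
  also have "\<dots> = (LINT x|M. indicator A x *\<^sub>R f' x)" by (simp add: integral_completion)
  also have "\<dots> = integral\<^sup>L (density M (\<lambda>x. ennreal (indicator A x))) f'" by (subst integral_density) auto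
  also have "\<dots> = integral\<^sup>L (completion (density M (indicator A))) f'"
    by (simp add: integral_completion ennreal_indicator)
  also have "\<dots> = integral\<^sup>L (completion (density M (indicator A))) f"
    by (rule completion_integral_cong_AE) (use ae in eventually_elim, simp)
  finally show ?thesis by simp
next
  case False
  have "f \<notin> borel_measurable (completion M)"
  proof
    assume "f \<in> borel_measurable (completion M)"
    from completion_ex_borel_measurable_real[OF this] obtain f'
      where f'[measurable]: "f' \<in> borel_measurable M" and ae: "AE x in M. f x = f' x"
      by blast
    have "AE x in density M (indicator A). f x = f' x"
      using ae by (subst AE_density) (auto elim!: eventually_mono)
    from completion_measurable_cong_AE[OF this] False show False
      by (auto intro!: measurable_completion)
  qed
  with False show ?thesis
    by (metis borel_measurable_integrable not_integrable_integral_eq)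
qed

section \<open>Face integrals as integrals over the sheets\<close>

context plane_family
begin

lemma borel_times: "S \<in> sets borel \<Longrightarrow> I \<in> sets borel \<Longrightarrow> S \<times> I \<in> sets (sheets \<P> \<Otimes>\<^sub>M lborel)"
  by (intro pair_measureI) auto

lemma sets_space_time: "sets (sheets \<P> \<Otimes>\<^sub>M lborel) = sets (borel :: (vec3 \<times> real) measure)"
proof -
  have "sets (sheets \<P> \<Otimes>\<^sub>M lborel) = sets ((borel :: vec3 measure) \<Otimes>\<^sub>M (borel :: real measure))"
    by (rule sets_pair_measure_cong) simp_all
  then show ?thesis by (simp only: borel_prod)
qed

lemma measurable_space_time: "borel_measurable (sheets \<P> \<Otimes>\<^sub>M lborel) = borel_measurable (borel :: (vec3 \<times> real) measure)"
  using sets_space_time by (intro measurable_cong_sets) simp_all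

lemma face_time_measure_sheets:
  assumes S: "S \<in> sets borel" "S \<subseteq> \<Union>\<P>"
  shows "face_time_measure S = completion (density (sheets \<P> \<Otimes>\<^sub>M lborel) (indicator (S \<times> UNIV)))"
proof -
  have "surface_measure S \<Otimes>\<^sub>M lborel = density (sheets \<P>) (indicator S) \<Otimes>\<^sub>M density lborel (\<lambda>_. 1)"
    by (simp add: surface_measure_sheets[OF S] density_1)
  also have "\<dots> = density (sheets \<P> \<Otimes>\<^sub>M lborel) (\<lambda>(x, y). indicator S x * 1)"
    using S by (intro pair_measure_density) (auto simp: density_1 lborel.sigma_finite_measure_axioms)
  also have "(\<lambda>(x, y). indicator S x * 1) = (indicator (S \<times> (UNIV :: real set)) :: _ \<Rightarrow> ennreal)"
    by (auto simp: fun_eq_iff indicator_def)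
  finally show ?thesis by (simp add: face_time_measure_def)
qed

lemma AE_face_time_measure:
  assumes S: "S \<in> sets borel" "S \<subseteq> \<Union>\<P>"
  shows "(AE z in face_time_measure S. Q z) \<longleftrightarrow> (AE z in sheets \<P> \<Otimes>\<^sub>M lborel. fst z \<in> S \<longrightarrow> Q z)"
proof -
  have "indicator (S \<times> UNIV) \<in> borel_measurable (sheets \<P> \<Otimes>\<^sub>M lborel)"
    by (intro borel_measurable_indicator borel_times S) simp
  then have "(AE z in face_time_measure S. Q z) \<longleftrightarrow> (AE z in sheets \<P> \<Otimes>\<^sub>M lborel. (0::ennreal) < indicator (S \<times> UNIV) z \<longrightarrow> Q z)"
    unfolding face_time_measure_sheets[OF S] AE_completion_iff by (rule AE_density)
  also have "(\<lambda>z. (0::ennreal) < indicator (S \<times> UNIV) z \<longrightarrow> Q z) = (\<lambda>z. fst z \<in> S \<longrightarrow> Q z)"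
    by (auto simp: fun_eq_iff indicator_def)
  finally show ?thesis .
qed

lemma face_time_integral_completion:
  assumes S: "S \<in> sets borel" "S \<subseteq> \<Union>\<P>" and I: "I \<in> sets borel"
  shows "face_time_integral S I F = (LINT z|completion (sheets \<P> \<Otimes>\<^sub>M lborel). indicator (S \<times> I) z * F z)"
  unfolding face_time_integral_def set_lebesgue_integral_def face_time_measure_sheets[OF S]
  using completion_integral_density_indicator[OF borel_times[OF S(1), of UNIV], of "\<lambda>z. indicator (S \<times> I) z * F z"]
  by auto

lemma face_time_integral_cong_AE:
  assumes S: "S \<in> sets borel" "S \<subseteq> \<Union>\<P>" and I: "I \<in> sets borel"
    and ae: "AE z in sheets \<P> \<Otimes>\<^sub>M lborel. z \<in> S \<times> I \<longrightarrow> F z = G z"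
  shows "face_time_integral S I F = face_time_integral S I G"
  unfolding face_time_integral_completion[OF S I]
  by (rule completion_integral_cong_AE) (use ae in \<open>auto elim!: eventually_mono simp: indicator_def\<close>)

lemma face_time_integral_borel:
  assumes S: "S \<in> sets borel" "S \<subseteq> \<Union>\<P>" and I: "I \<in> sets borel"
    and F: "F \<in> borel_measurable borel"
  shows "face_time_integral S I F = (LINT z|(sheets \<P> \<Otimes>\<^sub>M lborel). indicator (S \<times> I) z * F z)"
proof -
  have "(\<lambda>z. indicator (S \<times> I) z * F z) \<in> borel_measurable (sheets \<P> \<Otimes>\<^sub>M lborel)"
    using F borel_times[OF S(1) I] unfolding measurable_space_time[symmetric]
    by (intro borel_measurable_times borel_measurable_indicator) auto
  then show ?thesis
    unfolding face_time_integral_completion[OF S I] by (rule integral_completion)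
qed

end

subsection \<open>Normals of polyhedra\<close>

definition half_ball :: "vec3 \<Rightarrow> real \<Rightarrow> vec3 \<Rightarrow> vec3 set" where
  "half_ball x r n = {y \<in> ball x r. n \<bullet> (y - x) < 0}"

lemma is_outward_normal_half_ball:
  "is_outward_normal D x n \<longleftrightarrow> norm n = 1 \<and> (\<exists>r>0. half_ball x r n \<subseteq> D \<and> half_ball x r (- n) \<inter> D = {})"
  unfolding is_outward_normal_def half_ball_def by fastforce

lemma half_ball_mono: "r \<le> s \<Longrightarrow> half_ball x r n \<subseteq> half_ball x s n"
  by (auto simp: half_ball_def)

lemma open_half_ball: "open (half_ball x r n)"
proof -
  have "half_ball x r n = ball x r \<inter> {y. n \<bullet> y < n \<bullet> x}"
    by (auto simp: half_ball_def inner_diff_right)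
  then show ?thesis by (simp add: open_Int open_halfspace_lt)
qed

lemma connected_half_ball: "connected (half_ball x r n)"
proof -
  have "half_ball x r n = ball x r \<inter> {y. n \<bullet> y < n \<bullet> x}"
    by (auto simp: half_ball_def inner_diff_right)
  then show ?thesis by (simp add: convex_connected convex_Int convex_halfspace_lt)
qed

text \<open>A small step of length \<open>d\<close> against \<open>n\<close> makes the inner product
  strictly negative without leaving the ball.\<close>

lemma closure_half_ball:
  assumes n: "norm n = 1" and y: "y \<in> ball x r" "n \<bullet> (y - x) \<le> 0"
  shows "y \<in> closure (half_ball x r n)"
  unfolding closure_approachable
proof (intro allI impI)
  fix e :: real assume "e > 0"
  define d where "d = min (e / 2) ((r - dist x y) / 2)"
  have d: "0 < d" "d < e" "d < r - dist x y" using \<open>e > 0\<close> y by (auto simp: d_def min_def)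
  have nn: "n \<bullet> n = 1" using n by (simp add: norm_eq_sqrt_inner)
  have "dist x (y - d *\<^sub>R n) \<le> dist x y + d"
    using norm_triangle_ineq[of "x - y" "d *\<^sub>R n"] n d by (simp add: dist_norm algebra_simps)
  then have "dist x (y - d *\<^sub>R n) < r" using d by linarith
  moreover have "n \<bullet> (y - d *\<^sub>R n - x) < 0" using y(2) d nn by (simp add: inner_diff_right)
  ultimately have "y - d *\<^sub>R n \<in> half_ball x r n" by (simp add: half_ball_def)
  moreover have "dist (y - d *\<^sub>R n) y < e" using d n by (simp add: dist_norm)
  ultimately show "\<exists>z\<in>half_ball x r n. dist z y < e" by blast
qed

lemma half_ball_nonempty: "norm n = 1 \<Longrightarrow> 0 < r \<Longrightarrow> half_ball x r n \<noteq> {}"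
  using closure_half_ball[of n x x r] by auto

lemma ball_subset_closure_half_balls:
  assumes "norm n = 1"
  shows "ball x r \<subseteq> closure (half_ball x r n) \<union> closure (half_ball x r (- n))"
  using closure_half_ball[of n] closure_half_ball[of "- n"] assms by fastforce

text \<open>For distinct unit vectors \<open>n \<bullet> m < 1\<close>, so the direction
  \<open>m - n\<close> points inwards for \<open>n\<close> and outwards for \<open>m\<close>. A
  point slightly off \<open>x\<close> in this direction would be both inside and outside
  \<open>D\<close>.\<close>

lemma is_outward_normal_unique:
  assumes n: "is_outward_normal D x n" and m: "is_outward_normal D x m"
  shows "n = m"
proof (rule ccontr)
  assume ne: "n \<noteq> m"
  obtain r where r: "0 < r" "\<And>y. y \<in> ball x r \<Longrightarrow> n \<bullet> (y - x) < 0 \<Longrightarrow> y \<in> D" and n1: "norm n = 1"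
    using n unfolding is_outward_normal_def by blast
  obtain s where s: "0 < s" "\<And>y. y \<in> ball x s \<Longrightarrow> m \<bullet> (y - x) > 0 \<Longrightarrow> y \<notin> D" and m1: "norm m = 1"
    using m unfolding is_outward_normal_def by blast
  \<comment> \<open>Chosen so that the point \<open>y\<close> below has distance
    \<open>min r s / 2\<close> from \<open>x\<close> and lies in both balls.\<close>
  define \<delta> where "\<delta> = min r s / (2 * norm (m - n))"
  have nm: "norm (m - n) > 0" using ne by simp
  have \<delta>: "\<delta> > 0" using r s nm by (simp add: \<delta>_def)
  have nn: "n \<bullet> n = 1" "m \<bullet> m = 1" using n1 m1 by (simp_all add: norm_eq_sqrt_inner)
  have "0 < (m - n) \<bullet> (m - n)" using ne by simp
  then have lt: "n \<bullet> m < 1" using nn by (simp add: inner_diff_left inner_diff_right inner_commute)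
  define y where "y = x + \<delta> *\<^sub>R (m - n)"
  have "dist x y = \<delta> * norm (m - n)" using \<delta> by (simp add: y_def dist_norm)
  then have "dist x y = min r s / 2" using nm by (simp add: \<delta>_def)
  then have "dist x y < r" "dist x y < s" using r(1) s(1) by (simp_all add: min_def split: if_splits)
  moreover have "n \<bullet> (y - x) < 0" "m \<bullet> (y - x) > 0"
    using \<delta> lt nn by (simp_all add: y_def inner_diff_right inner_commute mult_pos_neg)
  ultimately show False using r(2)[of y] s(2)[of y] by auto
qed

lemma outward_normal_eqI: "is_outward_normal D x n \<Longrightarrow> outward_normal D x = n"
  unfolding outward_normal_def using is_outward_normal_unique by blast

text \<open>The open half ball is connected and avoids the frontier of \<open>D\<close>, which near
  \<open>x\<close> stays in the bounding plane.\<close>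

lemma half_ball_dichotomy:
  assumes fr: "frontier D \<inter> ball x r \<subseteq> {y. n \<bullet> (y - x) = 0}"
  shows "half_ball x r n \<subseteq> D \<or> half_ball x r n \<inter> D = {}"
proof (rule ccontr)
  assume "\<not> ?thesis"
  then have "half_ball x r n \<inter> frontier D \<noteq> {}"
    by (intro connected_Int_frontier connected_half_ball) auto
  then show False using fr by (auto simp: half_ball_def)
qed

text \<open>Each of the two half balls lies inside or outside \<open>K\<close>. If both are inside,
  closedness makes \<open>x\<close> an interior point. If both are outside, the interior of
  \<open>K\<close> misses their closures and hence the whole ball, against
  \<open>K = closure (interior K)\<close>. So exactly one is inside.\<close>

lemma polyhedral_element_normal:
  assumes K: "polyhedral_element K" and x: "x \<in> frontier K" and r: "0 < r" and n: "norm n = 1"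
    and fr: "frontier K \<inter> ball x r \<subseteq> {y. n \<bullet> (y - x) = 0}"
  shows "is_outward_normal K x n \<or> is_outward_normal K x (- n)"
proof (rule ccontr)
  assume neg: "\<not> ?thesis"
  have Kc: "closed K" and Kr: "K = closure (interior K)"
    using K by (auto simp: polyhedral_element_def compact_imp_closed)
  have fr': "frontier K \<inter> ball x r \<subseteq> {y. - n \<bullet> (y - x) = 0}" using fr by auto
  have "(half_ball x r n \<subseteq> K \<and> half_ball x r (- n) \<subseteq> K) \<or> (half_ball x r n \<inter> K = {} \<and> half_ball x r (- n) \<inter> K = {})"
    using half_ball_dichotomy[OF fr] half_ball_dichotomy[OF fr'] neg r n
    unfolding is_outward_normal_half_ball by auto
  then show False
  proof
    assume "half_ball x r n \<subseteq> K \<and> half_ball x r (- n) \<subseteq> K"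
    then have "closure (half_ball x r n) \<union> closure (half_ball x r (- n)) \<subseteq> K"
      using Kc by (simp add: closure_minimal)
    then have "ball x r \<subseteq> K" using ball_subset_closure_half_balls[OF n, of x r] by blast
    then have "x \<in> interior K" using r by (meson centre_in_ball interior_maximal open_ball subsetD)
    then show False using x by (simp add: frontier_def)
  next
    assume e: "half_ball x r n \<inter> K = {} \<and> half_ball x r (- n) \<inter> K = {}"
    have "x \<in> closure (interior K)" using x Kc Kr by (auto simp: frontier_def)
    then obtain y where y: "y \<in> interior K" "dist y x < r"
      using r by (auto simp: closure_approachable)
    have yb: "y \<in> ball x r" using y by (simp add: dist_commute)
    have op: "open (interior K \<inter> ball x r)" by auto
    have "closure (half_ball x r n) \<inter> (interior K \<inter> ball x r) = {}"
      "closure (half_ball x r (- n)) \<inter> (interior K \<inter> ball x r) = {}"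
      using e interior_subset[of K] op by (auto simp: open_Int_closure_eq_empty Int_commute[of "closure _"])
    then show False using ball_subset_closure_half_balls[OF n, of x r] y yb by blast
  qed
qed

text \<open>Both sets contain the half ball of the smaller radius. In a mesh this means that
  distinct elements never lie on the same side of a face.\<close>

lemma same_normal_overlap:
  assumes "is_outward_normal A x n" "is_outward_normal B x n"
  shows "interior A \<inter> interior B \<noteq> {}"
proof -
  obtain r s where rs: "0 < r" "half_ball x r n \<subseteq> A" "0 < s" "half_ball x s n \<subseteq> B" "norm n = 1"
    using assms unfolding is_outward_normal_half_ball by auto
  have "half_ball x (min r s) n \<subseteq> A" "half_ball x (min r s) n \<subseteq> B"
    using rs half_ball_mono[of "min r s" r x n] half_ball_mono[of "min r s" s x n] by auto
  then have "half_ball x (min r s) n \<subseteq> interior A \<inter> interior B"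
    by (simp add: interior_maximal open_half_ball)
  then show ?thesis using half_ball_nonempty[of n "min r s" x] rs by auto
qed

text \<open>This excludes cracks, that is, boundary faces with the domain on both sides. A point
  moved from \<open>x\<close> in direction \<open>e\<close> keeps its foot point but rises above the
  graph, and the part of \<open>U\<close> above the graph is open and free of \<Omega>.\<close>

lemma lipschitz_domain_ball:
  assumes L: "lipschitz_domain \<Omega>" and x: "x \<in> frontier \<Omega>" and r: "0 < r"
  shows "\<not> ball x r \<subseteq> closure \<Omega>"
proof
  assume sub: "ball x r \<subseteq> closure \<Omega>"
  obtain U e L \<gamma> where U: "open U" "x \<in> U" and e: "norm e = 1" and lip: "L-lipschitz_on {y. y \<bullet> e = 0} \<gamma>"
    and eq: "\<Omega> \<inter> U = {y\<in>U. y \<bullet> e < \<gamma> (y - (y \<bullet> e) *\<^sub>R e)}"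
    using L x unfolding lipschitz_domain_def by blast
  have ee: "e \<bullet> e = 1" using e by (simp add: norm_eq_sqrt_inner)
  have "open \<Omega>" using L by (simp add: lipschitz_domain_def)
  then have "x \<notin> \<Omega>" using x by (simp add: frontier_def interior_open)
  then have xg: "x \<bullet> e \<ge> \<gamma> (x - (x \<bullet> e) *\<^sub>R e)" using eq U by (metis (mono_tags, lifting) IntD1 mem_Collect_eq not_le)
  obtain s where s: "0 < s" "ball x s \<subseteq> U" using U openE by blast
  define d where "d = min r s / 2"
  have d: "0 < d" "d < r" "d < s" using r s by (auto simp: d_def)
  define y where "y = x + d *\<^sub>R e"
  have yU: "y \<in> U" "y \<in> ball x r" using s d e by (auto simp: y_def dist_norm subset_iff)
  have cont: "continuous_on UNIV (\<lambda>z. \<gamma> (z - (z \<bullet> e) *\<^sub>R e))"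
    by (rule continuous_on_compose2[OF lipschitz_on_continuous_on[OF lip]])
      (auto intro!: continuous_intros simp: inner_diff_left ee)
  have "open {z. \<gamma> (z - (z \<bullet> e) *\<^sub>R e) < z \<bullet> e}"
    by (rule open_Collect_less[OF cont]) (intro continuous_intros)
  then have opV: "open (U \<inter> {z. \<gamma> (z - (z \<bullet> e) *\<^sub>R e) < z \<bullet> e})" using U by auto
  have "(U \<inter> {z. \<gamma> (z - (z \<bullet> e) *\<^sub>R e) < z \<bullet> e}) \<inter> \<Omega> = {}"
  proof -
    have "z \<bullet> e < \<gamma> (z - (z \<bullet> e) *\<^sub>R e)" if "z \<in> U" "z \<in> \<Omega>" for z
      using eq that by blast
    then show ?thesis by force
  qed
  then have "(U \<inter> {z. \<gamma> (z - (z \<bullet> e) *\<^sub>R e) < z \<bullet> e}) \<inter> closure \<Omega> = {}"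
    using opV by (simp add: open_Int_closure_eq_empty)
  moreover have "y - (y \<bullet> e) *\<^sub>R e = x - (x \<bullet> e) *\<^sub>R e" "y \<bullet> e = x \<bullet> e + d"
    by (simp_all add: y_def inner_add_left ee algebra_simps)
  ultimately have "y \<notin> closure \<Omega>" using yU xg d by auto
  then show False using sub yU by auto
qed

section \<open>Generic points and a measurable normal\<close>

context plane_family
begin

text \<open>At such a point all frontiers carried by the family are locally contained in one plane,
  so the mesh consists there of half balls; edges and vertices, where two planes meet, are left
  out.\<close>

definition generic :: "vec3 \<Rightarrow> bool" where
  "generic x \<longleftrightarrow> (\<forall>P\<in>\<P>. \<forall>Q\<in>\<P>. x \<in> P \<longrightarrow> x \<in> Q \<longrightarrow> P = Q)"

lemma planes_family: "P \<in> \<P> \<Longrightarrow> P \<in> planes"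
  using family_planes by auto

lemma generic_AE: "AE x in sheets \<P>. generic x"
proof -
  have "P \<inter> Q \<in> null_sets (sheets \<P>)" if PQ: "P \<in> \<P>" "Q \<in> \<P>" "P \<noteq> Q" for P Q
  proof -
    have b: "P \<inter> Q \<in> sets borel" using PQ planes_family by auto
    have "emeasure lborel (plane_chart R -` (P \<inter> Q)) = 0" if R: "R \<in> \<P>" for R
    proof -
      \<comment> \<open>\<open>R\<close> differs from \<open>P\<close> or from \<open>Q\<close>, so
        the intersection lies in a member of the family other than \<open>R\<close>, which is null
        in the chart of \<open>R\<close>.\<close>
      obtain S where S: "S \<in> \<P>" "R \<noteq> S" "P \<inter> Q \<subseteq> S" using PQ R by (cases "R = P") auto
      have "plane_chart R -` (P \<inter> Q) \<in> null_sets lborel"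
      proof (rule null_sets_subset[OF null_plane_vimage[of R S]])
        show "plane_chart R -` (P \<inter> Q) \<in> sets lborel"
          using measurable_sets_borel[OF measurable_plane_chart b] planes_family[OF R] by simp
      qed (use S R planes_family in auto)
      then show ?thesis by auto
    qed
    then show ?thesis using b by (simp add: null_sets_def emeasure_sheets)
  qed
  then have "(\<Union>P\<in>\<P>. \<Union>Q\<in>\<P> - {P}. P \<inter> Q) \<in> null_sets (sheets \<P>)"
    using finite_family by (intro null_sets_UN' countable_finite finite_Diff) auto
  then show ?thesis
    by (rule AE_I') (auto simp: generic_def)
qed

lemma AE_space_time:
  assumes "AE x in sheets \<P>. Q x"
  shows "AE z in sheets \<P> \<Otimes>\<^sub>M lborel. Q (fst z)"
proof -
  obtain N where N: "N \<in> null_sets (sheets \<P>)" "{x \<in> space (sheets \<P>). \<not> Q x} \<subseteq> N"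
    using assms unfolding eventually_ae_filter by auto
  have "N \<times> UNIV \<in> null_sets (sheets \<P> \<Otimes>\<^sub>M lborel)"
    using N(1) by (intro lborel.times_in_null_sets1) auto
  then show ?thesis by (rule AE_I') (use N in auto)
qed

text \<open>The other planes of the family are finitely many, so their union is closed and keeps a
  positive distance from \<open>x\<close>.\<close>

lemma generic_ball:
  assumes "generic x" "P \<in> \<P>" "x \<in> P"
  obtains r where "0 < r" "ball x r \<inter> \<Union>\<P> \<subseteq> {y. plane_normal P \<bullet> (y - x) = 0}"
proof -
  have cl: "closed (\<Union>(\<P> - {P}))" using finite_family closed_plane planes_family by (intro closed_Union) auto
  have "x \<notin> \<Union>(\<P> - {P})" using assms by (auto simp: generic_def)
  then obtain r where r: "0 < r" "ball x r \<subseteq> - \<Union>(\<P> - {P})"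
    using cl by (metis ComplI open_Compl openE)
  then have "ball x r \<inter> \<Union>\<P> \<subseteq> P" by blast
  then show thesis using r that plane_eqI[OF planes_family[OF assms(2)] assms(3)] by blast
qed

text \<open>A Borel measurable substitute for the outward normal, equal to it at generic points.\<close>

definition unit_normal :: "vec3 set \<Rightarrow> vec3 \<Rightarrow> vec3" where
  "unit_normal D x = (\<Sum>P\<in>\<P>. (indicator {x \<in> P. is_outward_normal D x (plane_normal P)} x -
      indicator {x \<in> P. is_outward_normal D x (- plane_normal P)} x) *\<^sub>R plane_normal P)"

text \<open>The set is relatively open in the closed set \<open>P\<close>: moving \<open>x\<close>
  within the plane does not change the number \<open>n \<bullet> (w - x)\<close>, so half the radius
  still serves for nearby points.\<close>

lemma borel_normal_set:
  assumes P: "P \<in> planes" and n: "n = plane_normal P \<or> n = - plane_normal P"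
  shows "{x \<in> P. is_outward_normal D x n} \<in> sets borel"
proof -
  have "openin (top_of_set P) {x \<in> P. is_outward_normal D x n}"
    unfolding openin_contains_ball
  proof (intro conjI ballI)
    fix x assume "x \<in> {x \<in> P. is_outward_normal D x n}"
    then obtain r where x: "x \<in> P" and n1: "norm n = 1" and r: "0 < r"
      "\<And>y. y \<in> ball x r \<Longrightarrow> n \<bullet> (y - x) < 0 \<Longrightarrow> y \<in> D"
      "\<And>y. y \<in> ball x r \<Longrightarrow> n \<bullet> (y - x) > 0 \<Longrightarrow> y \<notin> D"
      unfolding is_outward_normal_def by auto
    have "is_outward_normal D y n" if y: "y \<in> ball x (r / 2)" "y \<in> P" for y
      unfolding is_outward_normal_def
    proof (intro conjI exI[of _ "r / 2"] ballI impI n1)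
      have "plane_normal P \<bullet> (y - x) = 0" using plane_eqI[OF P x] y(2) by blast
      then have "n \<bullet> (y - x) = 0" using n by auto
      then have e: "n \<bullet> (w - y) = n \<bullet> (w - x)" for w by (simp add: inner_diff_right)
      fix w assume "w \<in> ball y (r / 2)"
      then have w: "w \<in> ball x r" using y(1) dist_triangle_half_r[of y x r w] by (auto simp: dist_commute)
      show "w \<in> D" if "n \<bullet> (w - y) < 0" using r(2)[OF w] that e by simp
      show "w \<notin> D" if "n \<bullet> (w - y) > 0" using r(3)[OF w] that e by simp
    qed (use r in auto)
    then show "\<exists>e>0. ball x e \<inter> P \<subseteq> {x \<in> P. is_outward_normal D x n}"
      using r(1) by (intro exI[of _ "r / 2"]) auto
  qed auto
  then obtain T where "open T" "{x \<in> P. is_outward_normal D x n} = P \<inter> T" unfolding openin_open by blast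
  then show ?thesis using P by auto
qed

lemma borel_measurable_unit_normal [measurable]: "unit_normal D \<in> borel_measurable borel"
  unfolding unit_normal_def[abs_def]
  by (intro borel_measurable_sum borel_measurable_scaleR borel_measurable_diff borel_measurable_indicator
      borel_measurable_const borel_normal_set planes_family) auto

text \<open>A crude bound that holds also at nongeneric points, where several summands may
  contribute; it serves only for integrability.\<close>

lemma norm_unit_normal_le: "norm (unit_normal D x) \<le> 2 * real (card \<P>)"
proof -
  have "norm (unit_normal D x) \<le> (\<Sum>P\<in>\<P>. 2)"
    unfolding unit_normal_def
  proof (intro order_trans[OF norm_sum] sum_mono)
    fix P assume "P \<in> \<P>"
    then have "norm (plane_normal P) = 1" using norm_plane_normal planes_family by blast
    then show "norm ((indicator {x \<in> P. is_outward_normal D x (plane_normal P)} x -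
      indicator {x \<in> P. is_outward_normal D x (- plane_normal P)} x) *\<^sub>R plane_normal P) \<le> 2"
      by (auto simp: indicator_def)
  qed
  then show ?thesis by simp
qed

lemma unit_normal_eq:
  assumes g: "generic x" and P: "P \<in> \<P>" "x \<in> P" and n: "is_outward_normal D x n"
    and eq: "n = plane_normal P \<or> n = - plane_normal P"
  shows "unit_normal D x = n"
proof -
  have nz: "plane_normal P \<noteq> - plane_normal P"
    using norm_plane_normal[OF planes_family[OF P(1)]] by (metis norm_zero zero_neq_one eq_neg_iff_add_eq_0 scaleR_2 scaleR_eq_0_iff zero_neq_numeral)
  have "unit_normal D x = (\<Sum>Q\<in>{P}. (indicator {x \<in> Q. is_outward_normal D x (plane_normal Q)} x -
      indicator {x \<in> Q. is_outward_normal D x (- plane_normal Q)} x) *\<^sub>R plane_normal Q)"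
    unfolding unit_normal_def using g P finite_family
    by (intro sum.mono_neutral_right) (auto simp: generic_def indicator_def)
  also have "\<dots> = n"
    using eq
  proof
    assume e: "n = plane_normal P"
    then have "\<not> is_outward_normal D x (- plane_normal P)" using n nz is_outward_normal_unique by metis
    then show ?thesis using e n P by simp
  next
    assume e: "n = - plane_normal P"
    then have "\<not> is_outward_normal D x (plane_normal P)" using n nz is_outward_normal_unique by metis
    then show ?thesis using e n P by simp
  qed
  finally show ?thesis .
qed

end

section \<open>Local structure of the mesh at a generic point\<close>

locale mesh_family = plane_family +
  fixes \<Omega> :: "vec3 set" and M :: "vec3 set set"
  assumes bounded_domain: "bounded \<Omega>" and lipschitz: "lipschitz_domain \<Omega>" and mesh: "polyhedral_mesh \<Omega> M"
    and domain_family: "frontier \<Omega> \<subseteq> \<Union>\<P>" and mesh_family: "\<And>K. K \<in> M \<Longrightarrow> frontier K \<subseteq> \<Union>\<P>"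
begin

lemma finite_mesh: "finite M" and element: "K \<in> M \<Longrightarrow> polyhedral_element K" and mesh_cover: "\<Union>M = closure \<Omega>"
  and mesh_disjoint: "K1 \<in> M \<Longrightarrow> K2 \<in> M \<Longrightarrow> K1 \<noteq> K2 \<Longrightarrow> interior K1 \<inter> interior K2 = {}"
  using mesh by (auto simp: polyhedral_mesh_def)

lemma element_compact: "K \<in> M \<Longrightarrow> compact K" and element_closed: "K \<in> M \<Longrightarrow> closed K"
  and element_closure_interior: "K \<in> M \<Longrightarrow> closure (interior K) = K" and element_nonempty: "K \<in> M \<Longrightarrow> K \<noteq> {}"
  using element by (auto simp: polyhedral_element_def compact_imp_closed)

lemma element_interior: "K \<in> M \<Longrightarrow> interior K \<noteq> {}"
  using element_closure_interior element_nonempty by (metis closure_empty)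

lemma frontier_mem: "K \<in> M \<Longrightarrow> x \<in> frontier K \<Longrightarrow> x \<in> K"
  using element_closed frontier_subset_closed by blast

lemma element_normal:
  assumes K: "K \<in> M" "x \<in> frontier K" and g: "generic x" and P: "P \<in> \<P>" "x \<in> P"
  shows "\<exists>n. is_outward_normal K x n \<and> (n = plane_normal P \<or> n = - plane_normal P)"
proof -
  obtain r where r: "0 < r" "ball x r \<inter> \<Union>\<P> \<subseteq> {y. plane_normal P \<bullet> (y - x) = 0}"
    using generic_ball[OF g P] .
  have "frontier K \<inter> ball x r \<subseteq> {y. plane_normal P \<bullet> (y - x) = 0}" using r mesh_family[OF K(1)] by blast
  from polyhedral_element_normal[OF element[OF K(1)] K(2) r(1) norm_plane_normal[OF planes_family[OF P(1)]] this]
  show ?thesis by blast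
qed

lemma element_normal_ex:
  assumes K: "K \<in> M" "x \<in> frontier K" and g: "generic x"
  obtains n where "is_outward_normal K x n" "unit_normal K x = n" "outward_normal K x = n" "norm n = 1"
proof -
  obtain P where P: "P \<in> \<P>" "x \<in> P" using K mesh_family by blast
  obtain n where n: "is_outward_normal K x n" "n = plane_normal P \<or> n = - plane_normal P"
    using element_normal[OF K g P] by blast
  show thesis
    using that[OF n(1)] unit_normal_eq[OF g P n] outward_normal_eqI[OF n(1)] n(1)
    by (auto simp: is_outward_normal_def)
qed

text \<open>Both normals equal that of the plane up to sign, and equal signs would make the
  interiors overlap.\<close>

lemma opposite_normals:
  assumes K1: "K1 \<in> M" "x \<in> frontier K1" and K2: "K2 \<in> M" "x \<in> frontier K2" and ne: "K1 \<noteq> K2" and g: "generic x"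
    and n: "is_outward_normal K1 x n"
  shows "is_outward_normal K2 x (- n)"
proof -
  obtain P where P: "P \<in> \<P>" "x \<in> P" using K1 mesh_family by blast
  obtain n1 n2 where "is_outward_normal K1 x n1" "n1 = plane_normal P \<or> n1 = - plane_normal P"
      "is_outward_normal K2 x n2" "n2 = plane_normal P \<or> n2 = - plane_normal P"
    using element_normal[OF K1 g P] element_normal[OF K2 g P] by blast
  moreover then have "n1 = n" using n is_outward_normal_unique by blast
  moreover have "n1 \<noteq> n2"
    using same_normal_overlap mesh_disjoint[OF K1(1) K2(1) ne] calculation by blast
  ultimately show ?thesis by auto
qed

text \<open>The inner half ball lies in the closure of \<Omega> and misses its frontier, so it lies
  in \<Omega>. The outer one is inside or outside \<Omega>; inside would place a whole ball in the
  closure, which the Lipschitz property forbids.\<close>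

lemma domain_normal:
  assumes K: "K \<in> M" "x \<in> frontier K" and x: "x \<in> frontier \<Omega>" and g: "generic x" and n: "is_outward_normal K x n"
  shows "is_outward_normal \<Omega> x n"
proof -
  obtain P where P: "P \<in> \<P>" "x \<in> P" using K mesh_family by blast
  have nP: "n = plane_normal P \<or> n = - plane_normal P"
    using element_normal[OF K g P] is_outward_normal_unique[OF n] by blast
  obtain r where r: "0 < r" "ball x r \<inter> \<Union>\<P> \<subseteq> {y. plane_normal P \<bullet> (y - x) = 0}"
    using generic_ball[OF g P] .
  obtain s where s: "0 < s" "half_ball x s n \<subseteq> K" and n1: "norm n = 1"
    using n unfolding is_outward_normal_half_ball by blast
  define q where "q = min r s"
  have q: "0 < q" "q \<le> r" "q \<le> s" using r s by (auto simp: q_def)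
  have fr: "frontier \<Omega> \<inter> ball x q \<subseteq> {y. n \<bullet> (y - x) = 0}" "frontier \<Omega> \<inter> ball x q \<subseteq> {y. - n \<bullet> (y - x) = 0}"
  proof -
    have "frontier \<Omega> \<inter> ball x q \<subseteq> {y. plane_normal P \<bullet> (y - x) = 0}"
      using r(2) domain_family subset_ball[OF q(2), of x] by blast
    then show "frontier \<Omega> \<inter> ball x q \<subseteq> {y. n \<bullet> (y - x) = 0}" "frontier \<Omega> \<inter> ball x q \<subseteq> {y. - n \<bullet> (y - x) = 0}"
      using nP by auto
  qed
  have sub: "half_ball x q n \<subseteq> closure \<Omega>" using s half_ball_mono[OF q(3), of x n] K mesh_cover by blast
  moreover have "half_ball x q n \<inter> frontier \<Omega> = {}" using fr by (auto simp: half_ball_def)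
  ultimately have 1: "half_ball x q n \<subseteq> \<Omega>"
    using closure_Un_frontier[of \<Omega>] by blast
  have 2: "half_ball x q (- n) \<inter> \<Omega> = {}"
  proof (rule ccontr)
    assume "\<not> ?thesis"
    then have "half_ball x q (- n) \<subseteq> \<Omega>" using half_ball_dichotomy[OF fr(2)] by blast
    then have "ball x q \<subseteq> closure \<Omega>"
      using ball_subset_closure_half_balls[OF n1, of x q] closure_mono[OF 1] closure_mono[of "half_ball x q (- n)" \<Omega>] by blast
    then show False using lipschitz_domain_ball[OF lipschitz x q(1)] by blast
  qed
  show ?thesis unfolding is_outward_normal_half_ball using 1 2 q n1 by blast
qed

text \<open>Two elements would have opposite normals there, and the domain would inherit
  both.\<close>

lemma boundary_one_element:
  assumes "K1 \<in> M" "x \<in> frontier K1" "K2 \<in> M" "x \<in> frontier K2" "generic x" "x \<in> frontier \<Omega>"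
  shows "K1 = K2"
proof (rule ccontr)
  assume ne: "K1 \<noteq> K2"
  obtain n where n: "is_outward_normal K1 x n" "norm n = 1" using element_normal_ex assms by metis
  have 1: "is_outward_normal \<Omega> x n" by (rule domain_normal[OF assms(1,2,6,5) n(1)])
  have 2: "is_outward_normal \<Omega> x (- n)"
    by (rule domain_normal[OF assms(3,4,6,5)]) (rule opposite_normals[OF assms(1-4) ne assms(5) n(1)])
  have "n = - n" by (rule is_outward_normal_unique[OF 1 2])
  then have "n = 0" by (metis add.right_inverse scaleR_2 scaleR_eq_0_iff zero_neq_numeral)
  then show False using n by simp
qed

text \<open>The half ball on the far side of \<open>K\<close> lies in \<Omega>, so one of its points
  belongs to some element, which by the dichotomy contains all of it. A third element would have the
  same normal as this neighbour and overlap it.\<close>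

lemma interior_two_elements:
  assumes K: "K \<in> M" "x \<in> frontier K" and g: "generic x" and x: "x \<notin> frontier \<Omega>"
  shows "\<exists>!K'. K' \<in> M \<and> K' \<noteq> K \<and> x \<in> frontier K'"
proof -
  obtain P where P: "P \<in> \<P>" "x \<in> P" using K mesh_family by blast
  obtain n where n: "is_outward_normal K x n" "n = plane_normal P \<or> n = - plane_normal P"
    using element_normal[OF K g P] by blast
  obtain s where s: "0 < s" "half_ball x s n \<subseteq> K" "half_ball x s (- n) \<inter> K = {}" and n1: "norm n = 1"
    using n unfolding is_outward_normal_half_ball by blast
  obtain r where r: "0 < r" "ball x r \<inter> \<Union>\<P> \<subseteq> {y. plane_normal P \<bullet> (y - x) = 0}"
    using generic_ball[OF g P] .
  have "x \<in> \<Omega>" using K frontier_mem mesh_cover x closure_Un_frontier[of \<Omega>] by blast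
  moreover have "open \<Omega>" using lipschitz by (simp add: lipschitz_domain_def)
  ultimately obtain q' where q': "0 < q'" "ball x q' \<subseteq> \<Omega>" using openE by blast
  define q where "q = min r (min s q')"
  have q: "0 < q" "q \<le> r" "q \<le> s" "q \<le> q'" using r s q' by (auto simp: q_def)
  obtain y where y: "y \<in> half_ball x q (- n)" using half_ball_nonempty[of "- n" q x] n1 q by auto
  have "y \<in> ball x q'" using y q by (auto simp: half_ball_def)
  then have "y \<in> \<Union>M" using q' mesh_cover closure_subset by blast
  then obtain K' where K': "K' \<in> M" "y \<in> K'" by blast
  have hK: "half_ball x q (- n) \<inter> K = {}" using s half_ball_mono[OF q(3), of x "- n"] by blast
  have ne: "K' \<noteq> K" using y K' hK by blast
  have "frontier K' \<inter> ball x q \<subseteq> {y. plane_normal P \<bullet> (y - x) = 0}"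
    using r(2) mesh_family[OF K'(1)] subset_ball[OF q(2), of x] by blast
  then have "frontier K' \<inter> ball x q \<subseteq> {y. - n \<bullet> (y - x) = 0}" using n(2) by auto
  from half_ball_dichotomy[OF this] have hK': "half_ball x q (- n) \<subseteq> K'" using y K' by blast
  have "x \<in> closure (half_ball x q (- n))" using closure_half_ball[of "- n" x x q] n1 q by auto
  then have xK': "x \<in> K'" using closure_mono[OF hK'] element_closed[OF K'(1)] by auto
  have "x \<notin> interior K'"
  proof
    assume a: "x \<in> interior K'"
    have "x \<in> closure (interior K)" using element_closure_interior[OF K(1)] frontier_mem[OF K] by simp
    then have "interior K' \<inter> interior K \<noteq> {}"
      using a open_Int_closure_eq_empty[OF open_interior] by blast
    then show False using mesh_disjoint[OF K'(1) K(1) ne] by blast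
  qed
  then have fK': "x \<in> frontier K'" using xK' closure_subset by (auto simp: frontier_def)
  show ?thesis
  proof (rule ex1I[of _ K'])
    fix L assume L: "L \<in> M \<and> L \<noteq> K \<and> x \<in> frontier L"
    show "L = K'"
    proof (rule ccontr)
      assume "L \<noteq> K'"
      have "is_outward_normal L x (- n)" by (rule opposite_normals[OF K _ _ _ g n(1)]) (use L in auto)
      moreover have "is_outward_normal K' x (- n)" by (rule opposite_normals[OF K K'(1) fK' _ g n(1)]) (use ne in auto)
      ultimately have "interior L \<inter> interior K' \<noteq> {}" by (rule same_normal_overlap)
      then show False using mesh_disjoint L K' \<open>L \<noteq> K'\<close> by blast
    qed
  qed (use K' ne fK' in auto)
qed

end

subsection \<open>The divergence theorem on polyhedra\<close>

lemma isCont_eventually_eq: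
  fixes f g :: "real \<Rightarrow> real"
  assumes "\<forall>\<^sub>F y in nhds s. f y = g y" "isCont g s"
  shows "isCont f s"
  using isCont_cong[OF assms(1)] assms(2) by simp

text \<open>The boundary values enter through the auxiliary function \<open>h\<close>, in which the jumps of
  \<open>indicator A * f\<close> are compensated by step functions, so that \<open>h\<close> is continuous.\<close>

lemma integral_derivative_compact_real:
  fixes f f' \<sigma> :: "real \<Rightarrow> real"
  assumes A: "compact A" and Z: "finite Z" "frontier A \<subseteq> Z"
    and der: "\<And>x. (f has_real_derivative f' x) (at x)" and cont: "continuous_on UNIV f'"
    and \<sigma>: "\<And>x. x \<in> Z \<Longrightarrow> (\<sigma> x = 1 \<and> (\<exists>r>0. \<forall>y. \<bar>y - x\<bar> < r \<longrightarrow> (y < x \<longrightarrow> y \<in> A) \<and> (y > x \<longrightarrow> y \<notin> A))) \<or>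
       (\<sigma> x = - 1 \<and> (\<exists>r>0. \<forall>y. \<bar>y - x\<bar> < r \<longrightarrow> (y > x \<longrightarrow> y \<in> A) \<and> (y < x \<longrightarrow> y \<notin> A)))"
  shows "(LINT s|lborel. indicator A s * f' s) = (\<Sum>x\<in>Z. \<sigma> x * f x)"
proof -
  \<comment> \<open>\<open>A\<close> is closed and contains its end points, so the compensating step
    must start after a right end point but at a left one.\<close>
  define step where "step = (\<lambda>x y. if \<sigma> x = 1 then of_bool (x < y) else (of_bool (x \<le> y) :: real))"
  define rest where "rest = (\<lambda>s y. \<Sum>x\<in>Z - {s}. \<sigma> x * f x * step x y)"
  define h where "h = (\<lambda>y. indicator A y * f y + (\<Sum>x\<in>Z. \<sigma> x * f x * step x y))"
  have Ac: "closed A" "bounded A" using A by (auto simp: compact_eq_bounded_closed)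
  have contf: "isCont f x" for x using der DERIV_isCont by blast
  have rest_const: "\<forall>\<^sub>F y in nhds s. rest s y = rest s s" for s
  proof -
    have "\<forall>\<^sub>F y in nhds s. step x y = step x s" if "x \<in> Z - {s}" for x
    proof (cases "x < s")
      case True
      then have "\<forall>\<^sub>F y in nhds s. x < y" using eventually_nhds_in_open[of "{x<..}" s] by auto
      then show ?thesis by eventually_elim (use True in \<open>auto simp: step_def\<close>)
    next
      case False
      then have "s < x" using that by auto
      then have "\<forall>\<^sub>F y in nhds s. y < x" using eventually_nhds_in_open[of "{..<x}" s] by auto
      then show ?thesis by eventually_elim (use \<open>s < x\<close> in \<open>auto simp: step_def\<close>)
    qed
    then have "\<forall>\<^sub>F y in nhds s. \<forall>x\<in>Z - {s}. step x y = step x s"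
      using Z by (intro eventually_ball_finite) auto
    then show ?thesis by eventually_elim (auto simp: rest_def)
  qed
  have h_in: "h y = indicator A y * f y + \<sigma> s * f s * step s y + rest s y" if "s \<in> Z" for s y
    using that Z by (simp add: h_def rest_def sum.remove)
  have h_out: "h y = indicator A y * f y + rest s y" if "s \<notin> Z" for s y
    using that by (simp add: h_def rest_def)
  have h_der: "(h has_real_derivative indicator A s * f' s) (at s)" if s: "s \<notin> Z" for s
  proof -
    have "s \<notin> frontier A" using s Z by auto
    then consider "s \<in> interior A" | "s \<in> - A"
      using Ac(1) by (auto simp: frontier_def)
    then have ev: "\<forall>\<^sub>F y in nhds s. indicator A y = (indicator A s :: real)"
    proof cases
      case 1
      then have "\<forall>\<^sub>F y in nhds s. y \<in> interior A" by (intro eventually_nhds_in_open) auto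
      then show ?thesis by eventually_elim (use 1 interior_subset in \<open>auto simp: indicator_def\<close>)
    next
      case 2
      then have "\<forall>\<^sub>F y in nhds s. y \<in> - A" using Ac by (intro eventually_nhds_in_open) auto
      then show ?thesis by eventually_elim (use 2 in \<open>auto simp: indicator_def\<close>)
    qed
    have ev2: "\<forall>\<^sub>F y in nhds s. h y = indicator A s * f y + rest s s"
      using ev rest_const[of s] by eventually_elim (simp add: h_out[OF s])
    have "((\<lambda>y. indicator A s * f y + rest s s) has_real_derivative indicator A s * f' s) (at s)"
      by (auto intro!: derivative_eq_intros der)
    then show ?thesis using DERIV_cong_ev[OF refl ev2 refl] by simp
  qed
  have h_cont: "isCont h s" for s
  proof (cases "s \<in> Z")
    case False
    then show ?thesis using h_der DERIV_isCont by blast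
  next
    case True
    from \<sigma>[OF True] show ?thesis
    proof (elim disjE conjE exE)
      fix r assume 1: "\<sigma> s = 1" and r: "0 < r" and P: "\<forall>y. \<bar>y - s\<bar> < r \<longrightarrow> (y < s \<longrightarrow> y \<in> A) \<and> (s < y \<longrightarrow> y \<notin> A)"
      have "s \<in> closure A"
        unfolding closure_approachable
      proof (intro allI impI)
        fix e :: real assume "e > 0"
        define d where "d = min e r / 2"
        have d: "0 < d" "d < e" "d < r" using \<open>e > 0\<close> r by (auto simp: d_def min_def)
        then have "s - d \<in> A" using P by auto
        then show "\<exists>y\<in>A. dist y s < e" using d by (intro bexI[of _ "s - d"]) (auto simp: dist_real_def)
      qed
      then have sA: "s \<in> A" using Ac by simp
      have "\<forall>\<^sub>F y in nhds s. y \<in> ball s r" using r by (intro eventually_nhds_in_open) auto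
      then have "\<forall>\<^sub>F y in nhds s. h y = f (min y s) + rest s s"
        using rest_const[of s]
      proof eventually_elim
        case (elim y)
        then have "\<bar>y - s\<bar> < r" by (simp add: dist_real_def abs_minus_commute)
        then have "(y < s \<longrightarrow> y \<in> A) \<and> (s < y \<longrightarrow> y \<notin> A)" using P by blast
        then show ?case using elim sA 1 h_in[OF True, of y]
          by (cases y s rule: linorder_cases) (auto simp: step_def min_def)
      qed
      moreover have "isCont (\<lambda>y. f (min y s) + rest s s) s"
      proof -
        have "isCont (\<lambda>y. min y s) s" by (intro continuous_intros)
        then have "isCont (\<lambda>y. f (min y s)) s" by (rule isCont_o2) (rule contf)
        then show ?thesis by (intro continuous_intros)
      qed
      ultimately show ?thesis by (rule isCont_eventually_eq)
    next
      fix r assume 1: "\<sigma> s = - 1" and r: "0 < r" and P: "\<forall>y. \<bar>y - s\<bar> < r \<longrightarrow> (s < y \<longrightarrow> y \<in> A) \<and> (y < s \<longrightarrow> y \<notin> A)"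
      have "s \<in> closure A"
        unfolding closure_approachable
      proof (intro allI impI)
        fix e :: real assume "e > 0"
        define d where "d = min e r / 2"
        have d: "0 < d" "d < e" "d < r" using \<open>e > 0\<close> r by (auto simp: d_def min_def)
        then have "s + d \<in> A" using P by auto
        then show "\<exists>y\<in>A. dist y s < e" using d by (intro bexI[of _ "s + d"]) (auto simp: dist_real_def)
      qed
      then have sA: "s \<in> A" using Ac by simp
      have "\<forall>\<^sub>F y in nhds s. y \<in> ball s r" using r by (intro eventually_nhds_in_open) auto
      then have "\<forall>\<^sub>F y in nhds s. h y = f (max y s) - f s + rest s s"
        using rest_const[of s]
      proof eventually_elim
        case (elim y)
        then have "\<bar>y - s\<bar> < r" by (simp add: dist_real_def abs_minus_commute)
        then have "(s < y \<longrightarrow> y \<in> A) \<and> (y < s \<longrightarrow> y \<notin> A)" using P by blast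
        then show ?case using elim sA 1 h_in[OF True, of y]
          by (cases y s rule: linorder_cases) (auto simp: step_def max_def)
      qed
      moreover have "isCont (\<lambda>y. f (max y s) - f s + rest s s) s"
      proof -
        have "isCont (\<lambda>y. max y s) s" by (intro continuous_intros)
        then have "isCont (\<lambda>y. f (max y s)) s" by (rule isCont_o2) (rule contf)
        then show ?thesis by (intro continuous_intros)
      qed
      ultimately show ?thesis by (rule isCont_eventually_eq)
    qed
  qed
  have "bounded (A \<union> Z)" using Ac Z by (simp add: finite_imp_bounded)
  then obtain R where R: "\<And>x. x \<in> A \<union> Z \<Longrightarrow> \<bar>x\<bar> < R" "0 < R"
    using bounded_pos_less by (metis real_norm_def)
  \<comment> \<open>At \<open>- R\<close> every term of \<open>h\<close> vanishes; at
    \<open>R\<close> all steps have been taken and the indicator is 0. The difference is the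
    boundary sum.\<close>
  have "((\<lambda>s. indicator A s * f' s) has_integral (h R - h (- R))) {- R..R}"
  proof (rule fundamental_theorem_of_calculus_interior_strong[OF Z(1)])
    show "continuous_on {- R..R} h" using h_cont by (simp add: continuous_at_imp_continuous_on)
    show "(h has_vector_derivative indicator A s * f' s) (at s)" if "s \<in> {- R<..<R} - Z" for s
      using h_der[of s] that by (simp add: has_real_derivative_iff_has_vector_derivative)
  qed (use R in auto)
  moreover have "h R = (\<Sum>x\<in>Z. \<sigma> x * f x)"
  proof -
    have "R \<notin> A" using R by fastforce
    moreover have "step x R = 1" if "x \<in> Z" for x using R(1)[of x] that by (auto simp: step_def)
    ultimately show ?thesis by (simp add: h_def)
  qed
  moreover have "h (- R) = 0"
  proof -
    have "- R \<notin> A" using R by fastforce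
    moreover have "step x (- R) = 0" if "x \<in> Z" for x using R(1)[of x] that by (auto simp: step_def)
    ultimately show ?thesis by (simp add: h_def)
  qed
  ultimately have I: "((\<lambda>s. indicator A s * f' s) has_integral (\<Sum>x\<in>Z. \<sigma> x * f x)) {- R..R}" by simp
  have "A \<subseteq> {- R..R}" using R by fastforce
  then have I2: "((\<lambda>s. indicator A s * f' s) has_integral (\<Sum>x\<in>Z. \<sigma> x * f x)) UNIV"
    by (intro has_integral_on_superset[OF I]) (auto simp: indicator_def)
  have int: "integrable lborel (\<lambda>s. indicator A s *\<^sub>R f' s)"
    using borel_integrable_compact[OF A, of f'] continuous_on_subset[OF cont] by (simp add: indicator_def if_distrib cong: if_cong)
  then have "((\<lambda>s. indicator A s * f' s) has_integral (LINT s|lborel. indicator A s * f' s)) UNIV"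
    using has_integral_integral_lborel[OF int] by simp
  then show ?thesis using I2 has_integral_unique by blast
qed

section \<open>Lines parallel to a coordinate axis and shadows of planes\<close>

definition lift_line :: "3 \<Rightarrow> 3 \<Rightarrow> 3 \<Rightarrow> real^2 \<Rightarrow> real \<Rightarrow> vec3" where
  "lift_line i j k z \<tau> = (z $ 1) *\<^sub>R axis j 1 + (z $ 2) *\<^sub>R axis k 1 + \<tau> *\<^sub>R axis i 1"

lemma lift_line_nth:
  assumes "cyclic i j k"
  shows "lift_line i j k z \<tau> $ i = \<tau>" "lift_line i j k z \<tau> $ j = z $ 1" "lift_line i j k z \<tau> $ k = z $ 2"
  using cyclic_UNIV[OF assms] by (auto simp: lift_line_def axis_def)

lemma forall_cyclic: "cyclic i j k \<Longrightarrow> (\<forall>m. Q m) \<longleftrightarrow> Q i \<and> Q j \<and> Q k"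
  unfolding forall_3 cyclic_def by blast

lemma sum_cyclic: "cyclic i j k \<Longrightarrow> (\<Sum>m\<in>UNIV. f m) = (f i + f j + f k :: real)"
  unfolding sum_3 cyclic_def by auto

lemma prod_cyclic:
  assumes "cyclic i j k"
  shows "(\<Prod>m\<in>UNIV. f m) = (f i * f j * f k :: real)"
proof -
  have "(\<Prod>m\<in>UNIV. f m) = f 1 * f 2 * f 3" unfolding UNIV_3 by simp
  then show ?thesis using assms unfolding cyclic_def by auto
qed

lemma vec3_eq_cyclic: "cyclic i j k \<Longrightarrow> x = y \<longleftrightarrow> x $ i = y $ i \<and> x $ j = y $ j \<and> x $ k = (y :: vec3) $ k"
  unfolding vec_eq_iff by (rule forall_cyclic)

lemma inner_cyclic: 
  assumes "cyclic i j k"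
  shows "(x :: vec3) \<bullet> y = x $ i * y $ i + x $ j * y $ j + x $ k * y $ k"
  by (simp add: inner_vec_def sum_cyclic[OF assms])

lemma lift_line_shadow: "cyclic i j k \<Longrightarrow> lift_line i j k (shadow j k x) (x $ i) = x"
  by (simp add: vec3_eq_cyclic lift_line_nth)

lemma lift_line_diff: "lift_line i j k z s - lift_line i j k z \<tau> = (s - \<tau>) *\<^sub>R axis i 1"
  by (simp add: lift_line_def algebra_simps)

lemma continuous_on_lift_line [continuous_intros]:
  "continuous_on S f \<Longrightarrow> continuous_on S g \<Longrightarrow> continuous_on S (\<lambda>w. lift_line i j k (f w) (g w))"
  unfolding lift_line_def by (intro continuous_intros)

lemma measurable_lift_line: "(\<lambda>(z, \<tau>). lift_line i j k z \<tau>) \<in> borel_measurable (lborel \<Otimes>\<^sub>M lborel)"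
proof -
  have cont: "continuous_on UNIV (\<lambda>(z, \<tau>). lift_line i j k z \<tau>)"
    unfolding case_prod_beta by (intro continuous_intros)
  then show ?thesis
    using borel_measurable_continuous_onI[OF cont] by (simp add: lborel_prod)
qed

lemma prod_Basis_cart: "(\<Prod>b\<in>Basis. (x :: real^'n) \<bullet> b) = (\<Prod>m\<in>UNIV. x $ m)"
  by (rule prod.reindex_cong[of "\<lambda>m. axis m 1"]) (auto simp: inj_on_def axis_eq_axis Basis_vec_def inner_axis)

lemma emeasure_lborel_box_cart:
  fixes l u :: "real^'n"
  assumes "\<And>m. l $ m \<le> u $ m"
  shows "emeasure lborel (box l u) = ennreal (\<Prod>m\<in>UNIV. (u - l) $ m)"
proof -
  have "l \<bullet> b \<le> u \<bullet> b" if "b \<in> Basis" for b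
    using that assms by (auto simp: Basis_vec_def inner_axis)
  from emeasure_lborel_box[OF this] show ?thesis by (simp only: prod_Basis_cart)
qed

text \<open>Preimages of boxes are products of boxes, which determines the measure. This treats the
  three axes by one argument, whichever of them is singled out for Fubini.\<close>

lemma lborel_lift_line:
  assumes c: "cyclic i j k"
  shows "lborel = distr (lborel \<Otimes>\<^sub>M lborel) borel (\<lambda>(z, \<tau>). lift_line i j k z \<tau>)"
proof (rule lborel_eqI)
  note meas = measurable_lift_line[of i j k]
  fix l u :: vec3 assume lu: "\<And>b. b \<in> Basis \<Longrightarrow> l \<bullet> b \<le> u \<bullet> b"
  have le: "l $ m \<le> u $ m" for m using lu[of "axis m 1"] by (simp add: inner_axis)
  have "(\<lambda>(z, \<tau>). lift_line i j k z \<tau>) -` box l u = box (shadow j k l) (shadow j k u) \<times> box (l $ i) (u $ i)"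
  proof -
    have "x \<in> box l u \<longleftrightarrow> (l $ i < x $ i \<and> x $ i < u $ i) \<and> (l $ j < x $ j \<and> x $ j < u $ j) \<and> (l $ k < x $ k \<and> x $ k < u $ k)" for x
      unfolding mem_box_cart by (rule forall_cyclic[OF c])
    moreover have "z \<in> box (shadow j k l) (shadow j k u) \<longleftrightarrow> (l $ j < z $ 1 \<and> z $ 1 < u $ j) \<and> (l $ k < z $ 2 \<and> z $ 2 < u $ k)" for z
      unfolding mem_box_cart forall_2 by simp
    moreover have "\<tau> \<in> box (l $ i) (u $ i) \<longleftrightarrow> l $ i < \<tau> \<and> \<tau> < u $ i" for \<tau> by simp
    ultimately have "lift_line i j k z \<tau> \<in> box l u \<longleftrightarrow> z \<in> box (shadow j k l) (shadow j k u) \<and> \<tau> \<in> box (l $ i) (u $ i)" for z \<tau>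
      unfolding lift_line_nth[OF c] by (simp only: lift_line_nth[OF c]) blast
    then show ?thesis by (auto simp del: box_real)
  qed
  then have "emeasure (distr (lborel \<Otimes>\<^sub>M lborel) borel (\<lambda>(z, \<tau>). lift_line i j k z \<tau>)) (box l u)
     = emeasure (lborel \<Otimes>\<^sub>M lborel) (box (shadow j k l) (shadow j k u) \<times> box (l $ i) (u $ i))"
    using meas by (simp add: emeasure_distr space_pair_measure)
  also have "\<dots> = emeasure lborel (box (shadow j k l) (shadow j k u)) * emeasure lborel (box (l $ i) (u $ i))"
    by (intro lborel.emeasure_pair_measure_Times) auto
  also have "\<dots> = ennreal (((u - l) $ j * (u - l) $ k) * (u - l) $ i)"
  proof -
    have "shadow j k l $ m \<le> shadow j k u $ m" for m using le exhaust_2[of m] by auto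
    from emeasure_lborel_box_cart[OF this]
    have "emeasure lborel (box (shadow j k l) (shadow j k u)) = ennreal ((u - l) $ j * (u - l) $ k)"
      by (simp add: UNIV_2)
    moreover have "emeasure lborel (box (l $ i) (u $ i)) = ennreal ((u - l) $ i)" using le by simp
    ultimately show ?thesis using le by (simp add: ennreal_mult)
  qed
  also have "((u - l) $ j * (u - l) $ k) * (u - l) $ i = (\<Prod>b\<in>Basis. (u - l) \<bullet> b)"
    unfolding prod_Basis_cart prod_cyclic[OF c] by simp
  finally show "emeasure (distr (lborel \<Otimes>\<^sub>M lborel) borel (\<lambda>(z, \<tau>). lift_line i j k z \<tau>)) (box l u) = ennreal (\<Prod>b\<in>Basis. (u - l) \<bullet> b)" .
qed simp

lemma integral_lift_line:
  fixes F :: "vec3 \<Rightarrow> real"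
  assumes c: "cyclic i j k" and F: "integrable lborel F"
  shows "(LINT x|lborel. F x) = (LINT z|lborel. LINT \<tau>|lborel. F (lift_line i j k z \<tau>))"
proof -
  note meas = measurable_lift_line[of i j k]
  have Fm: "F \<in> borel_measurable borel" using F by auto
  have "integrable (distr (lborel \<Otimes>\<^sub>M lborel) borel (\<lambda>(z, \<tau>). lift_line i j k z \<tau>)) F"
    using F lborel_lift_line[OF c] by simp
  then have "integrable (lborel \<Otimes>\<^sub>M lborel) (\<lambda>w. F (case w of (z, \<tau>) \<Rightarrow> lift_line i j k z \<tau>))"
    using integrable_distr_eq[OF meas Fm] by simp
  from lborel_pair.integral_fst'[OF this]
  have "(LINT z|lborel. LINT \<tau>|lborel. F (lift_line i j k z \<tau>)) = (LINT w|(lborel \<Otimes>\<^sub>M lborel). F (case w of (z, \<tau>) \<Rightarrow> lift_line i j k z \<tau>))"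
    by simp
  also have "\<dots> = integral\<^sup>L (distr (lborel \<Otimes>\<^sub>M lborel) borel (\<lambda>(z, \<tau>). lift_line i j k z \<tau>)) F"
    by (rule integral_distr[OF meas Fm, symmetric])
  also have "\<dots> = (LINT x|lborel. F x)" using lborel_lift_line[OF c] by simp
  finally show ?thesis by simp
qed

text \<open>The parameter at which the line over \<open>z\<close> crosses the plane. It has this
  meaning only if component \<open>i\<close> of the normal is nonzero; otherwise the quotient is
  0.\<close>

definition height :: "3 \<Rightarrow> 3 \<Rightarrow> 3 \<Rightarrow> vec3 set \<Rightarrow> real^2 \<Rightarrow> real" where
  "height i j k P z = (plane_normal P \<bullet> plane_chart P 0 - plane_normal P $ j * z $ 1 - plane_normal P $ k * z $ 2) / plane_normal P $ i"

lemma lift_line_mem_plane: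
  assumes c: "cyclic i j k" and P: "P \<in> planes"
  shows "lift_line i j k z \<tau> \<in> P \<longleftrightarrow> plane_normal P $ i * \<tau> + plane_normal P $ j * z $ 1 + plane_normal P $ k * z $ 2 = plane_normal P \<bullet> plane_chart P 0"
proof -
  have "lift_line i j k z \<tau> \<in> P \<longleftrightarrow> plane_normal P \<bullet> lift_line i j k z \<tau> = plane_normal P \<bullet> plane_chart P 0"
    using plane_eq_hyperplane[OF P] by blast
  then show ?thesis unfolding inner_cyclic[OF c, of _ "lift_line i j k z \<tau>"] lift_line_nth[OF c] by simp
qed

lemma lift_line_height:
  assumes c: "cyclic i j k" and P: "P \<in> planes" and nz: "plane_normal P $ i \<noteq> 0"
  shows "lift_line i j k z \<tau> \<in> P \<longleftrightarrow> \<tau> = height i j k P z"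
  unfolding lift_line_mem_plane[OF c P] height_def using nz by (auto simp: field_simps)

lemma height_chart:
  assumes c: "cyclic i j k" and P: "P \<in> planes" and nz: "plane_normal P $ i \<noteq> 0"
  shows "lift_line i j k (shadow j k (plane_chart P y)) (height i j k P (shadow j k (plane_chart P y))) = plane_chart P y"
proof -
  have "lift_line i j k (shadow j k (plane_chart P y)) (plane_chart P y $ i) \<in> P"
    using lift_line_shadow[OF c] plane_chart_in[OF P] by simp
  then show ?thesis using lift_line_height[OF c P nz] lift_line_shadow[OF c] by metis
qed

lemma continuous_height: "continuous_on S (height i j k P)"
  unfolding height_def[abs_def] divide_inverse by (intro continuous_intros)

lemma borel_measurable_lift_height [measurable]:
  "(\<lambda>z. lift_line i j k z (height i j k P z)) \<in> borel_measurable borel"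
  by (intro borel_measurable_continuous_onI continuous_intros continuous_height)

lemma borel_measurable_shadow_chart:
  assumes "P \<in> planes"
  shows "(\<lambda>y. shadow j k (plane_chart P y)) \<in> borel_measurable borel"
  by (intro borel_measurable_continuous_onI continuous_on_compose2[OF linear_continuous_on continuous_plane_chart[OF assms]])
      (auto intro: linear_shadow simp: linear_conv_bounded_linear[symmetric])

text \<open>A null set on a plane casts a null shadow. This transfers genericity from the points of
  a plane to the lines that cross it.\<close>

lemma AE_shadow:
  assumes P: "P \<in> planes" and c: "cyclic i j k" and nz: "plane_normal P $ i \<noteq> 0"
    and Q: "{z. Q z} \<in> sets borel" and ae: "AE y in lborel. Q (shadow j k (plane_chart P y))"
  shows "AE z in lborel. Q z"
proof -
  have m: "(\<lambda>y. shadow j k (plane_chart P y)) \<in> lborel \<rightarrow>\<^sub>M borel" using borel_measurable_shadow_chart[OF P] by simp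
  have "AE z in distr lborel borel (\<lambda>y. shadow j k (plane_chart P y)). Q z"
    using AE_distr_iff[OF m] Q ae by simp
  then have "AE z in density (distr lborel borel (\<lambda>y. shadow j k (plane_chart P y))) (\<lambda>_. ennreal \<bar>plane_normal P $ i\<bar>). Q z"
    by (subst AE_density) auto
  then show ?thesis by (subst lborel_shadow_plane[OF P c nz])
qed

text \<open>Integrating over the shadow weights the plane with the Jacobian of the projection;
  equivalence of the integrability claims is proved alongside, because sums over planes must be
  exchanged with integrals.\<close>

lemma integral_shadow:
  fixes G :: "vec3 \<Rightarrow> real"
  assumes P: "P \<in> planes" and c: "cyclic i j k" and nz: "plane_normal P $ i \<noteq> 0" and G: "G \<in> borel_measurable borel"
  shows "(LINT z|lborel. G (lift_line i j k z (height i j k P z))) = (LINT y|lborel. \<bar>plane_normal P $ i\<bar> * G (plane_chart P y))"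
    and "integrable lborel (\<lambda>z. G (lift_line i j k z (height i j k P z))) \<longleftrightarrow> integrable lborel (\<lambda>y. \<bar>plane_normal P $ i\<bar> * G (plane_chart P y))"
proof -
  have m: "(\<lambda>y. shadow j k (plane_chart P y)) \<in> lborel \<rightarrow>\<^sub>M borel" using borel_measurable_shadow_chart[OF P] by simp
  let ?g = "\<lambda>z. G (lift_line i j k z (height i j k P z))"
  let ?D = "distr lborel borel (\<lambda>y. shadow j k (plane_chart P y))"
  have g: "?g \<in> borel_measurable borel" using G by measurable
  have "(LINT z|lborel. ?g z) = integral\<^sup>L (density ?D (\<lambda>_. ennreal \<bar>plane_normal P $ i\<bar>)) ?g"
    using lborel_shadow_plane[OF P c nz] by simp
  also have "\<dots> = (LINT z|?D. \<bar>plane_normal P $ i\<bar> *\<^sub>R ?g z)"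
    using g by (intro integral_density) auto
  also have "\<dots> = (LINT y|lborel. \<bar>plane_normal P $ i\<bar> * ?g (shadow j k (plane_chart P y)))"
    using g by (subst integral_distr[OF m]) auto
  finally show "(LINT z|lborel. ?g z) = (LINT y|lborel. \<bar>plane_normal P $ i\<bar> * G (plane_chart P y))"
    unfolding height_chart[OF c P nz] .
  have "integrable lborel ?g \<longleftrightarrow> integrable (density ?D (\<lambda>_. ennreal \<bar>plane_normal P $ i\<bar>)) ?g"
    using lborel_shadow_plane[OF P c nz] by simp
  also have "\<dots> \<longleftrightarrow> integrable ?D (\<lambda>z. \<bar>plane_normal P $ i\<bar> *\<^sub>R ?g z)"
    using g by (intro integrable_density) auto
  also have "\<dots> \<longleftrightarrow> integrable lborel (\<lambda>y. \<bar>plane_normal P $ i\<bar> * ?g (shadow j k (plane_chart P y)))"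
    using g by (subst integrable_distr_eq[OF m]) auto
  finally show "integrable lborel ?g \<longleftrightarrow> integrable lborel (\<lambda>y. \<bar>plane_normal P $ i\<bar> * G (plane_chart P y))"
    unfolding height_chart[OF c P nz] .
qed

text \<open>A plane parallel to axis \<open>i\<close> casts only a line as its shadow, and a line
  parallel to the axis meets the plane only if its base point lies on that shadow.\<close>

lemma vertical_plane_AE:
  assumes c: "cyclic i j k" and P: "P \<in> planes" and nz: "plane_normal P $ i = 0"
  shows "AE z in lborel. \<forall>\<tau>. lift_line i j k z \<tau> \<notin> P"
proof -
  define a :: "real^2" where "a = vector [plane_normal P $ j, plane_normal P $ k]"
  have "a \<noteq> 0"
  proof
    assume "a = 0"
    then have "a $ 1 = 0" "a $ 2 = 0" by simp_all
    then have "plane_normal P = 0" using nz vec3_eq_cyclic[OF c, of "plane_normal P" 0] by (simp add: a_def)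
    then show False using norm_plane_normal[OF P] by simp
  qed
  then have "negligible {z. a \<bullet> z = plane_normal P \<bullet> plane_chart P 0}" by (intro negligible_hyperplane) simp
  moreover have "{z. a \<bullet> z = plane_normal P \<bullet> plane_chart P 0} \<in> sets borel" by (simp add: closed_hyperplane)
  ultimately have N: "{z. a \<bullet> z = plane_normal P \<bullet> plane_chart P 0} \<in> null_sets lborel"
    unfolding negligible_iff_null_sets by (simp add: null_sets_completion_iff)
  have "a \<bullet> z = plane_normal P $ j * z $ 1 + plane_normal P $ k * z $ 2" for z
    by (simp add: a_def inner_vec_def sum_2)
  then show ?thesis
    using lift_line_mem_plane[OF c P] nz by (intro AE_I'[OF N]) auto
qed

lemma integrable_bounded_indicator:
  fixes f :: "'a \<Rightarrow> real"
  assumes "A \<in> sets M" "emeasure M A < \<infinity>" "f \<in> borel_measurable M" "\<And>x. x \<in> A \<Longrightarrow> \<bar>f x\<bar> \<le> B"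
  shows "integrable M (\<lambda>x. indicator A x * f x)"
  using integrableI_bounded_set_indicator[OF assms(1,3,2), of B] assms(4) by auto

section \<open>Lines in general position\<close>

context plane_family
begin

lemma generic_chart_AE:
  assumes P: "P \<in> \<P>"
  shows "AE y in lborel. generic (plane_chart P y)"
proof -
  have N: "(\<Union>Q\<in>\<P> - {P}. plane_chart P -` Q) \<in> null_sets lborel"
    using P planes_family by (intro null_sets_UN' countable_finite finite_Diff finite_family null_plane_vimage) auto
  have "generic (plane_chart P y)" if "y \<notin> (\<Union>Q\<in>\<P> - {P}. plane_chart P -` Q)" for y
  proof -
    have "Q = P" if "Q \<in> \<P>" "plane_chart P y \<in> Q" for Q using that \<open>y \<notin> _\<close> by auto
    then show ?thesis unfolding generic_def by blast
  qed
  then show ?thesis by (intro AE_I'[OF N]) blast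
qed

lemma borel_generic: "{x. generic x} \<in> sets borel"
proof -
  have "{x. generic x} = - (\<Union>P\<in>\<P>. \<Union>Q\<in>\<P> - {P}. P \<inter> Q)" unfolding generic_def by blast
  moreover have "(\<Union>P\<in>\<P>. \<Union>Q\<in>\<P> - {P}. P \<inter> Q) \<in> sets borel"
    using finite_family planes_family by (intro sets.finite_UN finite_Diff sets.Int borel_plane) auto
  ultimately show ?thesis by (simp only: borel_comp)
qed

lemma generic_height_AE:
  assumes P: "P \<in> \<P>" and c: "cyclic i j k" and nz: "plane_normal P $ i \<noteq> 0"
  shows "AE z in lborel. generic (lift_line i j k z (height i j k P z))"
proof (rule AE_shadow[OF planes_family[OF P] c nz])
  show "{z. generic (lift_line i j k z (height i j k P z))} \<in> sets borel"
    using measurable_sets_borel[OF borel_measurable_lift_height borel_generic, of i j k P] by (simp add: vimage_def)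
  show "AE y in lborel. generic (lift_line i j k (shadow j k (plane_chart P y)) (height i j k P (shadow j k (plane_chart P y))))"
    unfolding height_chart[OF c planes_family[OF P] nz] by (rule generic_chart_AE[OF P])
qed

text \<open>On such a line each crossing with the family is transversal and happens on one plane
  only, so a normal tells on which side of the crossing an element lies.\<close>

lemma good_lines_AE:
  assumes c: "cyclic i j k"
  shows "AE z in lborel. \<forall>P\<in>\<P>. if plane_normal P $ i = 0 then \<forall>\<tau>. lift_line i j k z \<tau> \<notin> P
     else generic (lift_line i j k z (height i j k P z))"
proof (rule AE_finite_allI[OF finite_family])
  fix P assume P: "P \<in> \<P>"
  show "AE z in lborel. if plane_normal P $ i = 0 then \<forall>\<tau>. lift_line i j k z \<tau> \<notin> P
     else generic (lift_line i j k z (height i j k P z))"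
    using vertical_plane_AE[OF c planes_family[OF P]] generic_height_AE[OF P c]
    by (cases "plane_normal P $ i = 0") simp_all
qed

end

section \<open>The divergence theorem for one coordinate\<close>

context mesh_family
begin

lemma emeasure_frontier_finite: "K \<in> M \<Longrightarrow> emeasure (sheets \<P>) (frontier K) < \<infinity>"
  using element_compact compact_frontier compact_imp_bounded by (intro emeasure_sheets_bounded) blast

lemma integrable_frontier:
  fixes g :: "vec3 \<Rightarrow> real"
  assumes K: "K \<in> M" and g: "g \<in> borel_measurable borel" "\<And>x. x \<in> frontier K \<Longrightarrow> \<bar>g x\<bar> \<le> B"
  shows "integrable (sheets \<P>) (\<lambda>x. indicator (frontier K) x * g x)"
  using assms emeasure_frontier_finite[OF K] by (intro integrable_bounded_indicator[of _ _ _ B]) auto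

lemma bounded_on_frontier:
  fixes f :: "vec3 \<Rightarrow> real"
  assumes K: "K \<in> M" and f: "continuous_on UNIV f"
  obtains B :: real where "0 \<le> B" "\<And>x. x \<in> frontier K \<Longrightarrow> \<bar>f x\<bar> \<le> B"
proof -
  have "compact (f ` frontier K)"
    using compact_continuous_image[OF continuous_on_subset[OF f] compact_frontier[OF element_compact[OF K]]] by simp
  then obtain B where "\<And>y. y \<in> f ` frontier K \<Longrightarrow> \<bar>y\<bar> \<le> B" using compact_imp_bounded bounded_iff by (metis real_norm_def)
  then have "\<bar>f x\<bar> \<le> \<bar>B\<bar>" if "x \<in> frontier K" for x using that by fastforce
  then show thesis using that[of "\<bar>B\<bar>"] by auto
qed

text \<open>The trace \<open>A\<close> of \<open>K\<close> on a good line is compact, and its end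
  points are crossings with planes at generic points, so the one-dimensional theorem applies. Moving
  along the axis, the line leaves \<open>K\<close> where component \<open>i\<close> of the normal is
  positive and enters it where the component is negative; this is the sign of the boundary
  value.\<close>

lemma line_integral:
  fixes f f' :: "vec3 \<Rightarrow> real"
  assumes K: "K \<in> M" and c: "cyclic i j k" and cont': "continuous_on UNIV f'"
    and der: "\<And>z \<tau>. ((\<lambda>\<tau>. f (lift_line i j k z \<tau>)) has_real_derivative f' (lift_line i j k z \<tau>)) (at \<tau>)"
    and good: "\<forall>P\<in>\<P>. if plane_normal P $ i = 0 then \<forall>\<tau>. lift_line i j k z \<tau> \<notin> P
     else generic (lift_line i j k z (height i j k P z))"
  defines "q \<equiv> \<lambda>P. lift_line i j k z (height i j k P z)"
  shows "(LINT \<tau>|lborel. indicator K (lift_line i j k z \<tau>) * f' (lift_line i j k z \<tau>)) =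
     (\<Sum>P\<in>{P \<in> \<P>. plane_normal P $ i \<noteq> 0}. indicator (frontier K) (q P) * (sgn (unit_normal K (q P) $ i) * f (q P)))"
proof -
  let ?l = "lift_line i j k z"
  define A where "A = {\<tau>. ?l \<tau> \<in> K}"
  define Q where "Q = {P \<in> \<P>. plane_normal P $ i \<noteq> 0 \<and> q P \<in> frontier K}"
  define Z where "Z = (\<lambda>P. height i j k P z) ` Q"
  have cl: "continuous_on UNIV ?l" by (intro continuous_intros)
  have dist_l: "dist (?l s) (?l \<tau>) = \<bar>s - \<tau>\<bar>" for s \<tau>
    by (simp add: dist_norm lift_line_diff)
  have "closed A" unfolding A_def using closed_vimage[OF element_closed[OF K] cl] by (simp add: vimage_def)
  moreover have "bounded A"
  proof -
    obtain B where B: "\<And>x. x \<in> K \<Longrightarrow> norm x \<le> B"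
      using compact_imp_bounded[OF element_compact[OF K]] bounded_iff by blast
    have "\<bar>\<tau>\<bar> \<le> B" if "\<tau> \<in> A" for \<tau>
    proof -
      have "\<bar>?l \<tau> $ i\<bar> \<le> norm (?l \<tau>)" by (rule component_le_norm_cart)
      then show ?thesis using B[of "?l \<tau>"] that lift_line_nth(1)[OF c] by (simp add: A_def)
    qed
    then show ?thesis by (auto simp: bounded_iff)
  qed
  ultimately have A: "compact A" by (simp add: compact_eq_bounded_closed)
  have finQ: "finite Q" using finite_family by (simp add: Q_def)
  have Zfr: "\<tau> \<in> Z" if fr: "?l \<tau> \<in> frontier K" for \<tau>
  proof -
    obtain P where P: "P \<in> \<P>" "?l \<tau> \<in> P" using fr mesh_family[OF K] by blast
    then have nz: "plane_normal P $ i \<noteq> 0" using good by (metis)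
    then have "\<tau> = height i j k P z" using lift_line_height[OF c planes_family[OF P(1)] nz] P by blast
    then show ?thesis using P nz fr by (auto simp: Z_def Q_def q_def)
  qed
  have frA: "frontier A \<subseteq> Z"
  proof
    fix \<tau> assume \<tau>: "\<tau> \<in> frontier A"
    then have "\<tau> \<in> A" using \<open>closed A\<close> frontier_subset_closed by blast
    have "?l \<tau> \<notin> interior K"
    proof
      assume "?l \<tau> \<in> interior K"
      moreover have "open (?l -` interior K)" using open_vimage[OF open_interior cl] .
      moreover have "?l -` interior K \<subseteq> A" using interior_subset by (auto simp: A_def)
      ultimately have "\<tau> \<in> interior A" using interior_maximal by blast
      then show False using \<tau> by (simp add: frontier_def)
    qed
    then have "?l \<tau> \<in> frontier K" using \<open>\<tau> \<in> A\<close> closure_subset by (auto simp: A_def frontier_def)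
    then show "\<tau> \<in> Z" by (rule Zfr)
  qed
  have sign: "(sgn (unit_normal K (?l x) $ i) = 1 \<and> (\<exists>r>0. \<forall>y. \<bar>y - x\<bar> < r \<longrightarrow> (y < x \<longrightarrow> y \<in> A) \<and> (y > x \<longrightarrow> y \<notin> A))) \<or>
       (sgn (unit_normal K (?l x) $ i) = - 1 \<and> (\<exists>r>0. \<forall>y. \<bar>y - x\<bar> < r \<longrightarrow> (y > x \<longrightarrow> y \<in> A) \<and> (y < x \<longrightarrow> y \<notin> A)))"
    if xZ: "x \<in> Z" for x
  proof -
    obtain P where "P \<in> Q" and xP: "x = height i j k P z" using xZ by (auto simp: Z_def)
    then have P: "P \<in> \<P>" "plane_normal P $ i \<noteq> 0" "?l x \<in> frontier K" "x = height i j k P z"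
      by (simp_all add: Q_def q_def)
    have g: "generic (?l x)" using good P by auto
    have xP: "?l x \<in> P" using lift_line_height[OF c planes_family[OF P(1)] P(2)] P(4) by blast
    obtain n where n: "is_outward_normal K (?l x) n" "n = plane_normal P \<or> n = - plane_normal P"
      using element_normal[OF K P(3) g P(1) xP] by blast
    have un: "unit_normal K (?l x) = n" using unit_normal_eq[OF g P(1) xP n] .
    have ni: "n $ i \<noteq> 0" using n P by auto
    obtain r where r: "0 < r" "\<And>y. y \<in> ball (?l x) r \<Longrightarrow> n \<bullet> (y - ?l x) < 0 \<Longrightarrow> y \<in> K"
      "\<And>y. y \<in> ball (?l x) r \<Longrightarrow> n \<bullet> (y - ?l x) > 0 \<Longrightarrow> y \<notin> K"
      using n(1) unfolding is_outward_normal_def by blast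
    have ip: "n \<bullet> (?l y - ?l x) = (y - x) * n $ i" for y by (simp add: lift_line_diff inner_axis)
    have bl: "?l y \<in> ball (?l x) r" if "\<bar>y - x\<bar> < r" for y using dist_l[of x y] that by (simp add: abs_minus_commute)
    show ?thesis
    proof (cases "n $ i > 0")
      case True
      have "(y < x \<longrightarrow> y \<in> A) \<and> (y > x \<longrightarrow> y \<notin> A)" if "\<bar>y - x\<bar> < r" for y
        using r(2,3)[OF bl[OF that]] True unfolding ip A_def by (simp add: mult_neg_pos)
      then show ?thesis using True r(1) un by auto
    next
      case False
      then have neg: "n $ i < 0" using ni by simp
      have "(y > x \<longrightarrow> y \<in> A) \<and> (y < x \<longrightarrow> y \<notin> A)" if "\<bar>y - x\<bar> < r" for y
        using r(2,3)[OF bl[OF that]] neg unfolding ip A_def by (simp add: mult_pos_neg mult_neg_neg)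
      then show ?thesis using neg r(1) un by auto
    qed
  qed
  have "(LINT \<tau>|lborel. indicator K (?l \<tau>) * f' (?l \<tau>)) = (LINT \<tau>|lborel. indicator A \<tau> * f' (?l \<tau>))"
    by (simp add: A_def indicator_def)
  also have "\<dots> = (\<Sum>x\<in>Z. sgn (unit_normal K (?l x) $ i) * f (?l x))"
    using finQ by (intro integral_derivative_compact_real[OF A _ frA der _ sign] continuous_on_compose2[OF cont' cl]) (auto simp: Z_def)
  also have "\<dots> = (\<Sum>P\<in>Q. sgn (unit_normal K (q P) $ i) * f (q P))"
  proof -
    \<comment> \<open>Two planes crossed at the same height would share a generic point. Hence the
      sum over crossing points may be indexed by planes.\<close>
    have "inj_on (\<lambda>P. height i j k P z) Q"
    proof (rule inj_onI)
      fix P P' assume *: "P \<in> Q" "P' \<in> Q" "height i j k P z = height i j k P' z"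
      have "q P \<in> P" "q P' \<in> P'" using * lift_line_height[OF c planes_family] by (auto simp: q_def Q_def)
      moreover have "q P = q P'" using * by (simp add: q_def)
      moreover have "generic (q P)" using * good by (auto simp: Q_def q_def)
      ultimately show "P = P'" using * by (auto simp: generic_def Q_def)
    qed
    then show ?thesis unfolding Z_def by (simp add: sum.reindex q_def)
  qed
  also have "\<dots> = (\<Sum>P\<in>{P \<in> \<P>. plane_normal P $ i \<noteq> 0}. indicator (frontier K) (q P) * (sgn (unit_normal K (q P) $ i) * f (q P)))"
    using finite_family by (intro sum.mono_neutral_cong_left) (auto simp: Q_def indicator_def)
  finally show ?thesis .
qed

text \<open>Fubini along the axis reduces the volume integral to line integrals, whose boundary sums
  are integrals over shadows of planes. Back on the planes the Jacobian restores the normal, because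
  \<open>|n| * sgn n = n\<close> for its component \<open>i\<close>.\<close>

lemma divergence_coordinate:
  fixes f f' :: "vec3 \<Rightarrow> real"
  assumes K: "K \<in> M" and cont: "continuous_on UNIV f" and cont': "continuous_on UNIV f'"
    and der: "\<And>x. ((\<lambda>\<tau>. f (x + \<tau> *\<^sub>R axis i 1)) has_real_derivative f' x) (at 0)"
  shows "(LINT x|lborel. indicator K x * f' x) = (LINT x|sheets \<P>. indicator (frontier K) x * (unit_normal K x $ i * f x))"
proof -
  obtain j k where c: "cyclic i j k" using cyclic_ex by blast
  have der': "((\<lambda>\<tau>. f (lift_line i j k z \<tau>)) has_real_derivative f' (lift_line i j k z \<tau>)) (at \<tau>)" for z \<tau>
  proof -
    have "((\<lambda>s. f (lift_line i j k z \<tau> + (s - \<tau>) *\<^sub>R axis i 1)) has_real_derivative f' (lift_line i j k z \<tau>)) (at \<tau>)"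
      using DERIV_shift[of "\<lambda>s. f (lift_line i j k z \<tau> + (s - \<tau>) *\<^sub>R axis i 1)" _ 0 \<tau>] der[of "lift_line i j k z \<tau>"] by simp
    moreover have "lift_line i j k z \<tau> + (s - \<tau>) *\<^sub>R axis i 1 = lift_line i j k z s" for s
      by (simp add: lift_line_def scaleR_left_diff_distrib)
    ultimately show ?thesis by simp
  qed
  define G where "G = (\<lambda>x. indicator (frontier K) x * (sgn (unit_normal K x $ i) * f x))"
  define V where "V = {P \<in> \<P>. plane_normal P $ i \<noteq> 0}"
  have un[measurable]: "(\<lambda>x. unit_normal K x $ i) \<in> borel_measurable borel"
  proof -
    have "(\<lambda>x. unit_normal K x \<bullet> axis i 1) \<in> borel_measurable borel" by measurable
    then show ?thesis by (simp add: inner_axis)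
  qed
  have fm[measurable]: "f \<in> borel_measurable borel" "f' \<in> borel_measurable borel"
    using cont cont' by (auto intro: borel_measurable_continuous_onI)
  have [measurable]: "frontier K \<in> sets borel" by simp
  have Gm[measurable]: "G \<in> borel_measurable borel" unfolding G_def by measurable
  obtain B where B: "0 \<le> B" "\<And>x. x \<in> frontier K \<Longrightarrow> \<bar>f x\<bar> \<le> B" using bounded_on_frontier[OF K cont] by blast
  have Gint: "integrable (sheets \<P>) G"
    unfolding G_def
    by (rule integrable_frontier[OF K, of _ B]) (use B in \<open>auto simp: abs_mult sgn_if\<close>)
  \<comment> \<open>The integral of the norm over the sheets is a finite sum of nonnegative chart
    integrals, so each of them is finite.\<close>
  have chart_int: "integrable lborel (\<lambda>y. g (plane_chart P y))"
    if P: "P \<in> \<P>" and g: "integrable (sheets \<P>) g" for P and g :: "vec3 \<Rightarrow> real"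
  proof -
    have [measurable]: "g \<in> borel_measurable borel" using g by auto
    have "(\<integral>\<^sup>+ y. ennreal (norm (g (plane_chart P y))) \<partial>lborel) \<le> (\<Sum>P\<in>\<P>. \<integral>\<^sup>+ y. ennreal (norm (g (plane_chart P y))) \<partial>lborel)"
      using P finite_family by (intro member_le_sum) auto
    also have "\<dots> = (\<integral>\<^sup>+ x. ennreal (norm (g x)) \<partial>sheets \<P>)" by (rule nn_integral_sheets[symmetric]) measurable
    also have "\<dots> < \<infinity>" using g by (simp add: integrable_iff_bounded)
    finally show ?thesis using planes_family[OF P] by (intro integrableI_bounded) auto
  qed
  have nb: "\<bar>unit_normal K x $ i\<bar> \<le> 2 * real (card \<P>)" for x
    using component_le_norm_cart[of "unit_normal K x" i] norm_unit_normal_le[of K x] by linarith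
  have Rint: "integrable (sheets \<P>) (\<lambda>x. indicator (frontier K) x * (unit_normal K x $ i * f x))"
  proof (rule integrable_frontier[OF K, of _ "2 * real (card \<P>) * B"])
    show "\<bar>unit_normal K x $ i * f x\<bar> \<le> 2 * real (card \<P>) * B" if "x \<in> frontier K" for x
      unfolding abs_mult using nb[of x] B(2)[OF that] B(1) by (intro mult_mono) auto
  qed measurable
  have pointwise: "AE y in lborel. indicator (frontier K) (plane_chart P y) * (unit_normal K (plane_chart P y) $ i * f (plane_chart P y))
      = \<bar>plane_normal P $ i\<bar> * G (plane_chart P y)" if P: "P \<in> \<P>" for P
    using generic_chart_AE[OF P]
  proof eventually_elim
    case (elim y)
    show ?case
    proof (cases "plane_chart P y \<in> frontier K")
      case True
      have yP: "plane_chart P y \<in> P" using plane_chart_in planes_family[OF P] .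
      obtain n where n: "is_outward_normal K (plane_chart P y) n" "n = plane_normal P \<or> n = - plane_normal P"
        using element_normal[OF K True elim P yP] by blast
      have "unit_normal K (plane_chart P y) = n" using unit_normal_eq[OF elim P yP n] .
      then have "unit_normal K (plane_chart P y) $ i = \<bar>plane_normal P $ i\<bar> * sgn (unit_normal K (plane_chart P y) $ i)"
        using n(2) by (auto simp: sgn_if)
      then show ?thesis by (simp add: G_def)
    qed (simp add: G_def)
  qed
  have Kint: "integrable lborel (\<lambda>x. indicator K x * f' x)"
    using borel_integrable_compact[OF element_compact[OF K], of f'] continuous_on_subset[OF cont']
    by (simp add: indicator_def if_distrib cong: if_cong)
  have "(LINT x|lborel. indicator K x * f' x)
     = (LINT z|lborel. LINT \<tau>|lborel. indicator K (lift_line i j k z \<tau>) * f' (lift_line i j k z \<tau>))"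
    by (rule integral_lift_line[OF c Kint])
  also have "\<dots> = (LINT z|lborel. (\<Sum>P\<in>V. G (lift_line i j k z (height i j k P z))))"
  proof (rule integral_cong_AE)
    have "K \<in> sets borel" using element_closed[OF K] by simp
    then have "(\<lambda>x. indicator K x * f' x) \<in> borel_measurable borel" by measurable
    from measurable_compose[OF measurable_lift_line this]
    show "(\<lambda>z. LINT \<tau>|lborel. indicator K (lift_line i j k z \<tau>) * f' (lift_line i j k z \<tau>)) \<in> borel_measurable lborel"
      by (intro lborel.borel_measurable_lebesgue_integral) (simp add: case_prod_beta)
    show "(\<lambda>z. \<Sum>P\<in>V. G (lift_line i j k z (height i j k P z))) \<in> borel_measurable lborel" by measurable
    show "AE z in lborel. (LINT \<tau>|lborel. indicator K (lift_line i j k z \<tau>) * f' (lift_line i j k z \<tau>))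
        = (\<Sum>P\<in>V. G (lift_line i j k z (height i j k P z)))"
      using good_lines_AE[OF c]
    proof eventually_elim
      case (elim z)
      show ?case unfolding V_def G_def by (rule line_integral[OF K c cont' der' elim])
    qed
  qed
  also have "\<dots> = (\<Sum>P\<in>V. (LINT z|lborel. G (lift_line i j k z (height i j k P z))))"
  proof (rule Bochner_Integration.integral_sum)
    fix P assume "P \<in> V"
    then show "integrable lborel (\<lambda>z. G (lift_line i j k z (height i j k P z)))"
      using integral_shadow(2)[OF planes_family c _ Gm] chart_int[OF _ Gint] by (auto simp: V_def)
  qed
  also have "\<dots> = (\<Sum>P\<in>V. (LINT y|lborel. \<bar>plane_normal P $ i\<bar> * G (plane_chart P y)))"
    by (intro sum.cong refl integral_shadow(1)[OF planes_family c _ Gm]) (auto simp: V_def)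
  \<comment> \<open>Planes parallel to the axis join the sum at no cost, as their factor is 0; the
    surface integral includes them too.\<close>
  also have "\<dots> = (\<Sum>P\<in>\<P>. (LINT y|lborel. \<bar>plane_normal P $ i\<bar> * G (plane_chart P y)))"
    using finite_family by (intro sum.mono_neutral_left) (auto simp: V_def)
  also have "\<dots> = (\<Sum>P\<in>\<P>. (LINT y|lborel. indicator (frontier K) (plane_chart P y) * (unit_normal K (plane_chart P y) $ i * f (plane_chart P y))))"
  proof (intro sum.cong refl integral_cong_AE)
    fix P assume P: "P \<in> \<P>"
    note [measurable] = measurable_plane_chart[OF planes_family[OF P]]
    show "(\<lambda>y. \<bar>plane_normal P $ i\<bar> * G (plane_chart P y)) \<in> borel_measurable lborel" by measurable
    show "(\<lambda>y. indicator (frontier K) (plane_chart P y) * (unit_normal K (plane_chart P y) $ i * f (plane_chart P y))) \<in> borel_measurable lborel"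
      using chart_int[OF P Rint] by (rule borel_measurable_integrable)
    show "AE y in lborel. \<bar>plane_normal P $ i\<bar> * G (plane_chart P y) = indicator (frontier K) (plane_chart P y) * (unit_normal K (plane_chart P y) $ i * f (plane_chart P y))"
      using pointwise[OF P] by eventually_elim simp
  qed
  also have "\<dots> = (LINT x|sheets \<P>. indicator (frontier K) x * (unit_normal K x $ i * f x))"
    using integral_sheets[OF Rint] by simp
  finally show ?thesis .
qed

end

subsection \<open>Polynomial fields and Maxwell's equations\<close>

lemma polynomial_const: "real_polynomial_function (\<lambda>x. c)"
  and polynomial_linear: "bounded_linear f \<Longrightarrow> real_polynomial_function f"
  by (intro real_polynomial_function.intros(2)) (rule real_polynomial_function.intros(1))

lemma polynomial_add: "real_polynomial_function f \<Longrightarrow> real_polynomial_function g \<Longrightarrow> real_polynomial_function (\<lambda>z. f z + g z)"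
  by (rule real_polynomial_function.intros(3))

lemma polynomial_mult: "real_polynomial_function f \<Longrightarrow> real_polynomial_function g \<Longrightarrow> real_polynomial_function (\<lambda>z. f z * g z)"
  by (rule real_polynomial_function.intros(4))

lemma polynomial_cmult: "real_polynomial_function f \<Longrightarrow> real_polynomial_function (\<lambda>z. c * f z)"
  by (rule polynomial_mult[OF polynomial_const])

text \<open>The directional derivative of a scalar component, in the same encoding as
  \<open>time_deriv\<close> and \<open>space_deriv\<close>.\<close>

definition pd :: "'a::real_normed_vector \<Rightarrow> ('a \<Rightarrow> real) \<Rightarrow> 'a \<Rightarrow> real" where
  "pd v f z = frechet_derivative f (at z) v"

lemma pd_eqI: "(f has_derivative f') (at z) \<Longrightarrow> pd v f z = f' v"
  unfolding pd_def using frechet_derivative_at by metis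

lemma polynomial_pd:
  assumes "real_polynomial_function f"
  shows "f differentiable (at z)" "real_polynomial_function (pd v f)"
proof -
  have "(\<forall>z. f differentiable (at z)) \<and> real_polynomial_function (pd v f)"
    using assms
  proof induction
    case (linear f)
    have "pd v f = (\<lambda>z. f v)"
      using pd_eqI[OF bounded_linear_imp_has_derivative[OF linear]] by blast
    then show ?case
      using linear bounded_linear_imp_differentiable by (auto simp: polynomial_const)
  next
    case (const c)
    have "pd v (\<lambda>x. c) = (\<lambda>z. 0)" using pd_eqI[OF has_derivative_const[of c]] by blast
    then show ?case by (auto simp: polynomial_const)
  next
    case (add f g)
    have "pd v (\<lambda>x. f x + g x) z = pd v f z + pd v g z" for z
      using add by (intro pd_eqI has_derivative_eq_rhs[OF has_derivative_add]) (auto simp: frechet_derivative_works pd_def)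
    then have "pd v (\<lambda>x. f x + g x) = (\<lambda>z. pd v f z + pd v g z)" by blast
    then show ?case using add by auto
  next
    case (mult f g)
    have "pd v (\<lambda>x. f x * g x) z = f z * pd v g z + pd v f z * g z" for z
      using mult by (intro pd_eqI has_derivative_eq_rhs[OF has_derivative_mult]) (auto simp: frechet_derivative_works pd_def)
    then have "pd v (\<lambda>x. f x * g x) = (\<lambda>z. f z * pd v g z + pd v f z * g z)" by blast
    then show ?case using mult by auto
  qed
  then show "f differentiable (at z)" "real_polynomial_function (pd v f)" by auto
qed

lemma pd_has_derivative: "real_polynomial_function f \<Longrightarrow> (f has_derivative (\<lambda>v. pd v f z)) (at z)"
  using polynomial_pd(1) frechet_derivative_works unfolding pd_def by blast

lemma pd_const [simp]: "pd v (\<lambda>x. c) z = 0"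
  using pd_eqI[OF has_derivative_const[of c]] .

lemma pd_add:
  "real_polynomial_function f \<Longrightarrow> real_polynomial_function g \<Longrightarrow> pd v (\<lambda>x. f x + g x) z = pd v f z + pd v g z"
  by (rule pd_eqI, rule has_derivative_eq_rhs[OF has_derivative_add[OF pd_has_derivative pd_has_derivative]]) auto

lemma pd_diff:
  "real_polynomial_function f \<Longrightarrow> real_polynomial_function g \<Longrightarrow> pd v (\<lambda>x. f x - g x) z = pd v f z - pd v g z"
  by (rule pd_eqI, rule has_derivative_eq_rhs[OF has_derivative_diff[OF pd_has_derivative pd_has_derivative]]) auto

lemma pd_mult:
  "real_polynomial_function f \<Longrightarrow> real_polynomial_function g \<Longrightarrow> pd v (\<lambda>x. f x * g x) z = f z * pd v g z + pd v f z * g z"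
  by (rule pd_eqI, rule has_derivative_eq_rhs[OF has_derivative_mult[OF pd_has_derivative pd_has_derivative]]) auto

lemma pd_cmult:
  "real_polynomial_function f \<Longrightarrow> pd v (\<lambda>x. c * f x) z = c * pd v f z"
  using pd_mult[OF polynomial_const[of c], of f v z] by simp

text \<open>Induction over the construction of polynomials: in the product rule applied twice, the
  two mixed terms are exchanged by swapping \<open>u\<close> and \<open>v\<close>, and the others
  agree by hypothesis.\<close>

lemma pd_commute:
  assumes "real_polynomial_function f"
  shows "pd u (pd v f) z = pd v (pd u f) z"
proof -
  have "\<forall>z. pd u (pd v f) z = pd v (pd u f) z" using assms
  proof induction
    case (linear f)
    have "pd w f = (\<lambda>z. f w)" for w
      using pd_eqI[OF bounded_linear_imp_has_derivative[OF linear]] by blast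
    then show ?case by simp
  next
    case (const c)
    have "pd w (\<lambda>x. c) = (\<lambda>z. 0)" for w :: 'a by (rule ext) simp
    then show ?case by simp
  next
    case (add f g)
    have "pd w (\<lambda>x. f x + g x) = (\<lambda>z. pd w f z + pd w g z)" for w
      using pd_add add by blast
    then show ?case using add by (simp add: pd_add polynomial_pd)
  next
    case (mult f g)
    have e: "pd w (\<lambda>x. f x * g x) = (\<lambda>z. f z * pd w g z + pd w f z * g z)" for w
      using pd_mult mult by blast
    note fg = mult(1,2)
    have r1: "real_polynomial_function (\<lambda>z. f z * pd w g z)" for w
      by (rule polynomial_mult[OF fg(1) polynomial_pd(2)[OF fg(2)]])
    have r2: "real_polynomial_function (\<lambda>z. pd w f z * g z)" for w
      by (rule polynomial_mult[OF polynomial_pd(2)[OF fg(1)] fg(2)])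
    have "pd u (\<lambda>z. f z * pd v g z + pd v f z * g z) z
        = f z * pd u (pd v g) z + pd u f z * pd v g z + (pd v f z * pd u g z + pd u (pd v f) z * g z)" for u v z
      using pd_add[OF r1[of v] r2[of v], of u z] pd_mult[OF fg(1) polynomial_pd(2)[OF fg(2)], of u v z]
        pd_mult[OF polynomial_pd(2)[OF fg(1)] fg(2), of u v z] by simp
    then show ?case unfolding e using mult(3,4) by (simp add: algebra_simps)
  qed
  then show ?thesis by blast
qed

lemma polynomial_continuous: "real_polynomial_function f \<Longrightarrow> continuous_on S f"
  for f :: "'a::euclidean_space \<Rightarrow> real"
  by (simp add: continuous_on_polymonial_function real_polynomial_function_eq)

lemma polynomial_line:
  fixes f :: "'a::real_normed_vector \<Rightarrow> real"
  assumes "real_polynomial_function f"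
  shows "real_polynomial_function (\<lambda>\<tau>. f (a + \<tau> *\<^sub>R v))"
  using assms
proof induction
  case (linear f)
  then have "(\<lambda>\<tau>. f (a + \<tau> *\<^sub>R v)) = (\<lambda>\<tau>. f a + \<tau> * f v)"
    by (simp add: linear_simps)
  moreover have id: "real_polynomial_function (\<lambda>\<tau>::real. \<tau>)" by (rule polynomial_linear) (rule bounded_linear_ident)
  have "real_polynomial_function (\<lambda>\<tau>. f a + \<tau> * f v)"
    by (rule polynomial_add[OF polynomial_const polynomial_mult[OF id polynomial_const]])
  ultimately show ?case by simp
next
  case (const c)
  show ?case by (rule polynomial_const)
next
  case (add f g)
  show ?case by (rule polynomial_add[OF add(3,4)])
next
  case (mult f g)
  show ?case by (rule polynomial_mult[OF mult(3,4)])
qed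

lemma polynomial_line_derivative:
  assumes "real_polynomial_function f"
  shows "((\<lambda>\<tau>. f (a + \<tau> *\<^sub>R v)) has_real_derivative pd v f (a + \<tau> *\<^sub>R v)) (at \<tau>)"
proof -
  have g: "((\<lambda>\<tau>. a + \<tau> *\<^sub>R v) has_derivative (\<lambda>h. h *\<^sub>R v)) (at \<tau>)"
    by (auto intro!: derivative_eq_intros)
  have lin: "linear (\<lambda>v. pd v f (a + \<tau> *\<^sub>R v'))" for v' 
    using pd_has_derivative[OF assms] has_derivative_linear by blast
  have "((\<lambda>\<tau>. f (a + \<tau> *\<^sub>R v)) has_derivative (\<lambda>h. pd (h *\<^sub>R v) f (a + \<tau> *\<^sub>R v))) (at \<tau>)"
    using diff_chain_at[OF g pd_has_derivative[OF assms]] by (simp add: o_def)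
  moreover have "(\<lambda>h. pd (h *\<^sub>R v) f (a + \<tau> *\<^sub>R v)) = (*) (pd v f (a + \<tau> *\<^sub>R v))"
    using linear_scale[OF lin] by (auto simp: mult.commute)
  ultimately show ?thesis by (simp add: has_field_derivative_def)
qed

text \<open>On the line from an interior point \<open>a\<close> of \<open>S\<close> to
  \<open>x\<close> the polynomial has one variable and infinitely many zeros, so its coefficients
  vanish; \<open>x\<close> is reached at parameter 1.\<close>

lemma polynomial_zero_extend:
  fixes f :: "'a::real_normed_vector \<Rightarrow> real"
  assumes f: "real_polynomial_function f" and S: "interior S \<noteq> {}" and z: "\<And>x. x \<in> S \<Longrightarrow> f x = 0"
  shows "f x = 0"
proof -
  obtain a where "a \<in> interior S" using S by blast
  then obtain e where e: "0 < e" "ball a e \<subseteq> S" by (auto simp: mem_interior)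
  define g where "g = (\<lambda>\<tau>. f (a + \<tau> *\<^sub>R (x - a)))"
  have "real_polynomial_function g" unfolding g_def by (rule polynomial_line[OF f])
  then obtain c n where g: "g = (\<lambda>\<tau>. \<Sum>i\<le>n. c i * \<tau> ^ i)" unfolding real_polynomial_function_iff_sum by blast
  \<comment> \<open>Keeps \<open>\<tau> * norm (x - a)\<close> below \<open>e\<close>; the added 1
    avoids a zero denominator for \<open>x = a\<close>.\<close>
  define d where "d = e / (norm (x - a) + 1)"
  have nn: "norm (x - a) + 1 > 0" using norm_ge_zero[of "x - a"] by linarith
  have d: "d > 0" using e nn by (simp add: d_def)
  have "{0<..<d} \<subseteq> {\<tau>. g \<tau> = 0}"
  proof
    fix \<tau> assume t: "\<tau> \<in> {0<..<d}"
    have "\<tau> * norm (x - a) \<le> \<tau> * (norm (x - a) + 1)" using t by (intro mult_left_mono) auto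
    also have "\<dots> < d * (norm (x - a) + 1)" using t nn by (intro mult_strict_right_mono) auto
    also have "\<dots> = e" using nn by (simp add: d_def)
    finally have "a + \<tau> *\<^sub>R (x - a) \<in> ball a e" using t by (simp add: dist_norm)
    then show "\<tau> \<in> {\<tau>. g \<tau> = 0}" using e z by (auto simp: g_def)
  qed
  then have "infinite {\<tau>. g \<tau> = 0}" using d infinite_Ioo[of 0 d] finite_subset by blast
  then have "\<forall>i\<le>n. c i = 0" using polyfun_finite_roots[of c n] unfolding g by auto
  then have "g 1 = 0" unfolding g by simp
  then show ?thesis by (simp add: g_def)
qed

section \<open>Vector fields with polynomial components\<close>

abbreviation poly_field :: "field \<Rightarrow> bool" where
  "poly_field E \<equiv> \<forall>i. real_polynomial_function (\<lambda>z. E z $ i)"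

lemma frechet_derivative_poly_field:
  assumes E: "poly_field E"
  shows "frechet_derivative E (at z) v $ i = pd v (\<lambda>z. E z $ i) z"
proof -
  have "(E has_derivative (\<lambda>v. \<chi> i. pd v (\<lambda>z. E z $ i) z)) (at z)"
  proof -
    have "((\<lambda>z. E z \<bullet> b) has_derivative (\<lambda>v. (\<chi> i. pd v (\<lambda>z. E z $ i) z) \<bullet> b)) (at z)" if b: "b \<in> Basis" for b
    proof -
      obtain i where "b = axis i 1" using b by (auto simp: Basis_vec_def)
      then show ?thesis using pd_has_derivative[OF E[rule_format, of i]] by (simp add: inner_axis)
    qed
    then show ?thesis using has_derivative_componentwise_within[of E _ z UNIV] by blast
  qed
  from frechet_derivative_at[OF this] have "frechet_derivative E (at z) = (\<lambda>v. \<chi> i. pd v (\<lambda>z. E z $ i) z)" by simp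
  then show ?thesis by simp
qed

lemma time_deriv_nth: "poly_field E \<Longrightarrow> time_deriv E z $ i = pd (0, 1) (\<lambda>z. E z $ i) z"
  unfolding time_deriv_def by (rule frechet_derivative_poly_field)

lemma curl_nth:
  assumes "poly_field E"
  shows "curl E z $ 1 = pd (axis 2 1, 0) (\<lambda>z. E z $ 3) z - pd (axis 3 1, 0) (\<lambda>z. E z $ 2) z"
    "curl E z $ 2 = pd (axis 3 1, 0) (\<lambda>z. E z $ 1) z - pd (axis 1 1, 0) (\<lambda>z. E z $ 3) z"
    "curl E z $ 3 = pd (axis 1 1, 0) (\<lambda>z. E z $ 2) z - pd (axis 2 1, 0) (\<lambda>z. E z $ 1) z"
  unfolding curl_def space_deriv_def by (simp_all add: frechet_derivative_poly_field[OF assms])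

lemma poly_field_time_deriv: "poly_field E \<Longrightarrow> poly_field (time_deriv E)"
  by (simp add: time_deriv_nth polynomial_pd)

lemma poly_field_curl: "poly_field E \<Longrightarrow> poly_field (curl E)"
  unfolding forall_3 by (simp add: curl_nth forall_3 polynomial_pd real_polynomial_function_diff)

lemma poly_field_add_scale:
  "poly_field E \<Longrightarrow> poly_field F \<Longrightarrow> poly_field (\<lambda>z. a *\<^sub>R E z + b *\<^sub>R F z)"
  by (simp add: polynomial_add polynomial_cmult)

lemma time_deriv_lincomb:
  assumes "poly_field E" "poly_field F"
  shows "time_deriv (\<lambda>z. a *\<^sub>R E z + b *\<^sub>R F z) z = a *\<^sub>R time_deriv E z + b *\<^sub>R time_deriv F z"
proof -
  have r: "real_polynomial_function (\<lambda>z. c * G z $ i)" if "poly_field G" for c G i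
    using that by (simp add: polynomial_cmult)
  show ?thesis
    by (simp add: vec_eq_iff time_deriv_nth[OF assms(1)] time_deriv_nth[OF assms(2)]
      time_deriv_nth[OF poly_field_add_scale[OF assms]] pd_add[OF r r] pd_cmult assms)
qed

lemma curl_lincomb:
  assumes "poly_field E" "poly_field F"
  shows "curl (\<lambda>z. a *\<^sub>R E z + b *\<^sub>R F z) z = a *\<^sub>R curl E z + b *\<^sub>R curl F z"
proof -
  have r: "real_polynomial_function (\<lambda>z. c * G z $ i)" if "poly_field G" for c G i
    using that by (simp add: polynomial_cmult)
  show ?thesis
    by (simp add: vec_eq_iff forall_3 curl_nth[OF assms(1)] curl_nth[OF assms(2)]
      curl_nth[OF poly_field_add_scale[OF assms]] pd_add[OF r r] pd_cmult assms algebra_simps)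
qed

lemma maxwell_at_lincomb:
  assumes p: "poly_field E" "poly_field H" "poly_field E'" "poly_field H'"
    and m: "maxwell_at \<epsilon> \<mu> E H z" "maxwell_at \<epsilon> \<mu> E' H' z"
  shows "maxwell_at \<epsilon> \<mu> (\<lambda>z. a *\<^sub>R E z + b *\<^sub>R E' z) (\<lambda>z. a *\<^sub>R H z + b *\<^sub>R H' z) z"
proof -
  have "curl H z = \<epsilon> *\<^sub>R time_deriv E z" "curl H' z = \<epsilon> *\<^sub>R time_deriv E' z"
    "curl E z = - (\<mu> *\<^sub>R time_deriv H z)" "curl E' z = - (\<mu> *\<^sub>R time_deriv H' z)"
    using m by (simp_all add: maxwell_at_def eq_neg_iff_add_eq_0 add.commute)
  then show ?thesis
    unfolding maxwell_at_def time_deriv_lincomb[OF p(1,3)] time_deriv_lincomb[OF p(2,4)]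
      curl_lincomb[OF p(1,3)] curl_lincomb[OF p(2,4)] by (simp add: algebra_simps)
qed

text \<open>The residuals of both equations are polynomials vanishing on a set with interior points.
  The equations then hold on full time slices, as the uniqueness argument at one time
  requires.\<close>

lemma maxwell_everywhere:
  assumes p: "poly_field E" "poly_field H" and S: "interior S \<noteq> {}" and m: "\<And>z. z \<in> S \<Longrightarrow> maxwell_at \<epsilon> \<mu> E H z"
  shows "maxwell_at \<epsilon> \<mu> E H z"
proof -
  have "(\<epsilon> *\<^sub>R time_deriv E z - curl H z) $ i = 0" for z i
  proof (rule polynomial_zero_extend[OF _ S])
    show "real_polynomial_function (\<lambda>z. (\<epsilon> *\<^sub>R time_deriv E z - curl H z) $ i)"
      using poly_field_time_deriv[OF p(1)] poly_field_curl[OF p(2)]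
      by (simp add: real_polynomial_function_diff polynomial_cmult)
  qed (use m in \<open>simp add: maxwell_at_def\<close>)
  moreover have "(\<mu> *\<^sub>R time_deriv H z + curl E z) $ i = 0" for z i
  proof (rule polynomial_zero_extend[OF _ S])
    show "real_polynomial_function (\<lambda>z. (\<mu> *\<^sub>R time_deriv H z + curl E z) $ i)"
      using poly_field_time_deriv[OF p(2)] poly_field_curl[OF p(1)]
      by (simp add: polynomial_add polynomial_cmult)
  qed (use m in \<open>simp add: maxwell_at_def\<close>)
  ultimately show ?thesis by (simp add: maxwell_at_def vec_eq_iff)
qed

section \<open>Uniqueness for Maxwell's equations with polynomial fields\<close>

primrec nilpotent_pd :: "'a::real_normed_vector \<Rightarrow> nat \<Rightarrow> ('a \<Rightarrow> real) \<Rightarrow> bool" where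
  "nilpotent_pd v 0 f \<longleftrightarrow> (\<forall>z. f z = 0)"
| "nilpotent_pd v (Suc m) f \<longleftrightarrow> nilpotent_pd v m (pd v f)"

lemma nilpotent_pd_zero: "nilpotent_pd v m (\<lambda>z. 0)"
proof (induction m)
  case (Suc m)
  have "pd v (\<lambda>z. 0) = (\<lambda>z. 0)" by (rule ext) simp
  then show ?case using Suc by simp
qed simp

lemma nilpotent_pd_add:
  "real_polynomial_function f \<Longrightarrow> real_polynomial_function g \<Longrightarrow> nilpotent_pd v m f \<Longrightarrow> nilpotent_pd v m g
    \<Longrightarrow> nilpotent_pd v m (\<lambda>z. f z + g z)"
proof (induction m arbitrary: f g)
  case (Suc m)
  have e: "pd v (\<lambda>z. f z + g z) = (\<lambda>z. pd v f z + pd v g z)" using pd_add Suc.prems by blast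
  show ?case unfolding nilpotent_pd.simps e by (intro Suc.IH polynomial_pd) (use Suc.prems in simp_all)
qed simp

lemma nilpotent_pd_mono: "nilpotent_pd v m f \<Longrightarrow> m \<le> n \<Longrightarrow> nilpotent_pd v n f"
proof (induction m arbitrary: f n)
  case 0
  then have "f = (\<lambda>z. 0)" by auto
  then show ?case using nilpotent_pd_zero by blast
next
  case (Suc m)
  then show ?case by (cases n) auto
qed

text \<open>By the product rule each differentiation is spent on one of the factors, so after
  \<open>a + b\<close> of them one factor has vanished in every term.\<close>

lemma nilpotent_pd_mult:
  "real_polynomial_function f \<Longrightarrow> real_polynomial_function g \<Longrightarrow> nilpotent_pd v a f \<Longrightarrow> nilpotent_pd v b g \<Longrightarrow> a + b \<le> n
    \<Longrightarrow> nilpotent_pd v n (\<lambda>z. f z * g z)"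
proof (induction n arbitrary: f g a b)
  case 0
  then show ?case by simp
next
  case (Suc n)
  have e: "pd v (\<lambda>z. f z * g z) = (\<lambda>z. f z * pd v g z + pd v f z * g z)" using pd_mult Suc.prems by blast
  show ?case
  proof (cases "a = 0 \<or> b = 0")
    case True
    then have "(\<lambda>z. f z * g z) = (\<lambda>z. 0)" using Suc.prems by auto
    then show ?thesis using nilpotent_pd_zero by metis
  next
    case False
    then obtain a' b' where ab: "a = Suc a'" "b = Suc b'" by (cases a; cases b) auto
    have "nilpotent_pd v n (\<lambda>z. f z * pd v g z)"
      by (rule Suc.IH[of _ _ a b']) (use Suc.prems ab polynomial_pd in auto)
    moreover have "nilpotent_pd v n (\<lambda>z. pd v f z * g z)"
      by (rule Suc.IH[of _ _ a' b]) (use Suc.prems ab polynomial_pd in auto)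
    ultimately show ?thesis
      unfolding nilpotent_pd.simps e by (intro nilpotent_pd_add polynomial_mult polynomial_pd Suc.prems)
  qed
qed

lemma polynomial_nilpotent: "real_polynomial_function f \<Longrightarrow> \<exists>m. nilpotent_pd v m f"
proof (induction rule: real_polynomial_function.induct)
  case (linear f)
  have "pd v f = (\<lambda>z. f v)"
    using pd_eqI[OF bounded_linear_imp_has_derivative[OF linear]] by blast
  then have "nilpotent_pd v 2 f" by (simp add: numeral_2_eq_2)
  then show ?case by blast
next
  case (const c)
  have "nilpotent_pd v 1 (\<lambda>x. c)" by simp
  then show ?case by blast
next
  case (add f g)
  then obtain a b where "nilpotent_pd v a f" "nilpotent_pd v b g" by blast
  then have "nilpotent_pd v (max a b) f" "nilpotent_pd v (max a b) g"
    by (auto elim!: nilpotent_pd_mono)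
  from nilpotent_pd_add[OF add.hyps this] show ?case by (rule exI)
next
  case (mult f g)
  then show ?case using nilpotent_pd_mult by blast
qed

text \<open>A derivative in a spatial direction sees only the values on the time slice.\<close>

lemma pd_slice_zero:
  fixes f :: "vec3 \<times> real \<Rightarrow> real"
  assumes f: "real_polynomial_function f" and z: "\<And>x. f (x, s0) = 0"
  shows "pd (v, 0) f (x, s0) = 0"
proof -
  have "(\<lambda>\<tau>. f ((x, s0) + \<tau> *\<^sub>R (v, 0))) = (\<lambda>\<tau>. 0)" using z by simp
  then show ?thesis
    using polynomial_line_derivative[OF f, of "(x, s0)" "(v, 0)" 0] DERIV_unique[OF _ DERIV_const] by fastforce
qed

lemma pd_time_zero:
  fixes f :: "vec3 \<times> real \<Rightarrow> real"
  assumes f: "real_polynomial_function f" and d: "\<And>z. pd (0, 1) f z = 0" and z: "\<And>x. f (x, s0) = 0"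
  shows "f (x, s) = 0"
proof -
  have "((\<lambda>\<tau>. f ((x, s0) + \<tau> *\<^sub>R (0, 1))) has_real_derivative 0) (at \<tau>)" for \<tau>
    using polynomial_line_derivative[OF f, of "(x, s0)" "(0, 1)" \<tau>] d by simp
  then have "f ((x, s0) + (s - s0) *\<^sub>R (0, 1)) = f ((x, s0) + 0 *\<^sub>R (0, 1))"
    using DERIV_isconst_all by blast
  then show ?thesis using z by simp
qed

text \<open>Differentiation in time maps a solution of Maxwell's equations vanishing at time \<open>s0\<close> to
  another one, and polynomials are annihilated by sufficiently many differentiations.\<close>

lemma maxwell_zero:
  assumes p: "poly_field E" "poly_field H" and m: "\<And>z. maxwell_at \<epsilon> \<mu> E H z" and pos: "\<epsilon> \<noteq> 0" "\<mu> \<noteq> 0"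
    and z: "\<And>x. E (x, s0) = 0" "\<And>x. H (x, s0) = 0"
  shows "E w = 0 \<and> H w = 0"
proof -
  \<comment> \<open>Stated for all fields, so that the induction hypothesis can be used for the time
    derivatives.\<close>
  have main: "(\<forall>i. nilpotent_pd (0, 1) n (\<lambda>z. E z $ i) \<and> nilpotent_pd (0, 1) n (\<lambda>z. H z $ i)) \<Longrightarrow>
     poly_field E \<Longrightarrow> poly_field H \<Longrightarrow> (\<forall>z. maxwell_at \<epsilon> \<mu> E H z) \<Longrightarrow> (\<forall>x. E (x, s0) = 0 \<and> H (x, s0) = 0)
     \<Longrightarrow> (\<forall>w. E w = 0 \<and> H w = 0)" for n E H
  proof (induction n arbitrary: E H)
    case 0
    then show ?case by (simp add: vec_eq_iff)
  next
    case (Suc n)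
    note p = Suc.prems(2,3)
    let ?E = "time_deriv E" and ?H = "time_deriv H"
    have c: "curl H z = \<epsilon> *\<^sub>R ?E z" "curl E z = (- \<mu>) *\<^sub>R ?H z" for z
    proof -
      have "\<epsilon> *\<^sub>R ?E z - curl H z = 0" "\<mu> *\<^sub>R ?H z + curl E z = 0"
        using Suc.prems(4) unfolding maxwell_at_def by blast+
      then show "curl H z = \<epsilon> *\<^sub>R ?E z" "curl E z = (- \<mu>) *\<^sub>R ?H z" by (simp_all add: add_eq_0_iff)
    qed
    have cc: "curl (time_deriv F) z = time_deriv (curl F) z" if F: "poly_field F" for F z
    proof -
      have "(\<lambda>z. time_deriv F z $ i) = pd (0, 1) (\<lambda>z. F z $ i)" for i
        using time_deriv_nth[OF F] by blast
      moreover have "(\<lambda>z. curl F z $ 1) = (\<lambda>z. pd (axis 2 1, 0) (\<lambda>z. F z $ 3) z - pd (axis 3 1, 0) (\<lambda>z. F z $ 2) z)"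
        by (rule ext) (rule curl_nth[OF F])
      moreover have "(\<lambda>z. curl F z $ 2) = (\<lambda>z. pd (axis 3 1, 0) (\<lambda>z. F z $ 1) z - pd (axis 1 1, 0) (\<lambda>z. F z $ 3) z)"
        by (rule ext) (rule curl_nth[OF F])
      moreover have "(\<lambda>z. curl F z $ 3) = (\<lambda>z. pd (axis 1 1, 0) (\<lambda>z. F z $ 2) z - pd (axis 2 1, 0) (\<lambda>z. F z $ 1) z)"
        by (rule ext) (rule curl_nth[OF F])
      moreover have "pd (0, 1) (\<lambda>z. pd u (\<lambda>z. F z $ i) z - pd v (\<lambda>z. F z $ j) z) z
          = pd u (pd (0, 1) (\<lambda>z. F z $ i)) z - pd v (pd (0, 1) (\<lambda>z. F z $ j)) z" for u v i j
        using F by (simp add: pd_diff polynomial_pd(2) pd_commute[of _ u "(0, 1)"] pd_commute[of _ v "(0, 1)"])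
      ultimately show ?thesis
        unfolding vec_eq_iff forall_3 curl_nth[OF poly_field_time_deriv[OF F]] time_deriv_nth[OF poly_field_curl[OF F]]
        by (simp only: simp_thms)
    qed
    have td: "time_deriv (\<lambda>z. a *\<^sub>R F z) z = a *\<^sub>R time_deriv F z" if "poly_field F" for F a z
      using time_deriv_lincomb[OF that that, of a 0 z] by simp
    have "maxwell_at \<epsilon> \<mu> ?E ?H z" for z
    proof -
      have "curl H = (\<lambda>z. \<epsilon> *\<^sub>R ?E z)" "curl E = (\<lambda>z. (- \<mu>) *\<^sub>R ?H z)" using c by blast+
      then have "curl ?H z = \<epsilon> *\<^sub>R time_deriv ?E z" "curl ?E z = (- \<mu>) *\<^sub>R time_deriv ?H z"
        using cc[OF p(1), of z] cc[OF p(2), of z] td[OF poly_field_time_deriv[OF p(1)], of \<epsilon> z]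
          td[OF poly_field_time_deriv[OF p(2)], of "- \<mu>" z] by simp_all
      then show ?thesis by (simp add: maxwell_at_def)
    qed
    \<comment> \<open>Fields vanishing on the slice have vanishing curl there; the equations, with
      nonzero coefficients, pass this on to the time derivatives.\<close>
    moreover have "?E (x, s0) = 0 \<and> ?H (x, s0) = 0" for x
    proof -
      have "curl F (x, s0) = 0" if F: "poly_field F" "\<And>x. F (x, s0) = 0" for F
        using F by (simp add: vec_eq_iff forall_3 curl_nth[OF F(1)] pd_slice_zero)
      then have "curl E (x, s0) = 0" "curl H (x, s0) = 0" using Suc.prems by blast+
      then show ?thesis using c[of "(x, s0)"] pos by simp
    qed
    moreover have "nilpotent_pd (0, 1) n (\<lambda>z. ?E z $ i) \<and> nilpotent_pd (0, 1) n (\<lambda>z. ?H z $ i)" for i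
    proof -
      have "(\<lambda>z. ?E z $ i) = pd (0, 1) (\<lambda>z. E z $ i)" "(\<lambda>z. ?H z $ i) = pd (0, 1) (\<lambda>z. H z $ i)"
        using time_deriv_nth p by blast+
      then show ?thesis using Suc.prems(1) by simp
    qed
    \<comment> \<open>The time derivatives vanish identically, so the fields are constant in time
      and keep their value 0 from time \<open>s0\<close>.\<close>
    ultimately have 0: "?E w = 0 \<and> ?H w = 0" for w
      using Suc.IH[of ?E ?H] poly_field_time_deriv[OF p(1)] poly_field_time_deriv[OF p(2)] by blast
    have "E (x, s) = 0 \<and> H (x, s) = 0" for x s
    proof -
      have "pd (0, 1) (\<lambda>z. E z $ i) z = 0" "pd (0, 1) (\<lambda>z. H z $ i) z = 0" for i z
        using 0[of z] time_deriv_nth[OF p(1), of z i] time_deriv_nth[OF p(2), of z i] by simp_all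
      then have "E (x, s) $ i = 0" "H (x, s) $ i = 0" for i
        using pd_time_zero[of "\<lambda>z. E z $ i" s0 x s] pd_time_zero[of "\<lambda>z. H z $ i" s0 x s] p Suc.prems(5) by simp_all
      then show ?thesis by (simp add: vec_eq_iff)
    qed
    then show ?case by auto
  qed
  have "\<forall>i. \<exists>n. nilpotent_pd (0, 1) n (\<lambda>z. E z $ i) \<and> nilpotent_pd (0, 1) n (\<lambda>z. H z $ i)"
  proof
    fix i
    obtain a b where "nilpotent_pd (0, 1) a (\<lambda>z. E z $ i)" "nilpotent_pd (0, 1) b (\<lambda>z. H z $ i)"
      using polynomial_nilpotent[OF p(1)[rule_format, of i]] polynomial_nilpotent[OF p(2)[rule_format, of i]] by blast
    then have "nilpotent_pd (0, 1) (max a b) (\<lambda>z. E z $ i) \<and> nilpotent_pd (0, 1) (max a b) (\<lambda>z. H z $ i)"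
      by (auto elim!: nilpotent_pd_mono)
    then show "\<exists>n. nilpotent_pd (0, 1) n (\<lambda>z. E z $ i) \<and> nilpotent_pd (0, 1) n (\<lambda>z. H z $ i)" by blast
  qed
  then obtain N where N: "\<And>i. nilpotent_pd (0, 1) (N i) (\<lambda>z. E z $ i) \<and> nilpotent_pd (0, 1) (N i) (\<lambda>z. H z $ i)"
    by metis
  have "nilpotent_pd (0, 1) (Max (range N)) (\<lambda>z. E z $ i) \<and> nilpotent_pd (0, 1) (Max (range N)) (\<lambda>z. H z $ i)" for i
  proof -
    have "N i \<le> Max (range N)" by simp
    then show ?thesis using N[of i] nilpotent_pd_mono by blast
  qed
  then show ?thesis using main[of "Max (range N)" E H] p m z by blast
qed

subsection \<open>Poynting's theorem and summation over the mesh\<close>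

text \<open>A class that contains polynomials as well as the discontinuous components of
  \<open>unit_normal\<close>, is closed under sums and products, and consists of functions
  integrable over bounded Borel pieces of faces and slabs.\<close>

definition locally_bounded :: "('a::real_normed_vector \<Rightarrow> real) \<Rightarrow> bool" where
  "locally_bounded f \<longleftrightarrow> f \<in> borel_measurable borel \<and> (\<forall>r. \<exists>B. \<forall>z. norm z \<le> r \<longrightarrow> \<bar>f z\<bar> \<le> B)"

lemma locally_bounded_const: "locally_bounded (\<lambda>z. c)"
  by (auto simp: locally_bounded_def)

lemma locally_bounded_add:
  assumes "locally_bounded f" "locally_bounded g"
  shows "locally_bounded (\<lambda>z. f z + g z)"
  unfolding locally_bounded_def
proof (intro conjI allI)
  fix r
  obtain B C where "\<And>z. norm z \<le> r \<Longrightarrow> \<bar>f z\<bar> \<le> B" "\<And>z. norm z \<le> r \<Longrightarrow> \<bar>g z\<bar> \<le> C"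
    using assms unfolding locally_bounded_def by metis
  then have "\<forall>z. norm z \<le> r \<longrightarrow> \<bar>f z + g z\<bar> \<le> B + C" by (meson abs_triangle_ineq add_mono order_trans)
  then show "\<exists>B. \<forall>z. norm z \<le> r \<longrightarrow> \<bar>f z + g z\<bar> \<le> B" by blast
qed (use assms in \<open>auto simp: locally_bounded_def\<close>)

lemma locally_bounded_mult:
  assumes "locally_bounded f" "locally_bounded g"
  shows "locally_bounded (\<lambda>z. f z * g z)"
  unfolding locally_bounded_def
proof (intro conjI allI)
  fix r
  obtain B C where BC: "\<And>z. norm z \<le> r \<Longrightarrow> \<bar>f z\<bar> \<le> B" "\<And>z. norm z \<le> r \<Longrightarrow> \<bar>g z\<bar> \<le> C"
    using assms unfolding locally_bounded_def by metis
  have "\<bar>f z * g z\<bar> \<le> B * C" if "norm z \<le> r" for z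
    unfolding abs_mult using BC[OF that] abs_ge_zero[of "f z"] by (intro mult_mono) linarith+
  then show "\<exists>B. \<forall>z. norm z \<le> r \<longrightarrow> \<bar>f z * g z\<bar> \<le> B" by blast
qed (use assms in \<open>auto simp: locally_bounded_def\<close>)

lemma locally_bounded_cmult: "locally_bounded f \<Longrightarrow> locally_bounded (\<lambda>z. c * f z)"
  by (rule locally_bounded_mult[OF locally_bounded_const])

lemma locally_bounded_uminus: "locally_bounded f \<Longrightarrow> locally_bounded (\<lambda>z. - f z)"
  using locally_bounded_cmult[of f "- 1"] by simp

lemma locally_bounded_diff: "locally_bounded f \<Longrightarrow> locally_bounded g \<Longrightarrow> locally_bounded (\<lambda>z. f z - g z)"
  using locally_bounded_add[OF _ locally_bounded_uminus, of f g] by simp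

lemma locally_bounded_sum: "(\<And>i. i \<in> I \<Longrightarrow> locally_bounded (f i)) \<Longrightarrow> locally_bounded (\<lambda>z. \<Sum>i\<in>I. f i z)"
  by (induction I rule: infinite_finite_induct) (simp_all add: locally_bounded_const locally_bounded_add)

lemma locally_bounded_polynomial:
  fixes f :: "'a::euclidean_space \<Rightarrow> real"
  assumes "real_polynomial_function f"
  shows "locally_bounded f"
  unfolding locally_bounded_def
proof (intro conjI allI)
  show "f \<in> borel_measurable borel"
    by (intro borel_measurable_continuous_onI polynomial_continuous[OF assms])
  fix r
  have "bounded (f ` cball 0 r)"
    by (intro compact_imp_bounded compact_continuous_image polynomial_continuous[OF assms]) auto
  then obtain B where "\<forall>y\<in>f ` cball 0 r. norm y \<le> B" unfolding bounded_iff by blast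
  then have "\<forall>z. norm z \<le> r \<longrightarrow> \<bar>f z\<bar> \<le> B" by simp
  then show "\<exists>B. \<forall>z. norm z \<le> r \<longrightarrow> \<bar>f z\<bar> \<le> B" by blast
qed

abbreviation locally_bounded_field :: "field \<Rightarrow> bool" where
  "locally_bounded_field F \<equiv> \<forall>i. locally_bounded (\<lambda>z. F z $ i)"

lemma locally_bounded_cross:
  assumes "locally_bounded_field F" "locally_bounded_field G"
  shows "locally_bounded_field (\<lambda>z. cross3 (F z) (G z))"
  unfolding forall_3 cross_components using assms by (auto intro!: locally_bounded_diff locally_bounded_mult)

lemma locally_bounded_inner:
  assumes "locally_bounded_field F" "locally_bounded_field G"
  shows "locally_bounded (\<lambda>z. F z \<bullet> G z)"
  unfolding inner_vec_def sum_3 using assms by (auto intro!: locally_bounded_add locally_bounded_mult)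

lemma locally_bounded_field_sum:
  "(\<And>K. K \<in> I \<Longrightarrow> locally_bounded_field (F K)) \<Longrightarrow> locally_bounded_field (\<lambda>z. \<Sum>K\<in>I. F K z)"
  using locally_bounded_sum[of I "\<lambda>K z. F K z $ i" for i] by simp

lemma poly_field_locally_bounded: "poly_field E \<Longrightarrow> locally_bounded_field E"
  using locally_bounded_polynomial by blast

lemma integrable_indicator_compact:
  fixes f :: "'a::euclidean_space \<Rightarrow> real"
  assumes "compact S" "continuous_on UNIV f"
  shows "integrable lborel (\<lambda>x. indicator S x * f x)"
  using borel_integrable_compact[OF assms(1) continuous_on_subset[OF assms(2)]]
  by (simp add: indicator_def if_distrib cong: if_cong)

lemma integrable_slab:
  fixes f :: "vec3 \<times> real \<Rightarrow> real"
  assumes "compact K" "real_polynomial_function f"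
  shows "integrable (lborel \<Otimes>\<^sub>M lborel) (\<lambda>z. indicator (K \<times> {a..b}) z * f z)"
  unfolding lborel_prod
  by (rule integrable_indicator_compact[OF compact_Times[OF assms(1) compact_Icc] polynomial_continuous[OF assms(2)]])

context mesh_family
begin

abbreviation ST :: "(vec3 \<times> real) measure" where "ST \<equiv> sheets \<P> \<Otimes>\<^sub>M lborel"

abbreviation ST_integral :: "vec3 set \<Rightarrow> real set \<Rightarrow> (vec3 \<times> real \<Rightarrow> real) \<Rightarrow> real" where
  "ST_integral S I F \<equiv> LINT z|ST. indicator (S \<times> I) z * F z"

lemma integrable_ST:
  assumes S: "S \<in> sets borel" "bounded S" and I: "I \<in> sets borel" "bounded I" and F: "locally_bounded F"
  shows "integrable ST (\<lambda>z. indicator (S \<times> I) z * F z)"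
proof -
  obtain r where r: "\<And>z. z \<in> S \<times> I \<Longrightarrow> norm z \<le> r"
    using bounded_Times[OF S(2) I(2)] by (auto simp: bounded_iff)
  obtain B where "\<And>z. norm z \<le> r \<Longrightarrow> \<bar>F z\<bar> \<le> B" using F unfolding locally_bounded_def by blast
  then have B: "\<And>z. z \<in> S \<times> I \<Longrightarrow> \<bar>F z\<bar> \<le> B" using r by blast
  have "emeasure ST (S \<times> I) = emeasure (sheets \<P>) S * emeasure lborel I"
    using S I by (intro lborel.emeasure_pair_measure_Times) auto
  also have "\<dots> < \<infinity>"
    using emeasure_sheets_bounded[OF S(2)] emeasure_bounded_finite[OF I(2)] by (simp add: ennreal_mult_less_top)
  finally show ?thesis
    using B F borel_times[OF S(1) I(1)] unfolding locally_bounded_def measurable_space_time[symmetric]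
    by (intro integrable_bounded_indicator[of _ _ _ B]) auto
qed

lemma locally_bounded_unit_normal: "locally_bounded_field (\<lambda>z. unit_normal K (fst z))"
proof
  fix i
  have "fst \<in> borel_measurable (borel :: (vec3 \<times> real) measure)"
    by (intro borel_measurable_continuous_onI continuous_on_fst continuous_on_id)
  moreover have "(\<lambda>x. unit_normal K x \<bullet> axis i 1) \<in> borel_measurable borel" by measurable
  then have "(\<lambda>x. unit_normal K x $ i) \<in> borel_measurable borel" by (simp add: inner_axis)
  ultimately have m: "(\<lambda>z. unit_normal K (fst z) $ i) \<in> borel_measurable (borel :: (vec3 \<times> real) measure)"
    by (rule measurable_compose)
  have bnd: "\<bar>unit_normal K x $ i\<bar> \<le> 2 * real (card \<P>)" for x
    using component_le_norm_cart[of "unit_normal K x" i] norm_unit_normal_le[of K x] by linarith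
  show "locally_bounded (\<lambda>z :: vec3 \<times> real. unit_normal K (fst z) $ i)"
    unfolding locally_bounded_def
  proof (intro conjI allI)
    show "(\<lambda>z. unit_normal K (fst z) $ i) \<in> borel_measurable (borel :: (vec3 \<times> real) measure)" by (rule m)
    show "\<exists>B. \<forall>z :: vec3 \<times> real. norm z \<le> r \<longrightarrow> \<bar>unit_normal K (fst z) $ i\<bar> \<le> B" for r
      using bnd by blast
  qed
qed

lemma frontier_element: "K \<in> M \<Longrightarrow> frontier K \<in> sets borel" "K \<in> M \<Longrightarrow> bounded (frontier K)"
  using element_compact compact_frontier compact_imp_bounded by (auto intro: borel_closed)

lemma time_integral:
  fixes a b :: real
  assumes K: "K \<in> M" and t: "a \<le> b" and G: "real_polynomial_function G"
  shows "(LINT z|(lborel \<Otimes>\<^sub>M lborel). indicator (K \<times> {a..b}) z * pd (0, 1) G z) = (LINT x|lborel. indicator K x * (G (x, b) - G (x, a)))"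
proof -
  have int: "integrable (lborel \<Otimes>\<^sub>M lborel) (\<lambda>z. indicator (K \<times> {a..b}) z * pd (0, 1) G z)"
    by (rule integrable_slab[OF element_compact[OF K] polynomial_pd(2)[OF G]])
  have inner: "(LINT s|lborel. indicator (K \<times> {a..b}) (x, s) * pd (0, 1) G (x, s)) = indicator K x * (G (x, b) - G (x, a))" for x
  proof -
    have "(LINT s|lborel. pd (0, 1) G (x, s) * indicator {a..b} s) = G (x, b) - G (x, a)"
    proof (rule integral_FTC_Icc_real[OF t])
      show "((\<lambda>s. G (x, s)) has_real_derivative pd (0, 1) G (x, s)) (at s)" for s
        using polynomial_line_derivative[OF G, of "(x, 0)" "(0, 1)" s] by simp
      have "continuous_on UNIV (\<lambda>s. pd (0, 1) G (x, s))"
        by (rule continuous_on_compose2[OF polynomial_continuous[OF polynomial_pd(2)[OF G], of UNIV]]) (auto intro!: continuous_intros)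
      then show "isCont (\<lambda>s. pd (0, 1) G (x, s)) s" for s by (simp add: continuous_on_eq_continuous_at)
    qed
    moreover have "(\<lambda>s. indicator (K \<times> {a..b}) (x, s) * pd (0, 1) G (x, s)) = (\<lambda>s. indicator K x * (pd (0, 1) G (x, s) * indicator {a..b} s))"
      by (auto simp: indicator_def)
    ultimately show ?thesis by simp
  qed
  show ?thesis using lborel_pair.integral_fst'[OF int] unfolding inner by simp
qed

text \<open>The divergence theorem on each time slice, integrated over the slab. Fubini is used with
  time as the outer variable, for the volume measure and for the sheets.\<close>

lemma space_integral:
  assumes K: "K \<in> M" and F: "real_polynomial_function F"
  shows "(LINT z|(lborel \<Otimes>\<^sub>M lborel). indicator (K \<times> {a..b}) z * pd (axis i 1, 0) F z)
    = ST_integral (frontier K) {a..b} (\<lambda>z. unit_normal K (fst z) $ i * F z)"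
proof -
  let ?f = "\<lambda>z. indicator (K \<times> {a..b}) z * pd (axis i 1, 0) F z"
  let ?g = "\<lambda>z. indicator (frontier K \<times> {a..b}) z * (unit_normal K (fst z) $ i * F z)"
  have eta: "case_prod (\<lambda>x s. ?f (x, s)) = ?f" "case_prod (\<lambda>x s. ?g (x, s)) = ?g" by (rule case_prod_eta)+
  have "integrable (lborel \<Otimes>\<^sub>M lborel) ?f"
    by (rule integrable_slab[OF element_compact[OF K] polynomial_pd(2)[OF F]])
  then have int: "integrable (lborel \<Otimes>\<^sub>M lborel) (case_prod (\<lambda>x s. ?f (x, s)))"
    by (simp only: eta)
  have "integrable ST ?g"
    using locally_bounded_unit_normal locally_bounded_polynomial[OF F] frontier_element[OF K]
    by (intro integrable_ST locally_bounded_mult) auto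
  then have int2: "integrable ST (case_prod (\<lambda>x s. ?g (x, s)))"
    by (simp only: eta)
  have "(LINT x|lborel. ?f (x, s)) = (LINT x|sheets \<P>. ?g (x, s))" for s
  proof -
    have c: "continuous_on UNIV (\<lambda>x. h (x, s))" if "real_polynomial_function h" for h :: "vec3 \<times> real \<Rightarrow> real"
      by (rule continuous_on_compose2[OF polynomial_continuous[OF that, of UNIV]]) (auto intro!: continuous_intros)
    have "(LINT x|lborel. indicator K x * pd (axis i 1, 0) F (x, s)) = (LINT x|sheets \<P>. indicator (frontier K) x * (unit_normal K x $ i * F (x, s)))"
    proof (rule divergence_coordinate[OF K c[OF F] c[OF polynomial_pd(2)[OF F]]])
      show "((\<lambda>\<tau>. F (x + \<tau> *\<^sub>R axis i 1, s)) has_real_derivative pd (axis i 1, 0) F (x, s)) (at 0)" for x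
        using polynomial_line_derivative[OF F, of "(x, s)" "(axis i 1, 0)" 0] by simp
    qed
    then have "(LINT x|lborel. indicator {a..b} s * (indicator K x * pd (axis i 1, 0) F (x, s)))
        = (LINT x|sheets \<P>. indicator {a..b} s * (indicator (frontier K) x * (unit_normal K x $ i * F (x, s))))"
      by simp
    then show ?thesis by (simp add: indicator_times mult_ac)
  qed
  then have "(LINT s|lborel. (LINT x|lborel. ?f (x, s))) = (LINT s|lborel. (LINT x|sheets \<P>. ?g (x, s)))" by simp
  then show ?thesis
    using lborel_pair.integral_snd[OF int] space_time.integral_snd[OF int2] by (simp only: eta)
qed

text \<open>The divergence of \<open>H x E\<close> is
  \<open>E \<bullet> curl H - H \<bullet> curl E\<close>, and Maxwell's equations identify the two
  curls with the weighted time derivatives. The factor 2 appears because the density is taken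
  without the factor 1/2 of the energy.\<close>

lemma poynting_pointwise:
  assumes p: "poly_field E" "poly_field H" and m: "maxwell_at \<epsilon> \<mu> E H z"
  shows "pd (0, 1) (\<lambda>z. \<epsilon> * (E z \<bullet> E z) + \<mu> * (H z \<bullet> H z)) z
     = 2 * (\<Sum>i\<in>UNIV. pd (axis i 1, 0) (\<lambda>z. cross3 (H z) (E z) $ i) z)"
proof -
  have q: "real_polynomial_function (\<lambda>z. E z $ i)" "real_polynomial_function (\<lambda>z. H z $ i)" for i using p by auto
  have q2: "real_polynomial_function (\<lambda>z. E z $ i * E z $ j)" "real_polynomial_function (\<lambda>z. H z $ i * H z $ j)"
     "real_polynomial_function (\<lambda>z. H z $ i * E z $ j)" "real_polynomial_function (\<lambda>z. E z $ i * H z $ j)" for i j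
    using q by (auto intro: polynomial_mult)
  have e: "\<epsilon> * time_deriv E z $ i = curl H z $ i" "\<mu> * time_deriv H z $ i = - (curl E z $ i)" for i
  proof -
    have "(\<epsilon> *\<^sub>R time_deriv E z - curl H z) $ i = 0 $ i" "(\<mu> *\<^sub>R time_deriv H z + curl E z) $ i = 0 $ i"
      using m unfolding maxwell_at_def by simp_all
    then show "\<epsilon> * time_deriv E z $ i = curl H z $ i" "\<mu> * time_deriv H z $ i = - (curl E z $ i)" by simp_all
  qed
  have "pd (0, 1) (\<lambda>z. \<epsilon> * (E z \<bullet> E z) + \<mu> * (H z \<bullet> H z)) z
     = 2 * (E z \<bullet> (\<epsilon> *\<^sub>R time_deriv E z) + H z \<bullet> (\<mu> *\<^sub>R time_deriv H z))"
    unfolding inner_vec_def sum_3 inner_real_def vector_scaleR_component real_scaleR_def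
    by (simp add: pd_add pd_cmult pd_mult polynomial_add polynomial_cmult q q2 time_deriv_nth[OF p(1)] time_deriv_nth[OF p(2)] algebra_simps)
  also have "\<dots> = 2 * (\<Sum>i\<in>UNIV. E z $ i * curl H z $ i - H z $ i * curl E z $ i)"
    unfolding inner_vec_def sum_3 inner_real_def vector_scaleR_component real_scaleR_def e by simp
  also have "\<dots> = 2 * (\<Sum>i\<in>UNIV. pd (axis i 1, 0) (\<lambda>z. cross3 (H z) (E z) $ i) z)"
    unfolding sum_3 cross_components curl_nth[OF p(1)] curl_nth[OF p(2)]
    by (simp add: pd_diff pd_mult q q2 algebra_simps)
  finally show ?thesis .
qed

text \<open>The pointwise identity is integrated over the element and the slab, by the fundamental
  theorem in time and the divergence theorem in space; the flux \<open>n \<bullet> (H x E)\<close>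
  is the triple product \<open>(n x H) \<bullet> E\<close>.\<close>

lemma poynting:
  fixes a b :: real
  assumes K: "K \<in> M" and t: "a \<le> b" and p: "poly_field E" "poly_field H" and m: "\<And>z. maxwell_at \<epsilon> \<mu> E H z"
  shows "(LINT x|lborel. indicator K x * ((\<epsilon> * (E (x, b) \<bullet> E (x, b)) + \<mu> * (H (x, b) \<bullet> H (x, b)))
       - (\<epsilon> * (E (x, a) \<bullet> E (x, a)) + \<mu> * (H (x, a) \<bullet> H (x, a)))))
    = 2 * ST_integral (frontier K) {a..b} (\<lambda>z. cross3 (unit_normal K (fst z)) (H z) \<bullet> E z)"
proof -
  let ?w = "\<lambda>z. \<epsilon> * (E z \<bullet> E z) + \<mu> * (H z \<bullet> H z)"
  let ?F = "\<lambda>i z. cross3 (H z) (E z) $ i"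
  have w: "real_polynomial_function ?w"
    unfolding inner_vec_def sum_3 inner_real_def using p by (intro polynomial_add polynomial_cmult polynomial_mult) auto
  have F: "real_polynomial_function (?F i)" for i
  proof -
    have "\<forall>i. real_polynomial_function (?F i)"
      unfolding forall_3 cross_components using p by (intro conjI real_polynomial_function_diff polynomial_mult) auto
    then show ?thesis by blast
  qed
  have int: "integrable (lborel \<Otimes>\<^sub>M lborel) (\<lambda>z. indicator (K \<times> {a..b}) z * pd (axis i 1, 0) (?F i) z)" for i
    by (rule integrable_slab[OF element_compact[OF K] polynomial_pd(2)[OF F]])
  have int2: "integrable ST (\<lambda>z. indicator (frontier K \<times> {a..b}) z * (unit_normal K (fst z) $ i * ?F i z))" for i
    using locally_bounded_unit_normal locally_bounded_polynomial[OF F] frontier_element[OF K]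
    by (intro integrable_ST locally_bounded_mult) auto
  have "(LINT x|lborel. indicator K x * (?w (x, b) - ?w (x, a)))
      = (LINT z|(lborel \<Otimes>\<^sub>M lborel). indicator (K \<times> {a..b}) z * pd (0, 1) ?w z)"
    by (rule time_integral[OF K t w, symmetric])
  also have "\<dots> = (LINT z|(lborel \<Otimes>\<^sub>M lborel). 2 * (\<Sum>i\<in>UNIV. indicator (K \<times> {a..b}) z * pd (axis i 1, 0) (?F i) z))"
  proof -
    have "c * (2 * (\<Sum>i\<in>UNIV. f i)) = 2 * (\<Sum>i\<in>UNIV. c * f i)" for c :: real and f :: "3 \<Rightarrow> real"
      by (simp add: sum_distrib_left[symmetric])
    then show ?thesis unfolding poynting_pointwise[OF p m] by (simp only:)
  qed
  also have "\<dots> = 2 * (LINT z|(lborel \<Otimes>\<^sub>M lborel). (\<Sum>i\<in>UNIV. indicator (K \<times> {a..b}) z * pd (axis i 1, 0) (?F i) z))"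
    by (rule integral_mult_right_zero)
  also have "\<dots> = 2 * (\<Sum>i\<in>UNIV. (LINT z|(lborel \<Otimes>\<^sub>M lborel). indicator (K \<times> {a..b}) z * pd (axis i 1, 0) (?F i) z))"
    by (subst Bochner_Integration.integral_sum[OF int]) (rule refl)
  also have "\<dots> = 2 * (\<Sum>i\<in>UNIV. ST_integral (frontier K) {a..b} (\<lambda>z. unit_normal K (fst z) $ i * ?F i z))"
    unfolding space_integral[OF K F] ..
  also have "\<dots> = 2 * (LINT z|ST. (\<Sum>i\<in>UNIV. indicator (frontier K \<times> {a..b}) z * (unit_normal K (fst z) $ i * ?F i z)))"
    by (subst Bochner_Integration.integral_sum[OF int2]) (rule refl)
  also have "\<dots> = 2 * ST_integral (frontier K) {a..b} (\<lambda>z. cross3 (unit_normal K (fst z)) (H z) \<bullet> E z)"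
  proof -
    have "(\<Sum>i\<in>UNIV. c * (n $ i * cross3 h e $ i)) = c * (cross3 n h \<bullet> e)" for c :: real and n h e :: vec3
      unfolding sum_3 inner_vec_def cross_components by (simp add: algebra_simps)
    then show ?thesis by simp
  qed
  finally show ?thesis .
qed

section \<open>From boundaries of elements to interfaces and boundary faces\<close>

lemma generic_ST: "AE z in ST. generic (fst z)"
  by (rule AE_space_time[OF generic_AE])

lemma finite_interfaces: "finite (interfaces M)"
  unfolding interfaces_def using finite_mesh by simp

lemma interfaceE:
  assumes "e \<in> interfaces M"
  obtains K1 K2 where "K1 \<in> M" "K2 \<in> M" "K1 \<noteq> K2" "e = {K1, K2}"
  using assms unfolding interfaces_def card_2_iff by auto

lemma interface_set_borel:
  assumes "e \<in> interfaces M"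
  shows "interface_set e \<in> sets borel" "bounded (interface_set e)" "interface_set e \<subseteq> \<Union>\<P>"
proof -
  obtain K1 K2 where K: "K1 \<in> M" "K2 \<in> M" "K1 \<noteq> K2" "e = {K1, K2}" using interfaceE[OF assms] .
  have e: "interface_set e = frontier K1 \<inter> frontier K2" using K by (simp add: interface_set_def)
  show "interface_set e \<in> sets borel" unfolding e by simp
  show "bounded (interface_set e)" unfolding e using frontier_element(2)[OF K(1)] bounded_subset by blast
  show "interface_set e \<subseteq> \<Union>\<P>" unfolding e using mesh_family[OF K(1)] by blast
qed

lemma boundary_face_borel:
  assumes "K \<in> M"
  shows "boundary_face \<Omega> K \<in> sets borel" "bounded (boundary_face \<Omega> K)" "boundary_face \<Omega> K \<subseteq> \<Union>\<P>"
  using frontier_element(2)[OF assms] mesh_family[OF assms] bounded_subset[of "frontier K" "boundary_face \<Omega> K"]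
  by (auto simp: boundary_face_def)

text \<open>On the boundary of the domain no second element is present, so only the boundary face
  counts. Elsewhere exactly one neighbour contains the point in its frontier, so exactly one
  interface counts.\<close>

lemma frontier_split:
  assumes K: "K \<in> M" and g: "generic x"
  shows "indicator (frontier K) x = (\<Sum>e\<in>{e \<in> interfaces M. K \<in> e}. indicator (interface_set e) x) + (indicator (boundary_face \<Omega> K) x :: real)"
proof (cases "x \<in> frontier K")
  case False
  then have "x \<notin> interface_set e" if "K \<in> e" for e using that by (auto simp: interface_set_def)
  then show ?thesis using False by (simp add: boundary_face_def)
next
  case True
  show ?thesis
  proof (cases "x \<in> frontier \<Omega>")
    case b: True
    have "x \<notin> interface_set e" if e: "e \<in> interfaces M" "K \<in> e" for e
    proof
      assume x: "x \<in> interface_set e"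
      obtain K1 K2 where K12: "K1 \<in> M" "K2 \<in> M" "K1 \<noteq> K2" "e = {K1, K2}" using interfaceE[OF e(1)] .
      then have "x \<in> frontier K1" "x \<in> frontier K2" using x by (auto simp: interface_set_def)
      then show False using boundary_one_element[OF K12(1) _ K12(2) _ g b] K12 by blast
    qed
    then show ?thesis using True b by (simp add: boundary_face_def)
  next
    case b: False
    obtain K' where K': "K' \<in> M" "K' \<noteq> K" "x \<in> frontier K'" and u: "\<And>L. L \<in> M \<Longrightarrow> L \<noteq> K \<Longrightarrow> x \<in> frontier L \<Longrightarrow> L = K'"
      using interior_two_elements[OF K True g b] by blast
    have e: "{K, K'} \<in> {e \<in> interfaces M. K \<in> e}" using K K' by (auto simp: interfaces_def)
    have "indicator (interface_set e) x = (if e = {K, K'} then 1 else 0 :: real)" if e': "e \<in> {e \<in> interfaces M. K \<in> e}" for e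
    proof -
      obtain K1 K2 where K12: "K1 \<in> M" "K2 \<in> M" "K1 \<noteq> K2" "e = {K1, K2}" using interfaceE e' by blast
      then have "K = K1 \<or> K = K2" using e' by auto
      then obtain L where L: "L \<in> M" "L \<noteq> K" "e = {K, L}"
      proof
        assume "K = K1"
        then show thesis using that[of K2] K12 by auto
      next
        assume "K = K2"
        then show thesis using that[of K1] K12 by (auto simp: insert_commute)
      qed
      have "x \<in> interface_set e \<longleftrightarrow> x \<in> frontier L"
        unfolding L(3) interface_set_def using True by simp
      also have "\<dots> \<longleftrightarrow> L = K'" using u[OF L(1,2)] K'(3) by blast
      finally have "x \<in> interface_set e \<longleftrightarrow> L = K'" .
      then show ?thesis using L K' by (auto simp: doubleton_eq_iff)
    qed
    then have "(\<Sum>e\<in>{e \<in> interfaces M. K \<in> e}. indicator (interface_set e) x) = (\<Sum>e\<in>{e \<in> interfaces M. K \<in> e}. if e = {K, K'} then 1 else 0 :: real)"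
      by (rule sum.cong[OF refl])
    also have "\<dots> = 1" using e finite_interfaces by simp
    finally show ?thesis using True b by (simp add: boundary_face_def)
  qed
qed

lemma sum_frontier_integrals:
  fixes a b :: real
  assumes F: "\<And>K. K \<in> M \<Longrightarrow> locally_bounded (F K)"
  shows "(\<Sum>K\<in>M. ST_integral (frontier K) {a..b} (F K))
    = (\<Sum>e\<in>interfaces M. ST_integral (interface_set e) {a..b} (\<lambda>z. \<Sum>K\<in>e. F K z))
    + (\<Sum>K\<in>M. ST_integral (boundary_face \<Omega> K) {a..b} (F K))"
proof -
  have iI: "integrable ST (\<lambda>z. indicator (interface_set e \<times> {a..b}) z * F K z)" if "e \<in> interfaces M" "K \<in> M" for e K
    using interface_set_borel[OF that(1)] F[OF that(2)] by (intro integrable_ST) auto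
  have bI: "integrable ST (\<lambda>z. indicator (boundary_face \<Omega> K \<times> {a..b}) z * F K z)" if "K \<in> M" for K
    using boundary_face_borel[OF that] F[OF that] by (intro integrable_ST) auto
  have "ST_integral (frontier K) {a..b} (F K)
      = (\<Sum>e\<in>{e \<in> interfaces M. K \<in> e}. ST_integral (interface_set e) {a..b} (F K))
       + ST_integral (boundary_face \<Omega> K) {a..b} (F K)" if K: "K \<in> M" for K
  proof -
    have fI: "integrable ST (\<lambda>z. indicator (frontier K \<times> {a..b}) z * F K z)"
      using frontier_element[OF K] F[OF K] by (intro integrable_ST) auto
    have sI: "integrable ST (\<lambda>z. \<Sum>e\<in>{e \<in> interfaces M. K \<in> e}. indicator (interface_set e \<times> {a..b}) z * F K z)"
      using iI K by (intro Bochner_Integration.integrable_sum) auto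
    have "ST_integral (frontier K) {a..b} (F K)
      = (LINT z|ST. ((\<Sum>e\<in>{e \<in> interfaces M. K \<in> e}. indicator (interface_set e \<times> {a..b}) z * F K z) + indicator (boundary_face \<Omega> K \<times> {a..b}) z * F K z))"
    proof (rule integral_cong_AE)
      show "AE z in ST. indicator (frontier K \<times> {a..b}) z * F K z = (\<Sum>e\<in>{e \<in> interfaces M. K \<in> e}. indicator (interface_set e \<times> {a..b}) z * F K z) + indicator (boundary_face \<Omega> K \<times> {a..b}) z * F K z"
        using generic_ST
      proof eventually_elim
        case (elim z)
        have "indicator (S \<times> {a..b}) z * y = (indicator {a..b} (snd z) * y) * indicator S (fst z)" for S and y :: real
          by (simp add: indicator_times)
        then show ?case by (simp only: frontier_split[OF K elim] distrib_left sum_distrib_left)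
      qed
    qed (use fI sI bI[OF K] in auto)
    also have "\<dots> = (LINT z|ST. (\<Sum>e\<in>{e \<in> interfaces M. K \<in> e}. indicator (interface_set e \<times> {a..b}) z * F K z))
       + ST_integral (boundary_face \<Omega> K) {a..b} (F K)"
      by (rule Bochner_Integration.integral_add[OF sI bI[OF K]])
    also have "(LINT z|ST. (\<Sum>e\<in>{e \<in> interfaces M. K \<in> e}. indicator (interface_set e \<times> {a..b}) z * F K z))
      = (\<Sum>e\<in>{e \<in> interfaces M. K \<in> e}. ST_integral (interface_set e) {a..b} (F K))"
      using iI K by (intro Bochner_Integration.integral_sum) auto
    finally show ?thesis .
  qed
  then have "(\<Sum>K\<in>M. ST_integral (frontier K) {a..b} (F K))
     = (\<Sum>K\<in>M. \<Sum>e\<in>{e \<in> interfaces M. K \<in> e}. ST_integral (interface_set e) {a..b} (F K))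
     + (\<Sum>K\<in>M. ST_integral (boundary_face \<Omega> K) {a..b} (F K))"
    by (simp add: sum.distrib)
  \<comment> \<open>Double counting of the incident pairs of an element and an interface: each
    interface collects the terms of its two elements.\<close>
  also have "(\<Sum>K\<in>M. \<Sum>e\<in>{e \<in> interfaces M. K \<in> e}. ST_integral (interface_set e) {a..b} (F K))
     = (\<Sum>e\<in>interfaces M. \<Sum>K\<in>{K \<in> M. K \<in> e}. ST_integral (interface_set e) {a..b} (F K))"
    by (rule sum.swap_restrict[OF finite_mesh finite_interfaces])
  also have "\<dots> = (\<Sum>e\<in>interfaces M. ST_integral (interface_set e) {a..b} (\<lambda>z. \<Sum>K\<in>e. F K z))"
  proof (rule sum.cong[OF refl])
    fix e assume e: "e \<in> interfaces M"
    then have sub: "e \<subseteq> M" by (simp add: interfaces_def)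
    then have "{K \<in> M. K \<in> e} = e" by blast
    then show "(\<Sum>K\<in>{K \<in> M. K \<in> e}. ST_integral (interface_set e) {a..b} (F K))
       = ST_integral (interface_set e) {a..b} (\<lambda>z. \<Sum>K\<in>e. F K z)"
      using iI[OF e] sub unfolding sum_distrib_left by (subst Bochner_Integration.integral_sum) auto
  qed
  finally show ?thesis .
qed

end

subsection \<open>Mass terms and energy\<close>

text \<open>The common ground of the initial data, which are merely square integrable, and of the
  time slices of polynomial fields.\<close>

definition square_integrable_on :: "vec3 set \<Rightarrow> (vec3 \<Rightarrow> vec3) \<Rightarrow> bool" where
  "square_integrable_on K f \<longleftrightarrow> (\<lambda>x. indicator K x *\<^sub>R f x) \<in> borel_measurable lebesgue \<and>
     integrable lebesgue (\<lambda>x. indicator K x * (norm (f x))\<^sup>2)"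

lemma square_integrable_inner:
  assumes f: "square_integrable_on K f" and g: "square_integrable_on K g"
  shows "integrable lebesgue (\<lambda>x. indicator K x * (f x \<bullet> g x))"
proof (rule Bochner_Integration.integrable_bound)
  show "integrable lebesgue (\<lambda>x. indicator K x * (norm (f x))\<^sup>2 + indicator K x * (norm (g x))\<^sup>2)"
    using f g unfolding square_integrable_on_def by (intro Bochner_Integration.integrable_add) auto
  have "(\<lambda>x. (indicator K x *\<^sub>R f x) \<bullet> (indicator K x *\<^sub>R g x)) \<in> borel_measurable lebesgue"
    using f g unfolding square_integrable_on_def by (intro borel_measurable_inner) auto
  moreover have "(\<lambda>x. (indicator K x *\<^sub>R f x) \<bullet> (indicator K x *\<^sub>R g x)) = (\<lambda>x. indicator K x * (f x \<bullet> g x))"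
    by (auto simp: indicator_def)
  ultimately show "(\<lambda>x. indicator K x * (f x \<bullet> g x)) \<in> borel_measurable lebesgue" by simp
  show "AE x in lebesgue. norm (indicator K x * (f x \<bullet> g x)) \<le> norm (indicator K x * (norm (f x))\<^sup>2 + indicator K x * (norm (g x))\<^sup>2)"
  proof (rule AE_I2)
    fix x
    have "\<bar>f x \<bullet> g x\<bar> \<le> norm (f x) * norm (g x)" by (rule Cauchy_Schwarz_ineq2)
    also have "\<dots> \<le> (norm (f x))\<^sup>2 + (norm (g x))\<^sup>2"
      using sum_squares_bound[of "norm (f x)" "norm (g x)"] mult_nonneg_nonneg[OF norm_ge_zero[of "f x"] norm_ge_zero[of "g x"]] by linarith
    finally show "norm (indicator K x * (f x \<bullet> g x)) \<le> norm (indicator K x * (norm (f x))\<^sup>2 + indicator K x * (norm (g x))\<^sup>2)"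
      by (auto simp: indicator_def)
  qed
qed

lemma square_integrable_poly:
  assumes K: "compact K" and E: "poly_field E"
  shows "square_integrable_on K (\<lambda>x. E (x, s))"
proof -
  have c: "continuous_on UNIV (\<lambda>x. E (x, s) $ i)" for i
    by (rule continuous_on_compose2[OF polynomial_continuous[OF E[rule_format, of i], of UNIV]]) (auto intro!: continuous_intros)
  have cE: "continuous_on UNIV (\<lambda>x. E (x, s))"
    using c by (subst continuous_on_componentwise) (auto simp: Basis_vec_def inner_axis)
  have m: "(\<lambda>x. indicator K x *\<^sub>R E (x, s)) \<in> borel_measurable lebesgue"
    using borel_measurable_continuous_onI[OF cE] compact_imp_closed[OF K]
    by (intro measurable_completion borel_measurable_scaleR borel_measurable_indicator) auto
  have "integrable lborel (\<lambda>x. indicator K x * (norm (E (x, s)))\<^sup>2)"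
    by (rule integrable_indicator_compact[OF K]) (intro continuous_intros cE)
  then have "integrable lebesgue (\<lambda>x. indicator K x * (norm (E (x, s)))\<^sup>2)"
    by (subst integrable_completion) auto
  then show ?thesis using m by (simp add: square_integrable_on_def)
qed

definition comb :: "real \<Rightarrow> broken \<times> broken \<Rightarrow> real \<Rightarrow> broken \<times> broken \<Rightarrow> broken \<times> broken" where
  "comb a u b v = (\<lambda>K z. a *\<^sub>R fst u K z + b *\<^sub>R fst v K z, \<lambda>K z. a *\<^sub>R snd u K z + b *\<^sub>R snd v K z)"

lemma comb_simps [simp]:
  "fst (comb a u b v) K z = a *\<^sub>R fst u K z + b *\<^sub>R fst v K z"
  "snd (comb a u b v) K z = a *\<^sub>R snd u K z + b *\<^sub>R snd v K z"
  by (simp_all add: comb_def)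

context mesh_family
begin

definition admissible :: "real \<Rightarrow> broken \<times> broken \<Rightarrow> bool" where
  "admissible s u \<longleftrightarrow> (\<forall>K\<in>M. square_integrable_on K (\<lambda>x. fst u K (x, s)) \<and> square_integrable_on K (\<lambda>x. snd u K (x, s)))"

definition poly_broken :: "broken \<times> broken \<Rightarrow> bool" where
  "poly_broken u \<longleftrightarrow> (\<forall>K\<in>M. poly_field (fst u K) \<and> poly_field (snd u K))"

lemma admissible_poly: "poly_broken u \<Longrightarrow> admissible s u"
  unfolding poly_broken_def admissible_def using square_integrable_poly element_compact by blast

lemma negligible_plane: "P \<in> planes \<Longrightarrow> negligible P"
  by (subst plane_eq_hyperplane, assumption, intro negligible_hyperplane disjI1)
    (metis norm_plane_normal norm_zero zero_neq_one)

text \<open>An element may contain points of the frontier of \<Omega>, where nothing is known about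
  the datum. The frontier lies in finitely many planes and is therefore a null set.\<close>

lemma square_integrable_L2:
  assumes E: "L2_on lebesgue \<Omega> E0" and K: "K \<in> M"
  shows "square_integrable_on K E0"
proof -
  have "negligible (\<Union>\<P>)" using negligible_plane planes_family finite_family by (intro negligible_Union) auto
  then have "negligible (frontier \<Omega>)" using domain_family negligible_subset by blast
  then have N: "frontier \<Omega> \<in> null_sets lebesgue" by (simp add: negligible_iff_null_sets)
  have sub: "K \<subseteq> \<Omega> \<union> frontier \<Omega>" using K mesh_cover closure_Un_frontier by blast
  have "AE x in lebesgue. x \<notin> frontier \<Omega>" using N by (rule AE_not_in)
  then have ae: "AE x in lebesgue. indicator K x * indicator \<Omega> x = (indicator K x :: real)"
    by eventually_elim (use sub in \<open>auto simp: indicator_def\<close>)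
  have Km: "K \<in> sets lebesgue" using element_closed[OF K] by (simp add: borel_closed)
  have m: "(\<lambda>x. indicator K x *\<^sub>R (indicator \<Omega> x *\<^sub>R E0 x)) \<in> borel_measurable lebesgue"
  proof (rule borel_measurable_scaleR[OF borel_measurable_indicator[OF Km]])
    show "(\<lambda>x. indicator \<Omega> x *\<^sub>R E0 x) \<in> borel_measurable lebesgue"
      using E unfolding L2_on_def set_borel_measurable_def by blast
  qed
  have "AE x in lborel. indicator K x *\<^sub>R (indicator \<Omega> x *\<^sub>R E0 x) = indicator K x *\<^sub>R E0 x"
    using ae unfolding AE_completion_iff by eventually_elim (simp only: scaleR_scaleR)
  from completion_measurable_cong_AE[OF this] have 1: "(\<lambda>x. indicator K x *\<^sub>R E0 x) \<in> borel_measurable lebesgue"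
    using m by blast
  have i: "integrable lebesgue (\<lambda>x. indicator K x * (indicator \<Omega> x * (norm (E0 x))\<^sup>2))"
  proof -
    have "integrable lebesgue (\<lambda>x. indicator \<Omega> x *\<^sub>R (norm (E0 x))\<^sup>2)"
      using E unfolding L2_on_def set_integrable_def by blast
    from integrable_mult_indicator[OF Km this] show ?thesis by simp
  qed
  have ae2: "AE x in lebesgue. indicator K x * (indicator \<Omega> x * (norm (E0 x))\<^sup>2) = indicator K x * (norm (E0 x))\<^sup>2"
    using ae by eventually_elim (simp only: mult.assoc[symmetric])
  have ae3: "AE x in lborel. indicator K x * (indicator \<Omega> x * (norm (E0 x))\<^sup>2) = indicator K x * (norm (E0 x))\<^sup>2"
    using ae2 unfolding AE_completion_iff .
  have "(\<lambda>x. indicator K x * (norm (E0 x))\<^sup>2) \<in> borel_measurable lebesgue"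
    using completion_measurable_cong_AE[OF ae3] borel_measurable_integrable[OF i] by blast
  from Bochner_Integration.integrable_cong_AE[OF borel_measurable_integrable[OF i] this ae2] i
  have "integrable lebesgue (\<lambda>x. indicator K x * (norm (E0 x))\<^sup>2)" by blast
  then show ?thesis using 1 by (simp add: square_integrable_on_def)
qed

lemma mass_term_expand:
  assumes "admissible s u" "admissible s v"
  shows "mass_term M \<epsilon> \<mu> s u v = (\<Sum>K\<in>M. \<epsilon> K * (LINT x|lebesgue. indicator K x * (fst u K (x, s) \<bullet> fst v K (x, s)))
     + \<mu> K * (LINT x|lebesgue. indicator K x * (snd u K (x, s) \<bullet> snd v K (x, s))))"
proof -
  have "(LINT x : K | lebesgue. \<epsilon> K * (fst u K (x, s) \<bullet> fst v K (x, s)) + \<mu> K * (snd u K (x, s) \<bullet> snd v K (x, s)))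
     = \<epsilon> K * (LINT x|lebesgue. indicator K x * (fst u K (x, s) \<bullet> fst v K (x, s)))
     + \<mu> K * (LINT x|lebesgue. indicator K x * (snd u K (x, s) \<bullet> snd v K (x, s)))" if K: "K \<in> M" for K
  proof -
    have i: "integrable lebesgue (\<lambda>x. indicator K x * (fst u K (x, s) \<bullet> fst v K (x, s)))"
      "integrable lebesgue (\<lambda>x. indicator K x * (snd u K (x, s) \<bullet> snd v K (x, s)))"
      using assms K unfolding admissible_def by (auto intro: square_integrable_inner)
    have "(LINT x : K | lebesgue. \<epsilon> K * (fst u K (x, s) \<bullet> fst v K (x, s)) + \<mu> K * (snd u K (x, s) \<bullet> snd v K (x, s)))
      = (LINT x|lebesgue. \<epsilon> K * (indicator K x * (fst u K (x, s) \<bullet> fst v K (x, s))) + \<mu> K * (indicator K x * (snd u K (x, s) \<bullet> snd v K (x, s))))"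
      unfolding set_lebesgue_integral_def by (simp add: algebra_simps)
    also have "\<dots> = (LINT x|lebesgue. \<epsilon> K * (indicator K x * (fst u K (x, s) \<bullet> fst v K (x, s)))) + (LINT x|lebesgue. \<mu> K * (indicator K x * (snd u K (x, s) \<bullet> snd v K (x, s))))"
      using i by (intro Bochner_Integration.integral_add integrable_mult_right) auto
    finally show ?thesis by simp
  qed
  then show ?thesis unfolding mass_term_def by (simp add: case_prod_beta)
qed

lemma poly_broken_comb:
  assumes "poly_broken u" "poly_broken v"
  shows "poly_broken (comb a u b v)"
  using assms poly_field_add_scale unfolding poly_broken_def by simp

lemma mass_term_commute:
  "mass_term M \<epsilon> \<mu> s u v = mass_term M \<epsilon> \<mu> s v u"
  unfolding mass_term_def by (simp add: case_prod_beta inner_commute)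

lemma mass_term_comb:
  assumes u: "admissible s u" and v: "admissible s v" and w: "admissible s w" and vw: "admissible s (comb a v b w)"
  shows "mass_term M \<epsilon> \<mu> s u (comb a v b w) = a * mass_term M \<epsilon> \<mu> s u v + b * mass_term M \<epsilon> \<mu> s u w"
proof -
  have l: "(LINT x|lebesgue. indicator K x * (f x \<bullet> (a *\<^sub>R g x + b *\<^sub>R h x)))
     = a * (LINT x|lebesgue. indicator K x * (f x \<bullet> g x)) + b * (LINT x|lebesgue. indicator K x * (f x \<bullet> h x))"
    if "square_integrable_on K f" "square_integrable_on K g" "square_integrable_on K h" for K f g h
  proof -
    have i: "integrable lebesgue (\<lambda>x. indicator K x * (f x \<bullet> g x))" "integrable lebesgue (\<lambda>x. indicator K x * (f x \<bullet> h x))"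
      using that by (auto intro: square_integrable_inner)
    have "(LINT x|lebesgue. indicator K x * (f x \<bullet> (a *\<^sub>R g x + b *\<^sub>R h x)))
      = (LINT x|lebesgue. a * (indicator K x * (f x \<bullet> g x)) + b * (indicator K x * (f x \<bullet> h x)))"
      by (simp add: inner_add_right algebra_simps)
    also have "\<dots> = (LINT x|lebesgue. a * (indicator K x * (f x \<bullet> g x))) + (LINT x|lebesgue. b * (indicator K x * (f x \<bullet> h x)))"
      using i by (intro Bochner_Integration.integral_add integrable_mult_right) auto
    finally show ?thesis by simp
  qed
  show ?thesis
    unfolding mass_term_expand[OF u v] mass_term_expand[OF u w] mass_term_expand[OF u vw] comb_simps
      sum_distrib_left sum.distrib[symmetric]
  proof (rule sum.cong[OF refl])
    fix K assume "K \<in> M"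
    then have sq: "square_integrable_on K (\<lambda>x. fst u K (x, s))" "square_integrable_on K (\<lambda>x. fst v K (x, s))" "square_integrable_on K (\<lambda>x. fst w K (x, s))"
      "square_integrable_on K (\<lambda>x. snd u K (x, s))" "square_integrable_on K (\<lambda>x. snd v K (x, s))" "square_integrable_on K (\<lambda>x. snd w K (x, s))"
      using u v w unfolding admissible_def by blast+
    show "\<epsilon> K * (LINT x|lebesgue. indicator K x * (fst u K (x, s) \<bullet> (a *\<^sub>R fst v K (x, s) + b *\<^sub>R fst w K (x, s))))
        + \<mu> K * (LINT x|lebesgue. indicator K x * (snd u K (x, s) \<bullet> (a *\<^sub>R snd v K (x, s) + b *\<^sub>R snd w K (x, s))))
      = a * (\<epsilon> K * (LINT x|lebesgue. indicator K x * (fst u K (x, s) \<bullet> fst v K (x, s)))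
          + \<mu> K * (LINT x|lebesgue. indicator K x * (snd u K (x, s) \<bullet> snd v K (x, s))))
        + b * (\<epsilon> K * (LINT x|lebesgue. indicator K x * (fst u K (x, s) \<bullet> fst w K (x, s)))
          + \<mu> K * (LINT x|lebesgue. indicator K x * (snd u K (x, s) \<bullet> snd w K (x, s))))"
      unfolding l[OF sq(1-3)] l[OF sq(4-6)] by (simp add: algebra_simps)
  qed
qed

lemma L2_norm_on_square: "(L2_norm_on K f)\<^sup>2 = (LINT x|lebesgue. indicator K x * (f x \<bullet> f x))"
proof -
  have "0 \<le> (LINT x|lebesgue. indicator K x * (f x \<bullet> f x))" by (intro Bochner_Integration.integral_nonneg) simp
  then show ?thesis unfolding L2_norm_on_def set_lebesgue_integral_def by (simp add: power2_norm_eq_inner)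
qed

lemma energy_mass_term:
  assumes u: "admissible s u" and pos: "\<And>K. K \<in> M \<Longrightarrow> \<epsilon> K > 0" "\<And>K. K \<in> M \<Longrightarrow> \<mu> K > 0"
  shows "energy M \<epsilon> \<mu> s u = 1/2 * mass_term M \<epsilon> \<mu> s u u"
proof -
  have "(L2_norm_mesh M (\<lambda>K x. sqrt (c K) *\<^sub>R f K x))\<^sup>2 = (\<Sum>K\<in>M. c K * (LINT x|lebesgue. indicator K x * (f K x \<bullet> f K x)))"
    if "\<And>K. K \<in> M \<Longrightarrow> c K > 0" for c :: "vec3 set \<Rightarrow> real" and f
  proof -
    have "(L2_norm_mesh M (\<lambda>K x. sqrt (c K) *\<^sub>R f K x))\<^sup>2 = (\<Sum>K\<in>M. (L2_norm_on K (\<lambda>x. sqrt (c K) *\<^sub>R f K x))\<^sup>2)"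
      unfolding L2_norm_mesh_def by (simp add: sum_nonneg)
    also have "\<dots> = (\<Sum>K\<in>M. c K * (LINT x|lebesgue. indicator K x * (f K x \<bullet> f K x)))"
    proof (rule sum.cong[OF refl])
      fix K assume "K \<in> M"
      then have "sqrt (c K) * sqrt (c K) = c K" using that[of K] by simp
      then have "indicator K x * ((sqrt (c K) *\<^sub>R f K x) \<bullet> (sqrt (c K) *\<^sub>R f K x)) = c K * (indicator K x * (f K x \<bullet> f K x))" for x
        by (simp add: mult.assoc[symmetric])
      then show "(L2_norm_on K (\<lambda>x. sqrt (c K) *\<^sub>R f K x))\<^sup>2 = c K * (LINT x|lebesgue. indicator K x * (f K x \<bullet> f K x))"
        unfolding L2_norm_on_square by (simp only: integral_mult_right_zero)
    qed
    finally show ?thesis .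
  qed
  note l = this
  show ?thesis
    unfolding energy_def case_prod_beta mass_term_expand[OF u u]
    using l[of \<epsilon> "\<lambda>K x. fst u K (x, s)", OF pos(1)] l[of \<mu> "\<lambda>K x. snd u K (x, s)", OF pos(2)]
    by (simp add: sum.distrib)
qed

text \<open>Expanding the square produces the mixed mass term of \<open>v\<close> and
  \<open>u\<close>. In the energy balance it is the contribution of the previous slab to the
  right-hand side tested with the solution, so the jump in time completes a square.\<close>

lemma difference_mass_term:
  assumes u: "admissible s u" and v: "admissible s v"
  shows "(\<Sum>K\<in>M. \<epsilon> K / 2 * (L2_norm_on K (\<lambda>x. fst u K (x, s) - fst v K (x, s)))\<^sup>2
      + \<mu> K / 2 * (L2_norm_on K (\<lambda>x. snd u K (x, s) - snd v K (x, s)))\<^sup>2)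
    = 1/2 * mass_term M \<epsilon> \<mu> s u u - mass_term M \<epsilon> \<mu> s v u + 1/2 * mass_term M \<epsilon> \<mu> s v v"
proof -
  have l: "(L2_norm_on K (\<lambda>x. f x - g x))\<^sup>2 = (LINT x|lebesgue. indicator K x * (f x \<bullet> f x))
     - 2 * (LINT x|lebesgue. indicator K x * (g x \<bullet> f x)) + (LINT x|lebesgue. indicator K x * (g x \<bullet> g x))"
    if "square_integrable_on K f" "square_integrable_on K g" for K f g
  proof -
    have i: "integrable lebesgue (\<lambda>x. indicator K x * (f x \<bullet> f x))" "integrable lebesgue (\<lambda>x. indicator K x * (g x \<bullet> f x))"
      "integrable lebesgue (\<lambda>x. indicator K x * (g x \<bullet> g x))"
      using that by (auto intro: square_integrable_inner)
    have "(\<lambda>x. indicator K x * ((f x - g x) \<bullet> (f x - g x)))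
      = (\<lambda>x. indicator K x * (f x \<bullet> f x) - 2 * (indicator K x * (g x \<bullet> f x)) + indicator K x * (g x \<bullet> g x))"
      by (auto simp: inner_diff_left inner_diff_right inner_commute algebra_simps)
    then show ?thesis unfolding L2_norm_on_square using i by simp
  qed
  show ?thesis
    unfolding mass_term_expand[OF u u] mass_term_expand[OF v u] mass_term_expand[OF v v]
      sum_distrib_left sum.distrib[symmetric] sum_subtractf[symmetric]
    using u v unfolding admissible_def by (intro sum.cong refl) (simp add: l field_simps)
qed

lemma mass_term_nonneg:
  assumes "\<And>K. K \<in> M \<Longrightarrow> \<epsilon> K > 0" "\<And>K. K \<in> M \<Longrightarrow> \<mu> K > 0" "admissible s u"
  shows "0 \<le> mass_term M \<epsilon> \<mu> s u u"
proof -
  have "0 \<le> energy M \<epsilon> \<mu> s u" unfolding energy_def case_prod_beta by simp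
  then show ?thesis using energy_mass_term[of s u \<epsilon> \<mu>, OF assms(3,1,2)] by simp
qed

text \<open>Positivity of the weights makes the integral of every squared component field vanish. A
  continuous function vanishing almost everywhere on \<open>K\<close> vanishes on its interior, and
  a polynomial doing so vanishes on the whole time slice, also outside \<open>K\<close>.\<close>

lemma mass_term_zero:
  assumes pos: "\<And>K. K \<in> M \<Longrightarrow> \<epsilon> K > 0" "\<And>K. K \<in> M \<Longrightarrow> \<mu> K > 0" and u: "poly_broken u"
    and z: "mass_term M \<epsilon> \<mu> s u u = 0" and K: "K \<in> M"
  shows "fst u K (x, s) = 0 \<and> snd u K (x, s) = 0"
proof -
  let ?IE = "\<lambda>K. (LINT x|lebesgue. indicator K x * (fst u K (x, s) \<bullet> fst u K (x, s)))"
  let ?IH = "\<lambda>K. (LINT x|lebesgue. indicator K x * (snd u K (x, s) \<bullet> snd u K (x, s)))"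
  have nn: "0 \<le> ?IE K" "0 \<le> ?IH K" for K by (intro Bochner_Integration.integral_nonneg; simp)+
  have "0 \<le> \<epsilon> K * ?IE K + \<mu> K * ?IH K" if "K \<in> M" for K
    using mult_nonneg_nonneg[OF less_imp_le[OF pos(1)[OF that]] nn(1)[of K]]
      mult_nonneg_nonneg[OF less_imp_le[OF pos(2)[OF that]] nn(2)[of K]] by linarith
  moreover have "(\<Sum>K\<in>M. \<epsilon> K * ?IE K + \<mu> K * ?IH K) = 0"
    using z unfolding mass_term_expand[OF admissible_poly[OF u] admissible_poly[OF u]] .
  ultimately have "\<forall>K\<in>M. \<epsilon> K * ?IE K + \<mu> K * ?IH K = 0"
    using sum_nonneg_eq_0_iff[OF finite_mesh, of "\<lambda>K. \<epsilon> K * ?IE K + \<mu> K * ?IH K"] by blast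
  then have "\<epsilon> K * ?IE K + \<mu> K * ?IH K = 0" using K by blast
  moreover have "0 \<le> \<epsilon> K * ?IE K" "0 \<le> \<mu> K * ?IH K" using pos[OF K] nn by (simp_all add: less_imp_le)
  ultimately have "\<epsilon> K * ?IE K = 0" "\<mu> K * ?IH K = 0" by linarith+
  then have I0: "?IE K = 0" "?IH K = 0" using pos[OF K] by auto
  have main: "F (x, s) = 0"
    if F: "poly_field F" and I: "(LINT x|lebesgue. indicator K x * (F (x, s) \<bullet> F (x, s))) = 0" for F
  proof -
    have int: "integrable lebesgue (\<lambda>x. indicator K x * (F (x, s) \<bullet> F (x, s)))"
      using square_integrable_inner square_integrable_poly[OF element_compact[OF K] F] by blast
    have "AE x in lebesgue. indicator K x * (F (x, s) \<bullet> F (x, s)) = 0"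
      using integral_nonneg_eq_0_iff_AE[OF int] I by simp
    then have ae: "AE x in lborel. indicator K x * (F (x, s) \<bullet> F (x, s)) = 0" unfolding AE_completion_iff .
    have pol: "real_polynomial_function (\<lambda>x. F (x, s) $ i)" for i
    proof -
      have "polynomial_function (\<lambda>x :: vec3. (x, s))"
        unfolding polynomial_function_def
      proof (intro allI impI)
        fix f :: "vec3 \<times> real \<Rightarrow> real" assume f: "bounded_linear f"
        have "f \<circ> (\<lambda>x. (x, s)) = (\<lambda>x. f (x, 0) + f (0, s))"
          using f by (auto simp: fun_eq_iff linear_simps(1)[OF f, symmetric])
        moreover have "bounded_linear (\<lambda>x. f (x, 0))"
          by (rule bounded_linear_compose[OF f]) (intro bounded_linear_Pair bounded_linear_ident bounded_linear_zero)
        ultimately show "real_polynomial_function (f \<circ> (\<lambda>x. (x, s)))"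
          using polynomial_add[OF polynomial_linear polynomial_const, of "\<lambda>x. f (x, 0)" "f (0, s)"] by simp
      qed
      from real_polynomial_function_compose[OF this F[rule_format, of i]] show ?thesis by (simp add: o_def)
    qed
    have "F (y, s) = 0" if y: "y \<in> interior K" for y
    proof (rule ccontr)
      assume ne: "F (y, s) \<noteq> 0"
      have cF: "continuous_on UNIV (\<lambda>x. F (x, s) \<bullet> F (x, s))"
        unfolding inner_vec_def inner_real_def by (intro continuous_on_sum continuous_on_mult polynomial_continuous pol)
      define U where "U = interior K \<inter> {x. F (x, s) \<bullet> F (x, s) > 0}"
      have "open U" unfolding U_def using open_Collect_less[OF continuous_on_const cF, of 0] by auto
      moreover have "y \<in> U" using ne y by (simp add: U_def)
      ultimately have "\<not> negligible U" using open_not_negligible by blast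
      moreover have "AE x in lborel. x \<notin> U"
        using ae by eventually_elim (use interior_subset[of K] in \<open>auto simp: U_def indicator_def split: if_splits\<close>)
      then have "U \<in> null_sets lborel" using \<open>open U\<close> by (subst AE_iff_null_sets) auto
      then have "negligible U" by (simp add: negligible_iff_null_sets null_sets_completionI)
      ultimately show False by blast
    qed
    then have "F (x, s) $ i = 0" for i
      using polynomial_zero_extend[OF pol, of "interior K"] element_interior[OF K] by simp
    then show ?thesis by (simp add: vec_eq_iff)
  qed
  show ?thesis using main I0 u K unfolding poly_broken_def by blast
qed

end

subsection \<open>The discontinuous Galerkin form\<close>

context mesh_family
begin

lemma interior_normals:
  assumes "K \<in> M" "generic x" "x \<in> frontier K"
  shows "outward_normal K x = unit_normal K x"
  using element_normal_ex[OF assms(1,3,2)] by metis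

lemma boundary_normals:
  assumes K: "K \<in> M" and g: "generic x" and x: "x \<in> boundary_face \<Omega> K"
  shows "outward_normal \<Omega> x = unit_normal K x"
proof -
  have f: "x \<in> frontier K" "x \<in> frontier \<Omega>" using x by (auto simp: boundary_face_def)
  obtain n where n: "is_outward_normal K x n" "unit_normal K x = n" using element_normal_ex[OF K f(1) g] .
  show ?thesis using outward_normal_eqI[OF domain_normal[OF K f g n(1)]] n(2) by simp
qed

lemma opposite_unit_normals:
  assumes K: "K1 \<in> M" "K2 \<in> M" "K1 \<noteq> K2" and g: "generic x" and x: "x \<in> frontier K1" "x \<in> frontier K2"
  shows "is_outward_normal K1 x (unit_normal K1 x)" "is_outward_normal K2 x (- unit_normal K1 x)"
    "unit_normal K2 x = - unit_normal K1 x"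
proof -
  obtain n where n: "is_outward_normal K1 x n" "unit_normal K1 x = n" using element_normal_ex[OF K(1) x(1) g] .
  have n2: "is_outward_normal K2 x (- n)" by (rule opposite_normals[OF K(1) x(1) K(2) x(2) K(3) g n(1)])
  obtain m where m: "is_outward_normal K2 x m" "unit_normal K2 x = m" using element_normal_ex[OF K(2) x(2) g] .
  show "is_outward_normal K1 x (unit_normal K1 x)" "is_outward_normal K2 x (- unit_normal K1 x)"
    "unit_normal K2 x = - unit_normal K1 x"
    using n n2 m is_outward_normal_unique[OF m(1) n2] by simp_all
qed

text \<open>The integrand of the form with the Borel normal in place of
  \<open>outward_normal\<close>. It is defined and measurable everywhere and differs from the
  original only at nongeneric points of the interface.\<close>

definition interface_form :: "vec3 set set \<Rightarrow> broken \<times> broken \<Rightarrow> broken \<times> broken \<Rightarrow> vec3 \<times> real \<Rightarrow> real" where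
  "interface_form e u v z =
     (\<Sum>K\<in>e. cross3 (unit_normal K (fst z)) (snd u K z)) \<bullet> average e (fst v) z
   - (\<Sum>K\<in>e. cross3 (unit_normal K (fst z)) (fst u K z)) \<bullet> average e (snd v) z"

definition boundary_form :: "real \<Rightarrow> vec3 set \<Rightarrow> broken \<times> broken \<Rightarrow> broken \<times> broken \<Rightarrow> vec3 \<times> real \<Rightarrow> real" where
  "boundary_form \<beta> K u v z =
     \<beta> * (cross3 (unit_normal K (fst z)) (snd u K z) \<bullet> cross3 (unit_normal K (fst z)) (snd v K z))
   - cross3 (unit_normal K (fst z)) (fst u K z) \<bullet> snd v K z"

lemma poly_brokenD: "poly_broken u \<Longrightarrow> K \<in> M \<Longrightarrow> poly_field (fst u K)" "poly_broken u \<Longrightarrow> K \<in> M \<Longrightarrow> poly_field (snd u K)"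
  by (auto simp: poly_broken_def)

lemma locally_bounded_average:
  assumes "e \<in> interfaces M" "\<And>K. K \<in> M \<Longrightarrow> poly_field (F K)"
  shows "locally_bounded_field (average e F)"
proof -
  have "e \<subseteq> M" using assms(1) by (simp add: interfaces_def)
  then have "locally_bounded_field (\<lambda>z. \<Sum>K\<in>e. F K z)"
    using assms(2) poly_field_locally_bounded by (intro locally_bounded_field_sum) blast
  then have "locally_bounded (\<lambda>z. 1/2 * ((\<Sum>K\<in>e. F K z) $ i))" for i by (intro locally_bounded_cmult) blast
  then show ?thesis unfolding average_def by simp
qed

lemma locally_bounded_interface_form:
  assumes e: "e \<in> interfaces M" and u: "poly_broken u" and v: "poly_broken v"
  shows "locally_bounded (interface_form e u v)"
proof -
  have eM: "e \<subseteq> M" using e by (simp add: interfaces_def)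
  have "locally_bounded_field (\<lambda>z. \<Sum>K\<in>e. cross3 (unit_normal K (fst z)) (F K z))" if "\<And>K. K \<in> M \<Longrightarrow> poly_field (F K)" for F
    using that eM by (intro locally_bounded_field_sum locally_bounded_cross locally_bounded_unit_normal poly_field_locally_bounded) blast
  then show ?thesis
    unfolding interface_form_def[abs_def]
    by (intro locally_bounded_diff locally_bounded_inner locally_bounded_average[OF e]) (use u v in \<open>simp_all add: poly_brokenD\<close>)
qed

lemma locally_bounded_boundary_form:
  assumes K: "K \<in> M" and u: "poly_broken u" and v: "poly_broken v"
  shows "locally_bounded (boundary_form \<beta> K u v)"
  unfolding boundary_form_def[abs_def]
  by (intro locally_bounded_diff locally_bounded_cmult locally_bounded_inner locally_bounded_cross
      locally_bounded_unit_normal poly_field_locally_bounded poly_brokenD u v K)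

lemma integrable_interface_form:
  "e \<in> interfaces M \<Longrightarrow> poly_broken u \<Longrightarrow> poly_broken v \<Longrightarrow> integrable ST (\<lambda>z. indicator (interface_set e \<times> {a..b}) z * interface_form e u v z)"
  using interface_set_borel locally_bounded_interface_form by (intro integrable_ST) auto

lemma integrable_boundary:
  "K \<in> M \<Longrightarrow> locally_bounded F \<Longrightarrow> integrable ST (\<lambda>z. indicator (boundary_face \<Omega> K \<times> {a..b}) z * F z)"
  for a b :: real
  using boundary_face_borel by (intro integrable_ST) auto

lemma boundary_integral_normals:
  fixes G :: "vec3 \<Rightarrow> vec3 \<times> real \<Rightarrow> real"
  assumes K: "K \<in> M"
  shows "face_time_integral (boundary_face \<Omega> K) {a..b} (\<lambda>z. G (outward_normal \<Omega> (fst z)) z)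
    = face_time_integral (boundary_face \<Omega> K) {a..b} (\<lambda>z. G (unit_normal K (fst z)) z)"
  using boundary_face_borel[OF K]
proof (intro face_time_integral_cong_AE)
  show "AE z in ST. z \<in> boundary_face \<Omega> K \<times> {a..b} \<longrightarrow> G (outward_normal \<Omega> (fst z)) z = G (unit_normal K (fst z)) z"
    using generic_ST by eventually_elim (auto simp: boundary_normals[OF K])
qed auto

lemma face_time_integral_locally_bounded:
  assumes "S \<in> sets borel" "S \<subseteq> \<Union>\<P>" and F: "locally_bounded F"
  shows "face_time_integral S {a..b} F = ST_integral S {a..b} F"
  using assms by (intro face_time_integral_borel) (auto simp: locally_bounded_def)

lemma dg_B_forms:
  assumes u: "poly_broken u" and v: "poly_broken v"
  shows "dg_B \<Omega> M \<epsilon> \<mu> \<beta> t n u v =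
     (\<Sum>e\<in>interfaces M. ST_integral (interface_set e) (slab t n) (interface_form e u v))
   + (\<Sum>K\<in>M. ST_integral (boundary_face \<Omega> K) (slab t n) (boundary_form \<beta> K u v))
   + mass_term M \<epsilon> \<mu> (t (n - 1)) u v"
proof -
  have "face_time_integral (interface_set e) (slab t n)
        (\<lambda>z. tangential_jump e (snd u) z \<bullet> average e (fst v) z - tangential_jump e (fst u) z \<bullet> average e (snd v) z)
      = ST_integral (interface_set e) (slab t n) (interface_form e u v)" if e: "e \<in> interfaces M" for e
  proof -
    have eM: "e \<subseteq> M" using e by (simp add: interfaces_def)
    have "face_time_integral (interface_set e) (slab t n)
        (\<lambda>z. tangential_jump e (snd u) z \<bullet> average e (fst v) z - tangential_jump e (fst u) z \<bullet> average e (snd v) z)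
      = face_time_integral (interface_set e) (slab t n) (interface_form e u v)"
      using interface_set_borel[OF e]
    proof (intro face_time_integral_cong_AE)
      show "AE z in ST. z \<in> interface_set e \<times> slab t n \<longrightarrow>
        tangential_jump e (snd u) z \<bullet> average e (fst v) z - tangential_jump e (fst u) z \<bullet> average e (snd v) z = interface_form e u v z"
        using generic_ST
      proof eventually_elim
        case (elim z)
        have "outward_normal K (fst z) = unit_normal K (fst z)" if "z \<in> interface_set e \<times> slab t n" "K \<in> e" for K
          using interior_normals[OF _ elim, of K] that eM by (auto simp: interface_set_def)
        then show ?case unfolding tangential_jump_def interface_form_def by (auto cong: sum.cong)
      qed
    qed auto
    then show ?thesis
      using face_time_integral_locally_bounded[OF interface_set_borel(1,3)[OF e] locally_bounded_interface_form[OF e u v]] by simp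
  qed
  moreover have "face_time_integral (boundary_face \<Omega> K) (slab t n)
        (\<lambda>z. let \<nu> = outward_normal \<Omega> (fst z)
             in \<beta> * (cross3 \<nu> (snd u K z) \<bullet> cross3 \<nu> (snd v K z)) - cross3 \<nu> (fst u K z) \<bullet> snd v K z)
      = ST_integral (boundary_face \<Omega> K) (slab t n) (boundary_form \<beta> K u v)" if K: "K \<in> M" for K
    using boundary_integral_normals[OF K, of "t (n - 1)" "t n" "\<lambda>\<nu> z. \<beta> * (cross3 \<nu> (snd u K z) \<bullet> cross3 \<nu> (snd v K z)) - cross3 \<nu> (fst u K z) \<bullet> snd v K z"]
      face_time_integral_locally_bounded[OF boundary_face_borel(1,3)[OF K] locally_bounded_boundary_form[OF K u v, of \<beta>]]
    unfolding boundary_form_def Let_def by simp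
  ultimately show ?thesis unfolding dg_B_def by (simp add: case_prod_beta)
qed

lemma average_comb:
  "average e (fst (comb a u b v)) z = a *\<^sub>R average e (fst u) z + b *\<^sub>R average e (fst v) z"
  "average e (snd (comb a u b v)) z = a *\<^sub>R average e (snd u) z + b *\<^sub>R average e (snd v) z"
  unfolding average_def by (simp_all add: sum.distrib scaleR_sum_right scaleR_add_right mult.commute)

lemma jump_comb:
  "(\<Sum>K\<in>e. cross3 (f K) (a *\<^sub>R g K + b *\<^sub>R h K)) = a *\<^sub>R (\<Sum>K\<in>e. cross3 (f K) (g K)) + b *\<^sub>R (\<Sum>K\<in>e. cross3 (f K) (h K))"
  by (simp add: cross_add_right cross_mult_right sum.distrib scaleR_sum_right)

lemma interface_form_comb:
  "interface_form e (comb a u b v) w z = a * interface_form e u w z + b * interface_form e v w z"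
  "interface_form e w (comb a u b v) z = a * interface_form e w u z + b * interface_form e w v z"
  unfolding interface_form_def average_comb comb_simps jump_comb by (simp_all add: inner_add_left inner_add_right algebra_simps)

lemma boundary_form_comb:
  "boundary_form \<beta> K (comb a u b v) w z = a * boundary_form \<beta> K u w z + b * boundary_form \<beta> K v w z"
  "boundary_form \<beta> K w (comb a u b v) z = a * boundary_form \<beta> K w u z + b * boundary_form \<beta> K w v z"
  unfolding boundary_form_def comb_simps cross_add_right cross_mult_right
  by (simp_all add: inner_add_left inner_add_right algebra_simps)

lemma integral_comb:
  fixes f g :: "vec3 \<times> real \<Rightarrow> real"
  assumes "integrable ST (\<lambda>z. c z * f z)" "integrable ST (\<lambda>z. c z * g z)"
  shows "(LINT z|ST. c z * (a * f z + b * g z)) = a * (LINT z|ST. c z * f z) + b * (LINT z|ST. c z * g z)"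
proof -
  have "(LINT z|ST. c z * (a * f z + b * g z)) = (LINT z|ST. a * (c z * f z) + b * (c z * g z))"
    by (simp add: algebra_simps)
  also have "\<dots> = (LINT z|ST. a * (c z * f z)) + (LINT z|ST. b * (c z * g z))"
    using assms by (intro Bochner_Integration.integral_add integrable_mult_right) auto
  finally show ?thesis by simp
qed

lemma dg_B_comb:
  assumes u: "poly_broken u" and v: "poly_broken v" and w: "poly_broken w"
  shows "dg_B \<Omega> M \<epsilon> \<mu> \<beta> t n (comb a u b v) w = a * dg_B \<Omega> M \<epsilon> \<mu> \<beta> t n u w + b * dg_B \<Omega> M \<epsilon> \<mu> \<beta> t n v w"
    and "dg_B \<Omega> M \<epsilon> \<mu> \<beta> t n w (comb a u b v) = a * dg_B \<Omega> M \<epsilon> \<mu> \<beta> t n w u + b * dg_B \<Omega> M \<epsilon> \<mu> \<beta> t n w v"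
proof -
  have c: "poly_broken (comb a u b v)" by (rule poly_broken_comb[OF u v])
  have m: "mass_term M \<epsilon> \<mu> s w (comb a u b v) = a * mass_term M \<epsilon> \<mu> s w u + b * mass_term M \<epsilon> \<mu> s w v" for s
    by (rule mass_term_comb) (rule admissible_poly, rule u v w c)+
  have i: "ST_integral (interface_set e) (slab t n) (\<lambda>z. a * interface_form e u1 w1 z + b * interface_form e u2 w2 z)
      = a * ST_integral (interface_set e) (slab t n) (interface_form e u1 w1)
      + b * ST_integral (interface_set e) (slab t n) (interface_form e u2 w2)"
    if "poly_broken u1" "poly_broken w1" "poly_broken u2" "poly_broken w2" "e \<in> interfaces M" for e u1 w1 u2 w2
    using that by (intro integral_comb integrable_interface_form)
  have j: "ST_integral (boundary_face \<Omega> K) (slab t n) (\<lambda>z. a * boundary_form \<beta> K u1 w1 z + b * boundary_form \<beta> K u2 w2 z)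
      = a * ST_integral (boundary_face \<Omega> K) (slab t n) (boundary_form \<beta> K u1 w1)
      + b * ST_integral (boundary_face \<Omega> K) (slab t n) (boundary_form \<beta> K u2 w2)"
    if "poly_broken u1" "poly_broken w1" "poly_broken u2" "poly_broken w2" "K \<in> M" for K u1 w1 u2 w2
    using that by (intro integral_comb integrable_boundary locally_bounded_boundary_form)
  have si: "(\<Sum>e\<in>interfaces M. ST_integral (interface_set e) (slab t n) (\<lambda>z. a * interface_form e u1 w1 z + b * interface_form e u2 w2 z))
      = a * (\<Sum>e\<in>interfaces M. ST_integral (interface_set e) (slab t n) (interface_form e u1 w1))
      + b * (\<Sum>e\<in>interfaces M. ST_integral (interface_set e) (slab t n) (interface_form e u2 w2))"
    if "poly_broken u1" "poly_broken w1" "poly_broken u2" "poly_broken w2" for u1 w1 u2 w2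
    unfolding sum_distrib_left sum.distrib[symmetric] by (rule sum.cong[OF refl i[OF that]])
  have sj: "(\<Sum>K\<in>M. ST_integral (boundary_face \<Omega> K) (slab t n) (\<lambda>z. a * boundary_form \<beta> K u1 w1 z + b * boundary_form \<beta> K u2 w2 z))
      = a * (\<Sum>K\<in>M. ST_integral (boundary_face \<Omega> K) (slab t n) (boundary_form \<beta> K u1 w1))
      + b * (\<Sum>K\<in>M. ST_integral (boundary_face \<Omega> K) (slab t n) (boundary_form \<beta> K u2 w2))"
    if "poly_broken u1" "poly_broken w1" "poly_broken u2" "poly_broken w2" for u1 w1 u2 w2
    unfolding sum_distrib_left sum.distrib[symmetric] by (rule sum.cong[OF refl j[OF that]])
  have alg: "a * x1 + b * y1 + (a * x2 + b * y2) + (a * x3 + b * y3) = a * (x1 + x2 + x3) + b * (y1 + y2 + y3)" for x1 x2 x3 y1 y2 y3 :: real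
    by (simp add: algebra_simps)
  show "dg_B \<Omega> M \<epsilon> \<mu> \<beta> t n w (comb a u b v) = a * dg_B \<Omega> M \<epsilon> \<mu> \<beta> t n w u + b * dg_B \<Omega> M \<epsilon> \<mu> \<beta> t n w v"
    unfolding dg_B_forms[OF w c] dg_B_forms[OF w u] dg_B_forms[OF w v] m interface_form_comb boundary_form_comb
      si[OF w u w v] sj[OF w u w v] by (rule alg)
  show "dg_B \<Omega> M \<epsilon> \<mu> \<beta> t n (comb a u b v) w = a * dg_B \<Omega> M \<epsilon> \<mu> \<beta> t n u w + b * dg_B \<Omega> M \<epsilon> \<mu> \<beta> t n v w"
    unfolding dg_B_forms[OF c w] dg_B_forms[OF u w] dg_B_forms[OF v w] mass_term_commute[of \<epsilon> \<mu> _ _ w] m interface_form_comb boundary_form_comb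
      si[OF u w v w] sj[OF u w v w] by (rule alg)
qed

text \<open>With opposite normals on both sides, the mixed terms between the two elements cancel
  because the triple product \<open>(n x h) \<bullet> e\<close> changes sign when \<open>h\<close>
  and \<open>e\<close> are exchanged.\<close>

lemma interface_form_diagonal:
  assumes e: "e \<in> interfaces M" and g: "generic (fst z)" and z: "fst z \<in> interface_set e"
  shows "interface_form e u u z = (\<Sum>K\<in>e. cross3 (unit_normal K (fst z)) (snd u K z) \<bullet> fst u K z)"
proof -
  obtain K1 K2 where K: "K1 \<in> M" "K2 \<in> M" "K1 \<noteq> K2" "e = {K1, K2}" using interfaceE[OF e] .
  have n: "unit_normal K2 (fst z) = - unit_normal K1 (fst z)"
    using opposite_unit_normals(3)[OF K(1-3) g] z K by (auto simp: interface_set_def)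
  have alg: "(cross3 n h1 - cross3 n h2) \<bullet> ((1/2) *\<^sub>R (e1 + e2)) - (cross3 n e1 - cross3 n e2) \<bullet> ((1/2) *\<^sub>R (h1 + h2))
      = cross3 n h1 \<bullet> e1 - cross3 n h2 \<bullet> e2" for n h1 h2 e1 e2 :: vec3
    unfolding inner_vec_def sum_3 cross_components vector_minus_component vector_add_component vector_scaleR_component inner_real_def real_scaleR_def
    by algebra
  show ?thesis
    unfolding interface_form_def average_def K(4) using K(3) alg[of "unit_normal K1 (fst z)" "snd u K1 z" "snd u K2 z" "fst u K1 z" "fst u K2 z"]
    by (simp add: n)
qed

section \<open>Energy balance of Trefftz fields\<close>

definition trefftz_field :: "(vec3 set \<Rightarrow> real) \<Rightarrow> (vec3 set \<Rightarrow> real) \<Rightarrow> broken \<times> broken \<Rightarrow> bool" where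
  "trefftz_field \<epsilon> \<mu> u \<longleftrightarrow> poly_broken u \<and> (\<forall>K\<in>M. \<forall>z. maxwell_at (\<epsilon> K) (\<mu> K) (fst u K) (snd u K) z)"

lemma mass_term_difference:
  assumes u: "trefftz_field \<epsilon> \<mu> u" and t: "a \<le> b"
  shows "mass_term M \<epsilon> \<mu> b u u - mass_term M \<epsilon> \<mu> a u u
    = 2 * (\<Sum>K\<in>M. ST_integral (frontier K) {a..b} (\<lambda>z. cross3 (unit_normal K (fst z)) (snd u K z) \<bullet> fst u K z))"
proof -
  have p: "poly_broken u" using u by (simp add: trefftz_field_def)
  have "(LINT x : K | lebesgue. \<epsilon> K * (fst u K (x, b) \<bullet> fst u K (x, b)) + \<mu> K * (snd u K (x, b) \<bullet> snd u K (x, b)))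
     - (LINT x : K | lebesgue. \<epsilon> K * (fst u K (x, a) \<bullet> fst u K (x, a)) + \<mu> K * (snd u K (x, a) \<bullet> snd u K (x, a)))
     = 2 * ST_integral (frontier K) {a..b} (\<lambda>z. cross3 (unit_normal K (fst z)) (snd u K z) \<bullet> fst u K z)"
    if K: "K \<in> M" for K
  proof -
    let ?w = "\<lambda>z. \<epsilon> K * (fst u K z \<bullet> fst u K z) + \<mu> K * (snd u K z \<bullet> snd u K z)"
    have w: "real_polynomial_function ?w"
      unfolding inner_vec_def sum_3 inner_real_def using poly_brokenD[OF p K] by (intro polynomial_add polynomial_cmult polynomial_mult) auto
    have c: "continuous_on UNIV (\<lambda>x. ?w (x, s))" for s
      by (rule continuous_on_compose2[OF polynomial_continuous[OF w, of UNIV]]) (auto intro!: continuous_intros)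
    have i: "integrable lborel (\<lambda>x. indicator K x * ?w (x, s))" for s
      by (rule integrable_indicator_compact[OF element_compact[OF K] c])
    have l: "(LINT x : K | lebesgue. ?w (x, s)) = (LINT x|lborel. indicator K x * ?w (x, s))" for s
      unfolding set_lebesgue_integral_def using borel_measurable_integrable[OF i[of s]] by (simp add: integral_completion)
    have "(LINT x : K | lebesgue. ?w (x, b)) - (LINT x : K | lebesgue. ?w (x, a)) = (LINT x|lborel. indicator K x * (?w (x, b) - ?w (x, a)))"
      unfolding l right_diff_distrib by (rule Bochner_Integration.integral_diff[OF i i, symmetric])
    also have "\<dots> = 2 * ST_integral (frontier K) {a..b} (\<lambda>z. cross3 (unit_normal K (fst z)) (snd u K z) \<bullet> fst u K z)"
      using u K unfolding trefftz_field_def by (intro poynting[OF K t poly_brokenD[OF p K]]) blast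
    finally show ?thesis .
  qed
  then show ?thesis unfolding mass_term_def by (simp add: case_prod_beta sum_subtractf[symmetric] sum_distrib_left)
qed

definition boundary_loss :: "real \<Rightarrow> real \<Rightarrow> broken \<times> broken \<Rightarrow> real" where
  "boundary_loss a b u = (\<Sum>K\<in>M. ST_integral (boundary_face \<Omega> K) {a..b} (\<lambda>z. (norm (cross3 (unit_normal K (fst z)) (snd u K z)))\<^sup>2))"

lemma boundary_loss_nonneg: "0 \<le> boundary_loss a b u"
  unfolding boundary_loss_def by (intro sum_nonneg Bochner_Integration.integral_nonneg) simp

text \<open>On the boundary \<open>- (n x E) \<bullet> H = (n x H) \<bullet> E\<close>, so interface
  and boundary terms together supply the flux through all element boundaries, which is half the
  increase of the mass. Added to the full mass at the initial time, it yields the mean of both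
  masses.\<close>

lemma dg_B_diagonal:
  assumes u: "trefftz_field \<epsilon> \<mu> u" and t: "t (n - 1) \<le> t n"
  shows "dg_B \<Omega> M \<epsilon> \<mu> \<beta> t n u u = 1/2 * mass_term M \<epsilon> \<mu> (t n) u u + 1/2 * mass_term M \<epsilon> \<mu> (t (n - 1)) u u
     + \<beta> * boundary_loss (t (n - 1)) (t n) u"
proof -
  have p: "poly_broken u" using u by (simp add: trefftz_field_def)
  let ?F = "\<lambda>K z. cross3 (unit_normal K (fst z)) (snd u K z) \<bullet> fst u K z"
  let ?N = "\<lambda>K z. (norm (cross3 (unit_normal K (fst z)) (snd u K z)))\<^sup>2"
  have lbF: "locally_bounded (?F K)" if "K \<in> M" for K
    by (intro locally_bounded_inner locally_bounded_cross locally_bounded_unit_normal poly_field_locally_bounded poly_brokenD p that)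
  have lbN: "locally_bounded (?N K)" if "K \<in> M" for K
    unfolding power2_norm_eq_inner
    by (intro locally_bounded_inner locally_bounded_cross locally_bounded_unit_normal poly_field_locally_bounded poly_brokenD p that)
  have "ST_integral (interface_set e) (slab t n) (interface_form e u u)
     = ST_integral (interface_set e) (slab t n) (\<lambda>z. \<Sum>K\<in>e. ?F K z)" if e: "e \<in> interfaces M" for e
  proof (rule integral_cong_AE)
    have eM: "e \<subseteq> M" using e by (simp add: interfaces_def)
    show "(\<lambda>z. indicator (interface_set e \<times> slab t n) z * interface_form e u u z) \<in> borel_measurable ST"
      using integrable_interface_form[OF e p p] by (rule borel_measurable_integrable)
    have "locally_bounded (\<lambda>z. \<Sum>K\<in>e. ?F K z)" using lbF eM by (intro locally_bounded_sum) blast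
    then have "integrable ST (\<lambda>z. indicator (interface_set e \<times> slab t n) z * (\<Sum>K\<in>e. ?F K z))"
      using interface_set_borel[OF e] by (intro integrable_ST) auto
    then show "(\<lambda>z. indicator (interface_set e \<times> slab t n) z * (\<Sum>K\<in>e. ?F K z)) \<in> borel_measurable ST"
      by (rule borel_measurable_integrable)
    show "AE z in ST. indicator (interface_set e \<times> slab t n) z * interface_form e u u z = indicator (interface_set e \<times> slab t n) z * (\<Sum>K\<in>e. ?F K z)"
      using generic_ST by eventually_elim (auto simp: interface_form_diagonal[OF e] indicator_def)
  qed
  then have I: "(\<Sum>e\<in>interfaces M. ST_integral (interface_set e) (slab t n) (interface_form e u u))
     = (\<Sum>e\<in>interfaces M. ST_integral (interface_set e) (slab t n) (\<lambda>z. \<Sum>K\<in>e. ?F K z))" by simp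
  have bf: "boundary_form \<beta> K u u z = \<beta> * ?N K z + 1 * ?F K z" for K z
    unfolding boundary_form_def power2_norm_eq_inner inner_vec_def sum_3 cross_components by (simp add: algebra_simps)
  have "ST_integral (boundary_face \<Omega> K) (slab t n) (boundary_form \<beta> K u u)
     = \<beta> * ST_integral (boundary_face \<Omega> K) (slab t n) (?N K) + 1 * ST_integral (boundary_face \<Omega> K) (slab t n) (?F K)"
    if K: "K \<in> M" for K
    unfolding bf by (rule integral_comb[OF integrable_boundary[OF K lbN[OF K]] integrable_boundary[OF K lbF[OF K]]])
  then have B: "(\<Sum>K\<in>M. ST_integral (boundary_face \<Omega> K) (slab t n) (boundary_form \<beta> K u u))
     = \<beta> * boundary_loss (t (n - 1)) (t n) u + (\<Sum>K\<in>M. ST_integral (boundary_face \<Omega> K) (slab t n) (?F K))"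
    unfolding boundary_loss_def by (simp add: sum.distrib sum_distrib_left)
  have "(\<Sum>K\<in>M. ST_integral (frontier K) (slab t n) (?F K))
     = (\<Sum>e\<in>interfaces M. ST_integral (interface_set e) (slab t n) (\<lambda>z. \<Sum>K\<in>e. ?F K z))
     + (\<Sum>K\<in>M. ST_integral (boundary_face \<Omega> K) (slab t n) (?F K))"
    by (rule sum_frontier_integrals[OF lbF])
  with mass_term_difference[OF u t] show ?thesis
    unfolding dg_B_forms[OF p p] I B by linarith
qed

lemma trefftz_field_zero:
  assumes u: "trefftz_field \<epsilon> \<mu> u" and t: "t (n - 1) \<le> t n" and \<beta>: "0 \<le> \<beta>"
    and pos: "\<And>K. K \<in> M \<Longrightarrow> \<epsilon> K > 0" "\<And>K. K \<in> M \<Longrightarrow> \<mu> K > 0"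
    and z: "dg_B \<Omega> M \<epsilon> \<mu> \<beta> t n u u = 0" and K: "K \<in> M"
  shows "fst u K w = 0 \<and> snd u K w = 0"
proof -
  have p: "poly_broken u" using u by (simp add: trefftz_field_def)
  have nn: "0 \<le> mass_term M \<epsilon> \<mu> s u u" for s by (rule mass_term_nonneg[OF pos admissible_poly[OF p]])
  have "mass_term M \<epsilon> \<mu> (t n) u u = 0"
    using z dg_B_diagonal[OF u t, of \<beta>] nn[of "t n"] nn[of "t (n - 1)"] mult_nonneg_nonneg[OF \<beta> boundary_loss_nonneg[of "t (n - 1)" "t n" u]]
    by linarith
  from mass_term_zero[OF pos p this K] have "fst u K (x, t n) = 0" "snd u K (x, t n) = 0" for x by blast+
  then show ?thesis
    using maxwell_zero[of "fst u K" "snd u K" "\<epsilon> K" "\<mu> K" "t n" w] poly_brokenD[OF p K] pos[OF K] u K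
    unfolding trefftz_field_def by auto
qed

section \<open>Consistency\<close>

lemma AE_time:
  assumes "finite A"
  shows "AE z in ST. snd z \<notin> A"
proof -
  have "A \<in> null_sets lborel" using assms by (simp add: countable_imp_null_set_lborel countable_finite)
  then have "UNIV \<times> A \<in> null_sets ST" by (intro lborel.times_in_null_sets2) auto
  then show ?thesis by (rule AE_I') auto
qed

lemma dg_consistent:
  assumes sol: "piecewise_smooth_solution \<Omega> M \<epsilon> \<mu> \<beta> N T t E0 H0 g u" and sl: "slab t n \<subseteq> {0..T}"
  shows "dg_B \<Omega> M \<epsilon> \<mu> \<beta> t n u v = dg_R \<Omega> M \<epsilon> \<mu> t g n u v"
proof -
  have tr: "cross3 m (fst u K1 (x, s)) = cross3 m (fst u K2 (x, s))" "cross3 m (snd u K1 (x, s)) = cross3 m (snd u K2 (x, s))"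
    if "K1 \<in> M" "K2 \<in> M" "x \<in> frontier K1" "x \<in> frontier K2" "s \<in> {0..T}" "K1 \<noteq> K2" "is_outward_normal K1 x m" "is_outward_normal K2 x (- m)"
    for K1 K2 x s m
    using sol that unfolding piecewise_smooth_solution_def by (auto simp: case_prod_beta)
  have bc: "AE z in face_time_measure (boundary_face \<Omega> K). z \<in> boundary_face \<Omega> K \<times> {0<..<T} \<longrightarrow>
        (let \<nu> = outward_normal \<Omega> (fst z)
         in cross3 \<nu> (fst u K z) + \<beta> *\<^sub>R cross3 \<nu> (cross3 \<nu> (snd u K z)) = cross3 \<nu> (g z))" if "K \<in> M" for K
    using sol that unfolding piecewise_smooth_solution_def by (simp add: case_prod_beta)
  have "face_time_integral (interface_set e) (slab t n)
        (\<lambda>z. tangential_jump e (snd u) z \<bullet> average e (fst v) z - tangential_jump e (fst u) z \<bullet> average e (snd v) z) = 0"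
    if e: "e \<in> interfaces M" for e
  proof -
    obtain K1 K2 where K: "K1 \<in> M" "K2 \<in> M" "K1 \<noteq> K2" "e = {K1, K2}" using interfaceE[OF e] .
    have "face_time_integral (interface_set e) (slab t n)
        (\<lambda>z. tangential_jump e (snd u) z \<bullet> average e (fst v) z - tangential_jump e (fst u) z \<bullet> average e (snd v) z)
      = face_time_integral (interface_set e) (slab t n) (\<lambda>z. 0)"
      using interface_set_borel[OF e]
    proof (intro face_time_integral_cong_AE)
      show "AE z in ST. z \<in> interface_set e \<times> slab t n \<longrightarrow>
        tangential_jump e (snd u) z \<bullet> average e (fst v) z - tangential_jump e (fst u) z \<bullet> average e (snd v) z = 0"
        using generic_ST
      proof eventually_elim
        case (elim z)
        show ?case
        proof
          assume z: "z \<in> interface_set e \<times> slab t n"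
          obtain x s where xs: "z = (x, s)" by (cases z) auto
          have x: "x \<in> frontier K1" "x \<in> frontier K2" "s \<in> {0..T}" and g: "generic x"
            using z K sl elim unfolding xs interface_set_def by auto
          note n = opposite_unit_normals[OF K(1-3) g x(1,2)]
          have o: "outward_normal K1 x = unit_normal K1 x" "outward_normal K2 x = - unit_normal K1 x"
            using outward_normal_eqI[OF n(1)] outward_normal_eqI[OF n(2)] by simp_all
          have "tangential_jump e (snd u) z = 0" "tangential_jump e (fst u) z = 0"
            using tr[OF K(1,2) x K(3) n(1,2)] K(3) unfolding tangential_jump_def K(4) xs by (simp_all add: o)
          then show "tangential_jump e (snd u) z \<bullet> average e (fst v) z - tangential_jump e (fst u) z \<bullet> average e (snd v) z = 0" by simp
        qed
      qed
    qed auto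
    then show ?thesis by (simp add: face_time_integral_def set_lebesgue_integral_def)
  qed
  moreover have "face_time_integral (boundary_face \<Omega> K) (slab t n)
        (\<lambda>z. let \<nu> = outward_normal \<Omega> (fst z)
             in \<beta> * (cross3 \<nu> (snd u K z) \<bullet> cross3 \<nu> (snd v K z)) - cross3 \<nu> (fst u K z) \<bullet> snd v K z)
      = - face_time_integral (boundary_face \<Omega> K) (slab t n) (\<lambda>z. cross3 (outward_normal \<Omega> (fst z)) (g z) \<bullet> snd v K z)"
    if K: "K \<in> M" for K
  proof -
    \<comment> \<open>The boundary condition tested with \<open>w\<close>; moving one factor
      \<open>m\<close> of the double cross product over to \<open>w\<close> changes the sign of the
      term with \<beta>.\<close>
    have alg: "\<beta> * (cross3 m h \<bullet> cross3 m w) - cross3 m e \<bullet> w = - (cross3 m g' \<bullet> w)"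
      if "cross3 m e + \<beta> *\<^sub>R cross3 m (cross3 m h) = cross3 m g'" for m h w e g' :: vec3
      unfolding that[symmetric] inner_vec_def sum_3 cross_components vector_add_component vector_scaleR_component
      by (simp add: algebra_simps)
    have "face_time_integral (boundary_face \<Omega> K) (slab t n)
        (\<lambda>z. let \<nu> = outward_normal \<Omega> (fst z)
             in \<beta> * (cross3 \<nu> (snd u K z) \<bullet> cross3 \<nu> (snd v K z)) - cross3 \<nu> (fst u K z) \<bullet> snd v K z)
      = face_time_integral (boundary_face \<Omega> K) (slab t n) (\<lambda>z. - (cross3 (outward_normal \<Omega> (fst z)) (g z) \<bullet> snd v K z))"
      using boundary_face_borel[OF K]
    proof (intro face_time_integral_cong_AE)
      \<comment> \<open>The boundary condition is posed on the open interval, while the closed first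
        and last slabs contain \<open>0\<close> and \<open>T\<close>.\<close>
      have at: "AE z in ST. snd z \<noteq> 0 \<and> snd z \<noteq> T" using AE_time[of "{0, T}"] by simp
      have "AE z in ST. fst z \<in> boundary_face \<Omega> K \<longrightarrow> z \<in> boundary_face \<Omega> K \<times> {0<..<T} \<longrightarrow>
        (let \<nu> = outward_normal \<Omega> (fst z)
         in cross3 \<nu> (fst u K z) + \<beta> *\<^sub>R cross3 \<nu> (cross3 \<nu> (snd u K z)) = cross3 \<nu> (g z))"
        using bc[OF K] unfolding AE_face_time_measure[OF boundary_face_borel(1,3)[OF K]] .
      then show "AE z in ST. z \<in> boundary_face \<Omega> K \<times> slab t n \<longrightarrow>
        (let \<nu> = outward_normal \<Omega> (fst z)
             in \<beta> * (cross3 \<nu> (snd u K z) \<bullet> cross3 \<nu> (snd v K z)) - cross3 \<nu> (fst u K z) \<bullet> snd v K z)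
          = - (cross3 (outward_normal \<Omega> (fst z)) (g z) \<bullet> snd v K z)"
        using at
      proof eventually_elim
        case (elim z)
        have "(let \<nu> = outward_normal \<Omega> (fst z)
             in \<beta> * (cross3 \<nu> (snd u K z) \<bullet> cross3 \<nu> (snd v K z)) - cross3 \<nu> (fst u K z) \<bullet> snd v K z)
          = - (cross3 (outward_normal \<Omega> (fst z)) (g z) \<bullet> snd v K z)" if z: "z \<in> boundary_face \<Omega> K \<times> slab t n"
        proof -
          have "z \<in> boundary_face \<Omega> K \<times> {0<..<T}" using z elim(2) sl by (cases z) (auto simp: subset_iff less_le)
          then have "cross3 (outward_normal \<Omega> (fst z)) (fst u K z) + \<beta> *\<^sub>R cross3 (outward_normal \<Omega> (fst z)) (cross3 (outward_normal \<Omega> (fst z)) (snd u K z))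
              = cross3 (outward_normal \<Omega> (fst z)) (g z)"
            using elim(1) by (auto simp: Let_def)
          from alg[OF this] show ?thesis by (simp add: Let_def)
        qed
        then show ?case using elim by blast
      qed
    qed auto
    then show ?thesis by (simp add: face_time_integral_def set_lebesgue_integral_def)
  qed
  ultimately show ?thesis unfolding dg_B_def dg_R_def by (simp add: case_prod_beta sum_negf)
qed

end

subsection \<open>Unique solvability\<close>

text \<open>Degenerate forms are admitted, so that the linear independence of the monomials is not needed.
  In the induction, the new basis vector is made orthogonal to the old subspace.\<close>

lemma coefficient_system_solvable:
  fixes S :: "('i \<Rightarrow> real) set" and B :: "('i \<Rightarrow> real) \<Rightarrow> ('i \<Rightarrow> real) \<Rightarrow> real"
  assumes "finite J" "\<And>c i. c \<in> S \<Longrightarrow> i \<notin> J \<Longrightarrow> c i = 0" "(\<lambda>i. 0) \<in> S"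
    and "\<And>a b c d. c \<in> S \<Longrightarrow> d \<in> S \<Longrightarrow> (\<lambda>i. a * c i + b * d i) \<in> S"
    and "\<And>a b c d e. c \<in> S \<Longrightarrow> d \<in> S \<Longrightarrow> e \<in> S \<Longrightarrow> B (\<lambda>i. a * c i + b * d i) e = a * B c e + b * B d e"
    and "\<And>a b c d e. c \<in> S \<Longrightarrow> d \<in> S \<Longrightarrow> e \<in> S \<Longrightarrow> B e (\<lambda>i. a * c i + b * d i) = a * B e c + b * B e d"
    and "\<And>a b c d. c \<in> S \<Longrightarrow> d \<in> S \<Longrightarrow> L (\<lambda>i. a * c i + b * d i) = a * L c + b * L d"
    and "\<And>c d. c \<in> S \<Longrightarrow> d \<in> S \<Longrightarrow> B c c = 0 \<Longrightarrow> B c d = 0 \<and> B d c = 0 \<and> L c = 0"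
  shows "\<exists>c\<in>S. \<forall>d\<in>S. B c d = L d"
  using assms
proof (induction J arbitrary: S L rule: finite_induct)
  case empty
  have S: "c = (\<lambda>i. 0)" if "c \<in> S" for c using empty.prems(1)[OF that] by auto
  have "B (\<lambda>i. 0) (\<lambda>i. 0) = 0" "L (\<lambda>i. 0) = 0"
    using empty.prems(4)[OF empty.prems(2,2,2), of 0 0] empty.prems(6)[OF empty.prems(2,2), of 0 0] by simp_all
  note 0 = this
  show ?case
  proof (rule bexI[OF _ empty.prems(2)], rule ballI)
    fix d assume "d \<in> S"
    then have "d = (\<lambda>i. 0)" by (rule S)
    then show "B (\<lambda>i. 0) d = L d" using 0 by (simp only:)
  qed
next
  case (insert j J)
  note sub = insert.prems(3) and Bl = insert.prems(4) and Br = insert.prems(5) and lin = insert.prems(6) and deg = insert.prems(7)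
  define S0 where "S0 = {c \<in> S. c j = 0}"
  have S0: "c \<in> S" "c j = 0" if "c \<in> S0" for c using that by (auto simp: S0_def)
  \<comment> \<open>Kept general because two functionals are solved for on the subspace:
    \<open>L\<close> itself, and \<open>B e\<close> for the orthogonalisation.\<close>
  have IH: "\<exists>c\<in>S0. \<forall>d\<in>S0. B c d = f d"
    if f: "\<And>a b c d. c \<in> S0 \<Longrightarrow> d \<in> S0 \<Longrightarrow> f (\<lambda>i. a * c i + b * d i) = a * f c + b * f d"
      and f0: "\<And>c. c \<in> S0 \<Longrightarrow> B c c = 0 \<Longrightarrow> f c = 0" for f
  proof (rule insert.IH)
    show "c i = 0" if "c \<in> S0" "i \<notin> J" for c i
      using insert.prems(1)[of c i] that by (auto simp: S0_def)
    show "(\<lambda>i. 0) \<in> S0" using insert.prems(2) by (simp add: S0_def)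
    show "(\<lambda>i. a * c i + b * d i) \<in> S0" if "c \<in> S0" "d \<in> S0" for a b c d
      using sub that by (auto simp: S0_def)
    show "B c d = 0 \<and> B d c = 0 \<and> f c = 0" if "c \<in> S0" "d \<in> S0" "B c c = 0" for c d
      using deg[of c d] f0[of c] that by (auto simp: S0_def)
  qed (use Bl Br f in \<open>auto simp: S0_def\<close>)
  have "\<exists>c\<in>S0. \<forall>d\<in>S0. B c d = L d"
  proof (rule IH)
    show "L (\<lambda>i. a * c i + b * d i) = a * L c + b * L d" if "c \<in> S0" "d \<in> S0" for a b c d
      by (rule lin[OF S0(1)[OF that(1)] S0(1)[OF that(2)]])
    show "L c = 0" if "c \<in> S0" "B c c = 0" for c
      using deg[OF S0(1)[OF that(1)] S0(1)[OF that(1)] that(2)] by blast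
  qed
  then obtain u0 where u0: "u0 \<in> S0" "\<And>d. d \<in> S0 \<Longrightarrow> B u0 d = L d" by blast
  show ?case
  proof (cases "S = S0")
    case True
    then show ?thesis using u0 by blast
  next
    case False
    then obtain e1 where e1: "e1 \<in> S" "e1 j \<noteq> 0" by (auto simp: S0_def)
    \<comment> \<open>Normalised to 1 at \<open>j\<close>; the summand with factor 0 gives the shape
      of the closure property of \<open>S\<close>.\<close>
    define e where "e = (\<lambda>i. (1 / e1 j) * e1 i + 0 * e1 i)"
    have e: "e \<in> S" "e j = 1" using sub[OF e1(1) e1(1), of "1 / e1 j" 0] e1(2) by (simp_all add: e_def)
    have "\<exists>c\<in>S0. \<forall>d\<in>S0. B c d = B e d"
    proof (rule IH)
      show "B e (\<lambda>i. a * c i + b * d i) = a * B e c + b * B e d" if "c \<in> S0" "d \<in> S0" for a b c d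
        by (rule Br[OF S0(1)[OF that(1)] S0(1)[OF that(2)] e(1)])
      show "B e c = 0" if "c \<in> S0" "B c c = 0" for c
        using deg[OF S0(1)[OF that(1)] e(1) that(2)] by blast
    qed
    then obtain q where q: "q \<in> S0" "\<And>d. d \<in> S0 \<Longrightarrow> B q d = B e d" by blast
    \<comment> \<open>\<open>q\<close> represents \<open>B e\<close> on \<open>S0\<close>, so the
      difference is annihilated by all of \<open>S0\<close> in the second argument. Adding multiples
      of \<open>e'\<close> to \<open>u0\<close> therefore keeps the equations on
      \<open>S0\<close>.\<close>
    define e' where "e' = (\<lambda>i. 1 * e i + (- 1) * q i)"
    have e': "e' \<in> S" "e' j = 1" using sub[OF e(1) S0(1)[OF q(1)], of 1 "- 1"] e(2) S0(2)[OF q(1)] by (simp_all add: e'_def)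
    have Be': "B e' d = 0" if "d \<in> S0" for d
      using Bl[OF e(1) S0(1)[OF q(1)] S0(1)[OF that], of 1 "- 1"] q(2)[OF that] by (simp add: e'_def)
    \<comment> \<open>The coefficient solves the equation tested with \<open>e'\<close>. If
      \<open>B e' e' = 0\<close>, degeneracy forces \<open>B u0 e'\<close> and \<open>L e'\<close>
      to vanish as well, and 0 serves.\<close>
    define u where "u = (\<lambda>i. 1 * u0 i + (if B e' e' = 0 then 0 else (L e' - B u0 e') / B e' e') * e' i)"
    have u: "u \<in> S" unfolding u_def by (rule sub[OF S0(1)[OF u0(1)] e'(1)])
    have ue': "B u e' = L e'"
    proof (cases "B e' e' = 0")
      case True
      then show ?thesis
        using deg[OF e'(1) S0(1)[OF u0(1)]] Bl[OF S0(1)[OF u0(1)] e'(1) e'(1), of 1 0] by (simp add: u_def)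
    next
      case False
      then show ?thesis
        using Bl[OF S0(1)[OF u0(1)] e'(1) e'(1), of 1 "(L e' - B u0 e') / B e' e'"] by (simp add: u_def)
    qed
    have ud: "B u d = L d" if "d \<in> S0" for d
      unfolding u_def Bl[OF S0(1)[OF u0(1)] e'(1) S0(1)[OF that]] using u0(2)[OF that] Be'[OF that] by simp
    have "B u d = L d" if d: "d \<in> S" for d
    proof -
      \<comment> \<open>Subtracting the multiple of \<open>e'\<close> clears entry \<open>j\<close>,
        so \<open>S\<close> is spanned by \<open>S0\<close> and \<open>e'\<close>.\<close>
      define d0 where "d0 = (\<lambda>i. 1 * d i + (- d j) * e' i)"
      have d0: "d0 \<in> S0" using sub[OF d e'(1), of 1 "- d j"] e'(2) by (simp add: S0_def d0_def)
      have eq: "d = (\<lambda>i. 1 * d0 i + d j * e' i)" by (simp add: d0_def)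
      have "B u d = 1 * B u d0 + d j * B u e'"
        by (subst eq) (rule Br[OF S0(1)[OF d0] e'(1) u])
      also have "\<dots> = 1 * L d0 + d j * L e'" using ud[OF d0] ue' by simp
      also have "\<dots> = L d" by (subst (2) eq) (rule lin[OF S0(1)[OF d0] e'(1), symmetric])
      finally show ?thesis .
    qed
    then show ?thesis using u by blast
  qed
qed

section \<open>Polynomials as finite sums of monomials\<close>

definition exponents :: "nat \<Rightarrow> (nat \<times> nat \<times> nat \<times> nat) set" where
  "exponents p = {(i, j, k, l). i + j + k + l \<le> p}"

definition monomial :: "nat \<times> nat \<times> nat \<times> nat \<Rightarrow> vec3 \<times> real \<Rightarrow> real" where
  "monomial q z = (case q of (i, j, k, l) \<Rightarrow> (fst z $ 1) ^ i * (fst z $ 2) ^ j * (fst z $ 3) ^ k * snd z ^ l)"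

lemma finite_exponents: "finite (exponents p)"
proof (rule finite_subset)
  show "exponents p \<subseteq> {..p} \<times> {..p} \<times> {..p} \<times> {..p}" by (auto simp: exponents_def)
qed simp

lemma polys_monomials: "f \<in> polys p \<longleftrightarrow> (\<exists>c. f = (\<lambda>z. \<Sum>q\<in>exponents p. c q * monomial q z))"
proof
  assume "f \<in> polys p"
  then obtain c where c: "\<And>x s. f (x, s) = (\<Sum>(i, j, k, l)\<in>{(i, j, k, l). i + j + k + l \<le> p}. c i j k l * (x $ 1) ^ i * (x $ 2) ^ j * (x $ 3) ^ k * s ^ l)"
    unfolding polys_def by auto
  have "f z = (\<Sum>q\<in>exponents p. (case q of (i, j, k, l) \<Rightarrow> c i j k l) * monomial q z)" for z
    using c[of "fst z" "snd z"] unfolding exponents_def monomial_def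
    by (auto intro!: sum.cong simp: mult.assoc split: prod.splits)
  then show "\<exists>c. f = (\<lambda>z. \<Sum>q\<in>exponents p. c q * monomial q z)" by blast
next
  assume "\<exists>c. f = (\<lambda>z. \<Sum>q\<in>exponents p. c q * monomial q z)"
  then obtain c where c: "f = (\<lambda>z. \<Sum>q\<in>exponents p. c q * monomial q z)" by blast
  have "f (x, s) = (\<Sum>(i, j, k, l)\<in>{(i, j, k, l). i + j + k + l \<le> p}. c (i, j, k, l) * (x $ 1) ^ i * (x $ 2) ^ j * (x $ 3) ^ k * s ^ l)" for x s
    unfolding c exponents_def monomial_def by (auto intro!: sum.cong simp: mult.assoc split: prod.splits)
  then show "f \<in> polys p" unfolding polys_def by (intro CollectI exI[of _ "\<lambda>i j k l. c (i, j, k, l)"]) blast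
qed

lemma polynomial_monomial: "real_polynomial_function (monomial q)"
proof -
  obtain i j k l where q: "q = (i, j, k, l)" by (cases q) auto
  have "bounded_linear (\<lambda>z :: vec3 \<times> real. fst z $ m)" for m
    using bounded_linear_compose[OF bounded_linear_vec_nth bounded_linear_fst] .
  then have "real_polynomial_function (\<lambda>z :: vec3 \<times> real. fst z $ m)" for m by (rule polynomial_linear)
  then have x: "real_polynomial_function (\<lambda>z :: vec3 \<times> real. (fst z $ m) ^ n)" for m n
    by (rule real_polynomial_function_power)
  have t: "real_polynomial_function (\<lambda>z :: vec3 \<times> real. snd z ^ n)" for n
    by (rule real_polynomial_function_power) (rule polynomial_linear[OF bounded_linear_snd])
  show ?thesis unfolding monomial_def[abs_def] q prod.case
    by (rule polynomial_mult[OF polynomial_mult[OF polynomial_mult[OF x x] x] t])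
qed

lemma polys_polynomial: "f \<in> polys p \<Longrightarrow> real_polynomial_function f"
  unfolding polys_monomials by (auto intro!: real_polynomial_function_sum finite_exponents polynomial_cmult polynomial_monomial)

lemma polys_lincomb:
  assumes "f \<in> polys p" "g \<in> polys p"
  shows "(\<lambda>z. a * f z + b * g z) \<in> polys p"
proof -
  obtain c d where "f = (\<lambda>z. \<Sum>q\<in>exponents p. c q * monomial q z)" "g = (\<lambda>z. \<Sum>q\<in>exponents p. d q * monomial q z)"
    using assms unfolding polys_monomials by blast
  then have "(\<lambda>z. a * f z + b * g z) = (\<lambda>z. \<Sum>q\<in>exponents p. (a * c q + b * d q) * monomial q z)"
    by (simp add: sum_distrib_left sum.distrib[symmetric] algebra_simps)
  then show ?thesis unfolding polys_monomials by (intro exI[of _ "\<lambda>q. a * c q + b * d q"])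
qed

context mesh_family
begin

lemma trefftz_space_field:
  assumes u: "u \<in> trefftz_space M \<epsilon> \<mu> p t n" and t: "t (n - 1) < t n"
  shows "trefftz_field \<epsilon> \<mu> u"
proof -
  have p: "poly_field (fst u K)" "poly_field (snd u K)" and m: "\<And>z. z \<in> K \<times> slab t n \<Longrightarrow> maxwell_at (\<epsilon> K) (\<mu> K) (fst u K) (snd u K) z"
    if "K \<in> M" for K
    using u that polys_polynomial unfolding trefftz_space_def local_trefftz_def by (auto simp: case_prod_beta)
  have "interior (K \<times> slab t n) \<noteq> {}" if "K \<in> M" for K
    using element_interior[OF that] t by (simp add: interior_Times)
  then have "maxwell_at (\<epsilon> K) (\<mu> K) (fst u K) (snd u K) z" if "K \<in> M" for K z
    using maxwell_everywhere[OF p[OF that] _ m[OF that]] that by blast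
  then show ?thesis unfolding trefftz_field_def poly_broken_def using p by blast
qed

text \<open>Equality on the mesh only: linear combinations need not have the default value outside
  \<open>M\<close> that extensional fields have, but the forms do not see it.\<close>

definition agree :: "broken \<times> broken \<Rightarrow> broken \<times> broken \<Rightarrow> bool" where
  "agree u v \<longleftrightarrow> (\<forall>K\<in>M. fst u K = fst v K \<and> snd u K = snd v K)"

lemma dg_B_agree:
  assumes "agree u u'" "agree v v'"
  shows "dg_B \<Omega> M \<epsilon> \<mu> \<beta> t n u v = dg_B \<Omega> M \<epsilon> \<mu> \<beta> t n u' v'"
proof -
  have M: "fst u K = fst u' K" "snd u K = snd u' K" "fst v K = fst v' K" "snd v K = snd v' K" if "K \<in> M" for K
    using assms that by (auto simp: agree_def)
  have j: "tangential_jump e F = tangential_jump e F'" "average e F = average e F'"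
    if "e \<in> interfaces M" "\<And>K. K \<in> M \<Longrightarrow> F K = F' K" for e F F'
  proof -
    have "F K = F' K" if "K \<in> e" for K using \<open>e \<in> interfaces M\<close> \<open>\<And>K. K \<in> M \<Longrightarrow> F K = F' K\<close> that by (auto simp: interfaces_def)
    then show "tangential_jump e F = tangential_jump e F'" "average e F = average e F'"
      unfolding tangential_jump_def[abs_def] average_def[abs_def] by simp_all
  qed
  have "(\<Sum>e\<in>interfaces M. face_time_integral (interface_set e) (slab t n)
        (\<lambda>z. tangential_jump e (snd u) z \<bullet> average e (fst v) z - tangential_jump e (fst u) z \<bullet> average e (snd v) z))
    = (\<Sum>e\<in>interfaces M. face_time_integral (interface_set e) (slab t n)
        (\<lambda>z. tangential_jump e (snd u') z \<bullet> average e (fst v') z - tangential_jump e (fst u') z \<bullet> average e (snd v') z))"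
    by (intro sum.cong refl) (simp add: j[OF _ M(1)] j[OF _ M(2)] j[OF _ M(3)] j[OF _ M(4)])
  then show ?thesis unfolding dg_B_def mass_term_def by (simp add: case_prod_beta M)
qed

lemma dg_R_agree:
  assumes "agree v v'"
  shows "dg_R \<Omega> M \<epsilon> \<mu> t g n u v = dg_R \<Omega> M \<epsilon> \<mu> t g n u v'"
proof -
  have M: "fst v K = fst v' K" "snd v K = snd v' K" if "K \<in> M" for K
    using assms that by (auto simp: agree_def)
  show ?thesis unfolding dg_R_def mass_term_def by (simp add: case_prod_beta M)
qed

text \<open>The datum is measurable only for the completed measure. Each component, a real function,
  has a Borel representative; cutting off at the open time interval first ensures that nothing is
  claimed about values of the datum elsewhere.\<close>

lemma datum_borel:
  assumes g: "L2_on (face_time_measure (frontier \<Omega>)) (frontier \<Omega> \<times> {0<..<T}) g"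
  obtains g' where "\<And>i. (\<lambda>z. g' z $ i) \<in> borel_measurable borel"
    "AE z in ST. z \<in> frontier \<Omega> \<times> {0<..<T} \<longrightarrow> g z = g' z"
    "integrable ST (\<lambda>z. indicator (frontier \<Omega> \<times> {0<..<T}) z * (norm (g' z))\<^sup>2)"
proof -
  let ?A = "frontier \<Omega> \<times> (UNIV :: real set)" and ?C = "frontier \<Omega> \<times> {0<..<T}"
  let ?D = "density ST (indicator ?A)"
  have Am[measurable]: "?A \<in> sets ST" and Cm[measurable]: "?C \<in> sets ST" by (auto intro!: borel_times)
  have ft: "face_time_measure (frontier \<Omega>) = completion ?D"
    by (rule face_time_measure_sheets) (use domain_family in auto)
  have fm: "(\<lambda>z. indicator ?C z *\<^sub>R g z) \<in> borel_measurable (completion ?D)"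
    and gi: "integrable (completion ?D) (\<lambda>z. indicator ?C z *\<^sub>R (norm (g z))\<^sup>2)"
    using g unfolding L2_on_def set_borel_measurable_def set_integrable_def ft by blast+
  have exi: "\<exists>h\<in>borel_measurable ?D. (AE z in ?D. (indicator ?C z *\<^sub>R g z) $ i = h z)" for i
  proof (rule completion_ex_borel_measurable_real)
    have "(\<lambda>z. (indicator ?C z *\<^sub>R g z) \<bullet> axis i 1) \<in> borel_measurable (completion ?D)"
      by (rule borel_measurable_inner[OF fm]) simp
    then show "(\<lambda>z. (indicator ?C z *\<^sub>R g z) $ i) \<in> borel_measurable (completion ?D)" by (simp add: inner_axis)
  qed
  have "\<forall>i. \<exists>h. h \<in> borel_measurable ?D \<and> (AE z in ?D. (indicator ?C z *\<^sub>R g z) $ i = h z)"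
  proof
    show "\<exists>h. h \<in> borel_measurable ?D \<and> (AE z in ?D. (indicator ?C z *\<^sub>R g z) $ i = h z)" for i
      using exi[of i] unfolding Bex_def .
  qed
  from choice[OF this] obtain h where h: "\<And>i. h i \<in> borel_measurable ?D"
    and hae: "\<And>i. AE z in ?D. (indicator ?C z *\<^sub>R g z) $ i = h i z"
    by blast
  define g' where "g' = (\<lambda>z. \<chi> i. h i z)"
  have hm[measurable]: "h i \<in> borel_measurable ST" for i using h[of i] by simp
  have ae: "AE z in ?D. indicator ?C z *\<^sub>R g z = g' z"
  proof -
    have "AE z in ?D. \<forall>i. (indicator ?C z *\<^sub>R g z) $ i = h i z" using hae by (rule eventually_all_finite)
    then show ?thesis by eventually_elim (simp add: g'_def vec_eq_iff)
  qed
  have 1: "(\<lambda>z. g' z $ i) \<in> borel_measurable borel" for i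
    using hm[of i] unfolding measurable_space_time by (simp add: g'_def)
  have 2: "AE z in ST. z \<in> ?C \<longrightarrow> g z = g' z"
  proof -
    have "AE z in ST. (0::ennreal) < indicator ?A z \<longrightarrow> indicator ?C z *\<^sub>R g z = g' z"
      using ae by (subst (asm) AE_density) auto
    then show ?thesis by eventually_elim (auto simp: indicator_def)
  qed
  let ?F = "\<lambda>z. indicator ?C z * (norm (g' z))\<^sup>2"
  have Fm: "?F \<in> borel_measurable ST"
    unfolding power2_norm_eq_inner inner_vec_def g'_def by simp
  have "AE z in ?D. indicator ?C z *\<^sub>R (norm (g z))\<^sup>2 = ?F z"
    using ae by eventually_elim (auto simp: indicator_def)
  then have aec: "AE z in completion ?D. indicator ?C z *\<^sub>R (norm (g z))\<^sup>2 = ?F z" by (rule AE_completion)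
  have FmD: "?F \<in> borel_measurable ?D" using Fm by simp
  have "integrable (completion ?D) ?F"
    using Bochner_Integration.integrable_cong_AE[OF borel_measurable_integrable[OF gi] measurable_completion[OF FmD] aec] gi by blast
  then have "integrable ?D ?F" using integrable_completion[OF FmD] by blast
  then have "integrable (density ST (\<lambda>z. ennreal (indicator ?A z))) ?F" by (simp add: ennreal_indicator)
  then have "integrable ST (\<lambda>z. indicator ?A z *\<^sub>R ?F z)"
    using Fm by (subst (asm) integrable_density) auto
  moreover have "(\<lambda>z. indicator ?A z *\<^sub>R ?F z) = ?F" by (auto simp: indicator_def)
  ultimately have 3: "integrable ST ?F" by simp
  show thesis by (rule that[OF 1 2 3])
qed

end

section \<open>Data terms for a Borel representative of the excitation\<close>

locale dg_data = mesh_family +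
  fixes g g' :: field and T :: real
  assumes datum_measurable: "\<And>i. (\<lambda>z. g' z $ i) \<in> borel_measurable borel"
    and datum_AE: "AE z in ST. z \<in> frontier \<Omega> \<times> {0<..<T} \<longrightarrow> g z = g' z"
    and datum_integrable: "integrable ST (\<lambda>z. indicator (frontier \<Omega> \<times> {0<..<T}) z * (norm (g' z))\<^sup>2)"
begin

definition datum_form :: "vec3 set \<Rightarrow> broken \<times> broken \<Rightarrow> vec3 \<times> real \<Rightarrow> real" where
  "datum_form K v z = cross3 (unit_normal K (fst z)) (g' z) \<bullet> snd v K z"

lemma borel_datum_form:
  assumes K: "K \<in> M" and v: "poly_broken v"
  shows "datum_form K v \<in> borel_measurable borel"
proof -
  have lb: "locally_bounded_field (\<lambda>z. cross3 (snd v K z) (unit_normal K (fst z)))"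
    by (intro locally_bounded_cross locally_bounded_unit_normal poly_field_locally_bounded poly_brokenD v K)
  \<comment> \<open>Cyclic symmetry of the triple product separates the datum from a locally bounded
    factor.\<close>
  have eq: "datum_form K v z = (\<Sum>i\<in>UNIV. g' z $ i * cross3 (snd v K z) (unit_normal K (fst z)) $ i)" for z
    unfolding datum_form_def inner_vec_def sum_3 cross_components by (simp add: algebra_simps)
  show ?thesis unfolding eq[abs_def]
    by (intro borel_measurable_sum borel_measurable_times datum_measurable) (use lb in \<open>auto simp: locally_bounded_def\<close>)
qed

text \<open>The datum is only square integrable, so its product with the test field is dominated by
  the sum of the two squares. The bound may fail at times \<open>0\<close> and \<open>T\<close>,
  which form a null set.\<close>

lemma integrable_datum_form:
  assumes K: "K \<in> M" and v: "poly_broken v" and ab: "{a..b} \<subseteq> {0..T}"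
  shows "integrable ST (\<lambda>z. indicator (boundary_face \<Omega> K \<times> {a..b}) z * datum_form K v z)"
proof -
  let ?c = "\<lambda>z. cross3 (snd v K z) (unit_normal K (fst z))"
  let ?b = "boundary_face \<Omega> K \<times> {a..b}" and ?C = "frontier \<Omega> \<times> {0<..<T}"
  have "locally_bounded (\<lambda>z. ?c z \<bullet> ?c z)"
    by (intro locally_bounded_inner locally_bounded_cross locally_bounded_unit_normal poly_field_locally_bounded poly_brokenD v K)
  then have ci: "integrable ST (\<lambda>z. indicator ?b z * (?c z \<bullet> ?c z))" by (rule integrable_boundary[OF K])
  show ?thesis
  proof (rule Bochner_Integration.integrable_bound)
    show "integrable ST (\<lambda>z. indicator ?C z * (norm (g' z))\<^sup>2 + indicator ?b z * (?c z \<bullet> ?c z))"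
      by (rule Bochner_Integration.integrable_add[OF datum_integrable ci])
    show "(\<lambda>z. indicator ?b z * datum_form K v z) \<in> borel_measurable ST"
      using borel_datum_form[OF K v] borel_times[OF boundary_face_borel(1)[OF K], of "{a..b}"]
      unfolding measurable_space_time[symmetric] by (intro borel_measurable_times borel_measurable_indicator) auto
    have "AE z in ST. snd z \<noteq> 0 \<and> snd z \<noteq> T" using AE_time[of "{0, T}"] by simp
    then show "AE z in ST. norm (indicator ?b z * datum_form K v z) \<le> norm (indicator ?C z * (norm (g' z))\<^sup>2 + indicator ?b z * (?c z \<bullet> ?c z))"
    proof eventually_elim
      case (elim z)
      show ?case
      proof (cases "z \<in> ?b")
        case True
        then have "z \<in> ?C" using elim ab by (cases z) (auto simp: boundary_face_def subset_iff less_le)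
        have "datum_form K v z = g' z \<bullet> ?c z"
          unfolding datum_form_def inner_vec_def sum_3 cross_components by (simp add: algebra_simps)
        then have "\<bar>datum_form K v z\<bar> \<le> norm (g' z) * norm (?c z)" by (simp only: Cauchy_Schwarz_ineq2)
        also have "\<dots> \<le> (norm (g' z))\<^sup>2 + (norm (?c z))\<^sup>2"
          using sum_squares_bound[of "norm (g' z)" "norm (?c z)"] mult_nonneg_nonneg[OF norm_ge_zero[of "g' z"] norm_ge_zero[of "?c z"]] by linarith
        finally show ?thesis using True \<open>z \<in> ?C\<close> by (simp add: power2_norm_eq_inner)
      qed simp
    qed
  qed
qed

lemma datum_integral_cong:
  fixes G :: "vec3 \<Rightarrow> vec3 \<Rightarrow> vec3 \<times> real \<Rightarrow> real"
  assumes K: "K \<in> M" and ab: "{a..b} \<subseteq> {0..T}" and m: "(\<lambda>z. G (unit_normal K (fst z)) (g' z) z) \<in> borel_measurable borel"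
  shows "face_time_integral (boundary_face \<Omega> K) {a..b} (\<lambda>z. G (outward_normal \<Omega> (fst z)) (g z) z)
    = ST_integral (boundary_face \<Omega> K) {a..b} (\<lambda>z. G (unit_normal K (fst z)) (g' z) z)"
proof -
  have "AE z in ST. snd z \<noteq> 0 \<and> snd z \<noteq> T" using AE_time[of "{0, T}"] by simp
  with datum_AE generic_ST have "AE z in ST. z \<in> boundary_face \<Omega> K \<times> {a..b} \<longrightarrow>
     G (outward_normal \<Omega> (fst z)) (g z) z = G (unit_normal K (fst z)) (g' z) z"
  proof eventually_elim
    case (elim z)
    have "G (outward_normal \<Omega> (fst z)) (g z) z = G (unit_normal K (fst z)) (g' z) z" if z: "z \<in> boundary_face \<Omega> K \<times> {a..b}"
    proof -
      have "z \<in> frontier \<Omega> \<times> {0<..<T}" using z elim(3) ab by (cases z) (auto simp: boundary_face_def subset_iff less_le)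
      then have "g z = g' z" using elim(1) by blast
      moreover have "outward_normal \<Omega> (fst z) = unit_normal K (fst z)"
        using boundary_normals[OF K elim(2)] z by auto
      ultimately show ?thesis by simp
    qed
    then show ?case using elim by blast
  qed
  then have "face_time_integral (boundary_face \<Omega> K) {a..b} (\<lambda>z. G (outward_normal \<Omega> (fst z)) (g z) z)
    = face_time_integral (boundary_face \<Omega> K) {a..b} (\<lambda>z. G (unit_normal K (fst z)) (g' z) z)"
    using boundary_face_borel[OF K] by (intro face_time_integral_cong_AE) auto
  then show ?thesis using face_time_integral_borel[OF boundary_face_borel(1,3)[OF K] _ m] by simp
qed

lemma dg_R_form:
  assumes v: "poly_broken v" and sl: "slab t n \<subseteq> {0..T}"
  shows "dg_R \<Omega> M \<epsilon> \<mu> t g n u v =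
     - (\<Sum>K\<in>M. ST_integral (boundary_face \<Omega> K) (slab t n) (datum_form K v)) + mass_term M \<epsilon> \<mu> (t (n - 1)) u v"
proof -
  have "face_time_integral (boundary_face \<Omega> K) (slab t n) (\<lambda>z. cross3 (outward_normal \<Omega> (fst z)) (g z) \<bullet> snd v K z)
     = ST_integral (boundary_face \<Omega> K) (slab t n) (datum_form K v)" if K: "K \<in> M" for K
    using datum_integral_cong[OF K sl, of "\<lambda>\<nu> \<gamma> z. cross3 \<nu> \<gamma> \<bullet> snd v K z"] borel_datum_form[OF K v]
    unfolding datum_form_def[abs_def] by simp
  then show ?thesis unfolding dg_R_def by (simp add: case_prod_beta)
qed

lemma datum_form_comb: "datum_form K (comb a u b v) z = a * datum_form K u z + b * datum_form K v z"
  unfolding datum_form_def comb_simps by (simp add: inner_add_right)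

lemma dg_R_comb:
  assumes u: "admissible (t (n - 1)) u" and v: "poly_broken v" and w: "poly_broken w" and sl: "slab t n \<subseteq> {0..T}"
  shows "dg_R \<Omega> M \<epsilon> \<mu> t g n u (comb a v b w) = a * dg_R \<Omega> M \<epsilon> \<mu> t g n u v + b * dg_R \<Omega> M \<epsilon> \<mu> t g n u w"
proof -
  have c: "poly_broken (comb a v b w)" by (rule poly_broken_comb[OF v w])
  have m: "mass_term M \<epsilon> \<mu> (t (n - 1)) u (comb a v b w) = a * mass_term M \<epsilon> \<mu> (t (n - 1)) u v + b * mass_term M \<epsilon> \<mu> (t (n - 1)) u w"
    by (rule mass_term_comb[OF u]) (rule admissible_poly, rule v w c)+
  have i: "ST_integral (boundary_face \<Omega> K) (slab t n) (\<lambda>z. a * datum_form K v z + b * datum_form K w z)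
     = a * ST_integral (boundary_face \<Omega> K) (slab t n) (datum_form K v)
     + b * ST_integral (boundary_face \<Omega> K) (slab t n) (datum_form K w)" if "K \<in> M" for K
    by (intro integral_comb integrable_datum_form that v w sl)
  have si: "(\<Sum>K\<in>M. ST_integral (boundary_face \<Omega> K) (slab t n) (\<lambda>z. a * datum_form K v z + b * datum_form K w z))
     = a * (\<Sum>K\<in>M. ST_integral (boundary_face \<Omega> K) (slab t n) (datum_form K v))
     + b * (\<Sum>K\<in>M. ST_integral (boundary_face \<Omega> K) (slab t n) (datum_form K w))"
    unfolding sum_distrib_left sum.distrib[symmetric] by (rule sum.cong[OF refl i])
  show ?thesis
    unfolding dg_R_form[OF c sl] dg_R_form[OF v sl] dg_R_form[OF w sl] datum_form_comb si m by (simp add: algebra_simps)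
qed

lemma boundary_dissipation:
  assumes v: "poly_broken v" and sl: "{a..b} \<subseteq> {0..T}"
  shows "(\<Sum>K\<in>M. face_time_integral (boundary_face \<Omega> K) {a..b}
      (\<lambda>z. let \<nu> = outward_normal \<Omega> (fst z)
           in \<beta> * (norm (cross3 \<nu> (snd v K z)))\<^sup>2 + cross3 \<nu> (g z) \<bullet> snd v K z))
    = \<beta> * boundary_loss a b v + (\<Sum>K\<in>M. ST_integral (boundary_face \<Omega> K) {a..b} (datum_form K v))"
proof -
  have "face_time_integral (boundary_face \<Omega> K) {a..b}
      (\<lambda>z. let \<nu> = outward_normal \<Omega> (fst z)
           in \<beta> * (norm (cross3 \<nu> (snd v K z)))\<^sup>2 + cross3 \<nu> (g z) \<bullet> snd v K z)
    = \<beta> * ST_integral (boundary_face \<Omega> K) {a..b} (\<lambda>z. (norm (cross3 (unit_normal K (fst z)) (snd v K z)))\<^sup>2)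
     + 1 * ST_integral (boundary_face \<Omega> K) {a..b} (datum_form K v)" if K: "K \<in> M" for K
  proof -
    let ?N = "\<lambda>z. (norm (cross3 (unit_normal K (fst z)) (snd v K z)))\<^sup>2"
    have lbN: "locally_bounded ?N"
      unfolding power2_norm_eq_inner
      by (intro locally_bounded_inner locally_bounded_cross locally_bounded_unit_normal poly_field_locally_bounded poly_brokenD v K)
    have "(\<lambda>z. \<beta> * ?N z + 1 * datum_form K v z) \<in> borel_measurable borel"
      using lbN borel_datum_form[OF K v] unfolding locally_bounded_def
      by (intro borel_measurable_add borel_measurable_times borel_measurable_const) blast+
    then have "face_time_integral (boundary_face \<Omega> K) {a..b}
      (\<lambda>z. let \<nu> = outward_normal \<Omega> (fst z)
           in \<beta> * (norm (cross3 \<nu> (snd v K z)))\<^sup>2 + cross3 \<nu> (g z) \<bullet> snd v K z)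
     = ST_integral (boundary_face \<Omega> K) {a..b} (\<lambda>z. \<beta> * ?N z + 1 * datum_form K v z)"
      using datum_integral_cong[OF K sl, of "\<lambda>\<nu> \<gamma> z. \<beta> * (norm (cross3 \<nu> (snd v K z)))\<^sup>2 + cross3 \<nu> \<gamma> \<bullet> snd v K z"]
      unfolding datum_form_def Let_def by simp
    then show ?thesis
      using integral_comb[OF integrable_boundary[OF K lbN] integrable_datum_form[OF K v sl], of \<beta> 1] by simp
  qed
  then show ?thesis unfolding boundary_loss_def by (simp add: sum.distrib sum_distrib_left)
qed

text \<open>Equating the diagonal of the form with the right-hand side leaves the mixed mass term
  with the previous field; replacing it by the squared jump in time removes half of the initial mass
  of \<open>u\<close> and produces the energy of \<open>u'\<close>.\<close>

lemma dg_step_energy: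
  assumes u: "trefftz_field \<epsilon> \<mu> u" and u': "admissible (t (n - 1)) u'" and t: "t (n - 1) \<le> t n" and sl: "slab t n \<subseteq> {0..T}"
    and pos: "\<And>K. K \<in> M \<Longrightarrow> \<epsilon> K > 0" "\<And>K. K \<in> M \<Longrightarrow> \<mu> K > 0"
    and eq: "dg_B \<Omega> M \<epsilon> \<mu> \<beta> t n u u = dg_R \<Omega> M \<epsilon> \<mu> t g n u' u"
  shows "energy M \<epsilon> \<mu> (t n) u - energy M \<epsilon> \<mu> (t (n - 1)) u' =
     - (\<Sum>K\<in>M. face_time_integral (boundary_face \<Omega> K) (slab t n)
          (\<lambda>z. let \<nu> = outward_normal \<Omega> (fst z)
               in \<beta> * (norm (cross3 \<nu> (snd u K z)))\<^sup>2 + cross3 \<nu> (g z) \<bullet> snd u K z))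
     - (\<Sum>K\<in>M. \<epsilon> K / 2 * (L2_norm_on K (\<lambda>x. fst u K (x, t (n - 1)) - fst u' K (x, t (n - 1))))\<^sup>2
         + \<mu> K / 2 * (L2_norm_on K (\<lambda>x. snd u K (x, t (n - 1)) - snd u' K (x, t (n - 1))))\<^sup>2)"
proof -
  have p: "poly_broken u" using u by (simp add: trefftz_field_def)
  have e: "energy M \<epsilon> \<mu> (t n) u = 1/2 * mass_term M \<epsilon> \<mu> (t n) u u"
    "energy M \<epsilon> \<mu> (t (n - 1)) u' = 1/2 * mass_term M \<epsilon> \<mu> (t (n - 1)) u' u'"
    by (rule energy_mass_term[OF admissible_poly[OF p] pos], assumption+)
      (rule energy_mass_term[OF u' pos], assumption+)
  show ?thesis
    unfolding e boundary_dissipation[OF p sl] difference_mass_term[OF admissible_poly[OF p] u']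
    using eq unfolding dg_B_diagonal[OF u t] dg_R_form[OF p sl] by linarith
qed

end

section \<open>Coefficient vectors of broken fields\<close>

definition coefficient_field :: "nat \<Rightarrow> (3 \<Rightarrow> nat \<times> nat \<times> nat \<times> nat \<Rightarrow> real) \<Rightarrow> field" where
  "coefficient_field p c z = (\<chi> i. \<Sum>q\<in>exponents p. c i q * monomial q z)"

text \<open>All coefficients of both fields on all elements form one function on a finite index set,
  as the abstract solvability lemma wants it; the Boolean is \<open>False\<close> for the electric
  and \<open>True\<close> for the magnetic field.\<close>

definition coefficient_broken ::
    "vec3 set set \<Rightarrow> nat \<Rightarrow> (vec3 set \<times> bool \<times> 3 \<times> nat \<times> nat \<times> nat \<times> nat \<Rightarrow> real) \<Rightarrow> broken \<times> broken" where
  "coefficient_broken M p c =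
     (restrict (\<lambda>K. coefficient_field p (\<lambda>i q. c (K, False, i, q))) M, restrict (\<lambda>K. coefficient_field p (\<lambda>i q. c (K, True, i, q))) M)"

lemma coefficient_field_lincomb:
  "coefficient_field p (\<lambda>i q. a * c i q + b * d i q) z = a *\<^sub>R coefficient_field p c z + b *\<^sub>R coefficient_field p d z"
  by (simp add: coefficient_field_def vec_eq_iff sum_distrib_left sum.distrib[symmetric] algebra_simps)

lemma coefficient_field_ex:
  assumes "\<forall>i. (\<lambda>z. E z $ i) \<in> polys p"
  shows "\<exists>c. E = coefficient_field p c"
proof -
  have "\<forall>i. \<exists>c. (\<lambda>z. E z $ i) = (\<lambda>z. \<Sum>q\<in>exponents p. c q * monomial q z)"
    using assms unfolding polys_monomials .
  from choice[OF this] obtain c where c: "\<And>i. (\<lambda>z. E z $ i) = (\<lambda>z. \<Sum>q\<in>exponents p. c i q * monomial q z)"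
    by blast
  have "E = coefficient_field p c"
    unfolding coefficient_field_def[abs_def] using fun_cong[OF c] by (simp add: fun_eq_iff vec_eq_iff)
  then show ?thesis by blast
qed

context mesh_family
begin

text \<open>Brings a linear combination back into the extensional Trefftz space by resetting its
  values outside \<open>M\<close>.\<close>

definition restrict_broken :: "broken \<times> broken \<Rightarrow> broken \<times> broken" where
  "restrict_broken u = (restrict (fst u) M, restrict (snd u) M)"

lemma restrict_broken_agree: "agree (restrict_broken u) u" "agree u (restrict_broken u)"
  by (simp_all add: agree_def restrict_broken_def)

lemma agree_refl: "agree u u"
  by (simp add: agree_def)

lemma trefftz_space_comb:
  assumes u: "u \<in> trefftz_space M \<epsilon> \<mu> p t n" and v: "v \<in> trefftz_space M \<epsilon> \<mu> p t n"
  shows "restrict_broken (comb a u b v) \<in> trefftz_space M \<epsilon> \<mu> p t n"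
proof -
  have "(\<lambda>z. a *\<^sub>R fst u K z + b *\<^sub>R fst v K z, \<lambda>z. a *\<^sub>R snd u K z + b *\<^sub>R snd v K z) \<in> local_trefftz (\<epsilon> K) (\<mu> K) p (K \<times> slab t n)"
    if K: "K \<in> M" for K
  proof -
    have pu: "\<forall>i. (\<lambda>z. fst u K z $ i) \<in> polys p \<and> (\<lambda>z. snd u K z $ i) \<in> polys p"
      and mu: "\<forall>z\<in>K \<times> slab t n. maxwell_at (\<epsilon> K) (\<mu> K) (fst u K) (snd u K) z"
      using u K unfolding trefftz_space_def local_trefftz_def by (auto simp: case_prod_beta)
    have pv: "\<forall>i. (\<lambda>z. fst v K z $ i) \<in> polys p \<and> (\<lambda>z. snd v K z $ i) \<in> polys p"
      and mv: "\<forall>z\<in>K \<times> slab t n. maxwell_at (\<epsilon> K) (\<mu> K) (fst v K) (snd v K) z"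
      using v K unfolding trefftz_space_def local_trefftz_def by (auto simp: case_prod_beta)
    have "(\<lambda>z. (a *\<^sub>R fst u K z + b *\<^sub>R fst v K z) $ i) \<in> polys p" "(\<lambda>z. (a *\<^sub>R snd u K z + b *\<^sub>R snd v K z) $ i) \<in> polys p" for i
      using pu pv by (simp_all add: polys_lincomb)
    moreover have "maxwell_at (\<epsilon> K) (\<mu> K) (\<lambda>z. a *\<^sub>R fst u K z + b *\<^sub>R fst v K z) (\<lambda>z. a *\<^sub>R snd u K z + b *\<^sub>R snd v K z) z"
      if "z \<in> K \<times> slab t n" for z
      using pu pv mu mv that polys_polynomial by (intro maxwell_at_lincomb) blast+
    ultimately show ?thesis unfolding local_trefftz_def by blast
  qed
  then show ?thesis unfolding trefftz_space_def restrict_broken_def by (simp add: comb_def)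
qed

lemma trefftz_space_coefficients:
  assumes u: "u \<in> trefftz_space M \<epsilon> \<mu> p t n"
  shows "\<exists>c. (\<forall>x. x \<notin> M \<times> UNIV \<times> UNIV \<times> exponents p \<longrightarrow> c x = 0) \<and> coefficient_broken M p c = u"
proof -
  have ext: "fst u \<in> extensional M" "snd u \<in> extensional M"
    using u unfolding trefftz_space_def by (auto simp: case_prod_beta)
  have pu: "\<forall>i. (\<lambda>z. fst u K z $ i) \<in> polys p" "\<forall>i. (\<lambda>z. snd u K z $ i) \<in> polys p" if "K \<in> M" for K
    using u that unfolding trefftz_space_def local_trefftz_def by (auto simp: case_prod_beta)
  have "\<forall>K\<in>M. \<exists>c. fst u K = coefficient_field p c" "\<forall>K\<in>M. \<exists>c. snd u K = coefficient_field p c"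
    using coefficient_field_ex pu by blast+
  then obtain c d where c: "\<And>K. K \<in> M \<Longrightarrow> fst u K = coefficient_field p (c K)" and d: "\<And>K. K \<in> M \<Longrightarrow> snd u K = coefficient_field p (d K)"
    by (auto dest!: bchoice)
  \<comment> \<open>Zero off the index set, since the solvability lemma works with coefficient
    vectors supported there.\<close>
  define e where "e = (\<lambda>(K, b, i, q). if K \<in> M \<and> q \<in> exponents p then (if b then d K i q else c K i q) else (0 :: real))"
  have "coefficient_field p (\<lambda>i q. e (K, False, i, q)) = fst u K" "coefficient_field p (\<lambda>i q. e (K, True, i, q)) = snd u K" if "K \<in> M" for K
    using that unfolding c[OF that] d[OF that] by (simp_all add: e_def coefficient_field_def[abs_def] cong: sum.cong)
  then have "coefficient_broken M p e = u"
    unfolding coefficient_broken_def using ext by (simp add: prod_eq_iff extensionalityI[of _ M])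
  moreover have "e x = 0" if "x \<notin> M \<times> UNIV \<times> UNIV \<times> exponents p" for x
    using that by (cases x) (auto simp: e_def)
  ultimately show ?thesis by blast
qed

lemma coefficient_broken_lincomb:
  "agree (coefficient_broken M p (\<lambda>x. a * c x + b * d x)) (comb a (coefficient_broken M p c) b (coefficient_broken M p d))"
  unfolding agree_def coefficient_broken_def comb_def by (auto simp: coefficient_field_lincomb fun_eq_iff)

lemma trefftz_eqI:
  assumes u: "u \<in> trefftz_space M \<epsilon> \<mu> p t n" and v: "v \<in> trefftz_space M \<epsilon> \<mu> p t n" and a: "agree u v"
  shows "u = v"
proof -
  have "fst u \<in> extensional M" "snd u \<in> extensional M" "fst v \<in> extensional M" "snd v \<in> extensional M"
    using u v unfolding trefftz_space_def by (auto simp: case_prod_beta)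
  then have "fst u = fst v" "snd u = snd v"
    using a unfolding agree_def by (auto intro: extensionalityI)
  then show ?thesis by (simp add: prod_eq_iff)
qed

lemma previous_fields_admissible:
  assumes u: "u \<in> previous_fields M \<epsilon> \<mu> p t E0 H0 n" and n: "1 \<le> n" and t: "\<And>m. m < n \<Longrightarrow> t m < t (Suc m)"
    and E0: "L2_on lebesgue \<Omega> E0" and H0: "L2_on lebesgue \<Omega> H0"
  shows "admissible s u"
proof (cases "n = 1")
  case True
  then have "u = initial_field E0 H0" using u by (simp add: previous_fields_def)
  then show ?thesis using square_integrable_L2[OF E0] square_integrable_L2[OF H0] by (simp add: admissible_def initial_field_def)
next
  case False
  then have "u \<in> trefftz_space M \<epsilon> \<mu> p t (n - 1)" using u by (simp add: previous_fields_def)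
  moreover have "t (n - 1 - 1) < t (n - 1)"
  proof -
    have "Suc (n - 1 - 1) = n - 1" using False n by simp
    then show ?thesis using t[of "n - 1 - 1"] n by simp
  qed
  ultimately have "trefftz_field \<epsilon> \<mu> u" by (rule trefftz_space_field)
  then show ?thesis unfolding trefftz_field_def using admissible_poly by blast
qed

end

section \<open>Existence and uniqueness on one slab\<close>

context dg_data
begin

lemma dg_step_unique:
  assumes t: "t (n - 1) < t n" and \<beta>: "0 \<le> \<beta>"
    and pos: "\<And>K. K \<in> M \<Longrightarrow> \<epsilon> K > 0" "\<And>K. K \<in> M \<Longrightarrow> \<mu> K > 0"
    and u: "dg_step \<Omega> M \<epsilon> \<mu> \<beta> p t g n u' u" and v: "dg_step \<Omega> M \<epsilon> \<mu> \<beta> p t g n u' v"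
  shows "u = v"
proof -
  let ?V = "trefftz_space M \<epsilon> \<mu> p t n"
  have uv: "u \<in> ?V" "v \<in> ?V" using u v by (auto simp: dg_step_def)
  have pb: "poly_broken u" if "u \<in> ?V" for u
    using trefftz_space_field[OF that t] by (simp add: trefftz_field_def)
  let ?d = "comb 1 u (- 1) v"
  have w: "restrict_broken ?d \<in> ?V" by (rule trefftz_space_comb[OF uv])
  have "dg_B \<Omega> M \<epsilon> \<mu> \<beta> t n (restrict_broken ?d) (restrict_broken ?d) = dg_B \<Omega> M \<epsilon> \<mu> \<beta> t n ?d (restrict_broken ?d)"
    by (rule dg_B_agree[OF restrict_broken_agree(1) agree_refl])
  also have "\<dots> = 1 * dg_B \<Omega> M \<epsilon> \<mu> \<beta> t n u (restrict_broken ?d) + (- 1) * dg_B \<Omega> M \<epsilon> \<mu> \<beta> t n v (restrict_broken ?d)"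
    by (rule dg_B_comb(1)[OF pb[OF uv(1)] pb[OF uv(2)] pb[OF w]])
  also have "\<dots> = 0" using u v w by (simp add: dg_step_def)
  finally have z: "dg_B \<Omega> M \<epsilon> \<mu> \<beta> t n (restrict_broken ?d) (restrict_broken ?d) = 0" .
  have "fst u K = fst v K \<and> snd u K = snd v K" if K: "K \<in> M" for K
  proof -
    have "fst (restrict_broken ?d) K w = 0 \<and> snd (restrict_broken ?d) K w = 0" for w
      using trefftz_field_zero[OF trefftz_space_field[OF w t] less_imp_le[OF t] \<beta> pos z K] by blast
    then show ?thesis using K by (auto simp: restrict_broken_def comb_def)
  qed
  then have "agree u v" by (simp add: agree_def)
  then show ?thesis using trefftz_eqI[OF uv] by blast
qed

text \<open>The problem is moved to the subspace of coefficient vectors whose fields are Trefftz.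
  Degenerate directions are harmless: \<open>B c c = 0\<close> makes the field of \<open>c\<close>
  vanish on the mesh, so both forms and the right-hand side vanish with it.\<close>

lemma dg_step_exists:
  assumes t: "t (n - 1) < t n" and sl: "slab t n \<subseteq> {0..T}" and \<beta>: "0 \<le> \<beta>"
    and pos: "\<And>K. K \<in> M \<Longrightarrow> \<epsilon> K > 0" "\<And>K. K \<in> M \<Longrightarrow> \<mu> K > 0" and u': "admissible (t (n - 1)) u'"
  shows "\<exists>u. dg_step \<Omega> M \<epsilon> \<mu> \<beta> p t g n u' u"
proof -
  let ?V = "trefftz_space M \<epsilon> \<mu> p t n"
  let ?J = "M \<times> (UNIV :: bool set) \<times> (UNIV :: 3 set) \<times> exponents p"
  let ?L = "coefficient_broken M p"
  define S where "S = {c. (\<forall>x. x \<notin> ?J \<longrightarrow> c x = 0) \<and> ?L c \<in> ?V}"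
  define B where "B = (\<lambda>c d. dg_B \<Omega> M \<epsilon> \<mu> \<beta> t n (?L c) (?L d))"
  define R where "R = (\<lambda>d. dg_R \<Omega> M \<epsilon> \<mu> t g n u' (?L d))"
  have SV: "?L c \<in> ?V" if "c \<in> S" for c using that by (simp add: S_def)
  have pb: "poly_broken (?L c)" if "c \<in> S" for c
    using trefftz_space_field[OF SV[OF that] t] by (simp add: trefftz_field_def)
  have lcV: "?L (\<lambda>x. a * c x + b * d x) = restrict_broken (comb a (?L c) b (?L d))" for a b c d
    unfolding coefficient_broken_def restrict_broken_def comb_def
    by (auto simp: coefficient_field_lincomb fun_eq_iff restrict_def)
  have sub: "(\<lambda>x. a * c x + b * d x) \<in> S" if "c \<in> S" "d \<in> S" for a b c d
  proof -
    have "a * c x + b * d x = 0" if x: "x \<notin> ?J" for x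
    proof -
      have "c x = 0" "d x = 0" using x \<open>c \<in> S\<close> \<open>d \<in> S\<close> unfolding S_def by blast+
      then show ?thesis by simp
    qed
    moreover have "?L (\<lambda>x. a * c x + b * d x) \<in> ?V"
      unfolding lcV by (rule trefftz_space_comb[OF SV[OF that(1)] SV[OF that(2)]])
    ultimately show ?thesis unfolding S_def by blast
  qed
  have Bl: "B (\<lambda>x. a * c x + b * d x) e = a * B c e + b * B d e" if "c \<in> S" "d \<in> S" "e \<in> S" for a b c d e
    unfolding B_def dg_B_agree[OF coefficient_broken_lincomb agree_refl]
    by (rule dg_B_comb(1)[OF pb[OF that(1)] pb[OF that(2)] pb[OF that(3)]])
  have Br: "B e (\<lambda>x. a * c x + b * d x) = a * B e c + b * B e d" if "c \<in> S" "d \<in> S" "e \<in> S" for a b c d e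
    unfolding B_def dg_B_agree[OF agree_refl coefficient_broken_lincomb]
    by (rule dg_B_comb(2)[OF pb[OF that(1)] pb[OF that(2)] pb[OF that(3)]])
  have Rl: "R (\<lambda>x. a * c x + b * d x) = a * R c + b * R d" if "c \<in> S" "d \<in> S" for a b c d
    unfolding R_def dg_R_agree[OF coefficient_broken_lincomb]
    by (rule dg_R_comb[OF u' pb[OF that(1)] pb[OF that(2)] sl])
  have deg: "B c d = 0 \<and> B d c = 0 \<and> R c = 0" if c: "c \<in> S" and d: "d \<in> S" and z: "B c c = 0" for c d
  proof -
    have "fst (?L c) K w = 0 \<and> snd (?L c) K w = 0" if "K \<in> M" for K w
      using trefftz_field_zero[OF trefftz_space_field[OF SV[OF c] t] less_imp_le[OF t] \<beta> pos _ that] z unfolding B_def by blast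
    \<comment> \<open>A vanishing field agrees with a combination with factors 0, so linearity alone
      gives the three zeros.\<close>
    then have ag: "agree (?L c) (comb 0 (?L c) 0 (?L c))" by (simp add: agree_def fun_eq_iff)
    have "B c d = dg_B \<Omega> M \<epsilon> \<mu> \<beta> t n (comb 0 (?L c) 0 (?L c)) (?L d)"
      unfolding B_def by (rule dg_B_agree[OF ag agree_refl])
    then have 1: "B c d = 0" using dg_B_comb(1)[OF pb[OF c] pb[OF c] pb[OF d], of \<epsilon> \<mu> \<beta> t n 0 0] by simp
    have "B d c = dg_B \<Omega> M \<epsilon> \<mu> \<beta> t n (?L d) (comb 0 (?L c) 0 (?L c))"
      unfolding B_def by (rule dg_B_agree[OF agree_refl ag])
    then have 2: "B d c = 0" using dg_B_comb(2)[OF pb[OF c] pb[OF c] pb[OF d], of \<epsilon> \<mu> \<beta> t n 0 0] by simp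
    have "R c = dg_R \<Omega> M \<epsilon> \<mu> t g n u' (comb 0 (?L c) 0 (?L c))"
      unfolding R_def by (rule dg_R_agree[OF ag])
    then have 3: "R c = 0" using dg_R_comb[OF u' pb[OF c] pb[OF c] sl, of \<epsilon> \<mu> 0 0] by simp
    show ?thesis using 1 2 3 by blast
  qed
  have zero: "(\<lambda>x. 0) \<in> S"
  proof -
    have "restrict_broken (\<lambda>K z. 0, \<lambda>K z. 0) \<in> ?V"
    proof -
      have "(\<lambda>z. 0) \<in> polys p" unfolding polys_monomials by (intro exI[of _ "\<lambda>q. 0"]) simp
      moreover have "maxwell_at e m (\<lambda>z. 0) (\<lambda>z. 0) z" for e m z
        unfolding maxwell_at_def curl_def time_deriv_def space_deriv_def by (simp add: vec_eq_iff forall_3)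
      ultimately show ?thesis unfolding trefftz_space_def local_trefftz_def restrict_broken_def by simp
    qed
    moreover have "?L (\<lambda>x. 0) = restrict_broken (\<lambda>K z. 0, \<lambda>K z. 0)"
      unfolding coefficient_broken_def restrict_broken_def
      by (auto simp: fun_eq_iff restrict_def coefficient_field_def vec_eq_iff)
    ultimately show ?thesis by (simp add: S_def)
  qed
  have "\<exists>c\<in>S. \<forall>d\<in>S. B c d = R d"
  proof (rule coefficient_system_solvable[of ?J])
    show "finite ?J" using finite_mesh finite_exponents by simp
    show "c x = 0" if "c \<in> S" "x \<notin> ?J" for c x using that unfolding S_def by blast
  qed (fact zero sub Bl Br Rl deg)+
  then obtain c where c: "c \<in> S" "\<And>d. d \<in> S \<Longrightarrow> B c d = R d" by blast
  have "dg_B \<Omega> M \<epsilon> \<mu> \<beta> t n (?L c) v = dg_R \<Omega> M \<epsilon> \<mu> t g n u' v" if v: "v \<in> ?V" for v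
  proof -
    obtain d where d: "\<forall>x. x \<notin> ?J \<longrightarrow> d x = 0" "?L d = v" using trefftz_space_coefficients[OF v] by blast
    then have "d \<in> S" using v by (simp add: S_def)
    from c(2)[OF this] show ?thesis unfolding B_def R_def d(2) .
  qed
  then show ?thesis using SV[OF c(1)] unfolding dg_step_def by blast
qed

end

context mesh_family
begin

text \<open>Expresses that a step depends on the excitation only through its class on the boundary
  over the current slab.\<close>

lemma dg_R_datum_cong:
  assumes ae: "AE z in face_time_measure (frontier \<Omega>). z \<in> frontier \<Omega> \<times> slab t n \<longrightarrow> g' z = g z"
  shows "dg_R \<Omega> M \<epsilon> \<mu> t g' n u v = dg_R \<Omega> M \<epsilon> \<mu> t g n u v"
proof -
  have fr: "frontier \<Omega> \<in> sets borel" by simp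
  have ae': "AE z in ST. fst z \<in> frontier \<Omega> \<longrightarrow> z \<in> frontier \<Omega> \<times> slab t n \<longrightarrow> g' z = g z"
    using ae unfolding AE_face_time_measure[OF fr domain_family] .
  have "face_time_integral (boundary_face \<Omega> K) (slab t n) (\<lambda>z. cross3 (outward_normal \<Omega> (fst z)) (g' z) \<bullet> snd v K z)
     = face_time_integral (boundary_face \<Omega> K) (slab t n) (\<lambda>z. cross3 (outward_normal \<Omega> (fst z)) (g z) \<bullet> snd v K z)" if K: "K \<in> M" for K
    using boundary_face_borel[OF K]
  proof (intro face_time_integral_cong_AE)
    show "AE z in ST. z \<in> boundary_face \<Omega> K \<times> slab t n \<longrightarrow>
       cross3 (outward_normal \<Omega> (fst z)) (g' z) \<bullet> snd v K z = cross3 (outward_normal \<Omega> (fst z)) (g z) \<bullet> snd v K z"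
      using ae' by eventually_elim (auto simp: boundary_face_def)
  qed auto
  then show ?thesis unfolding dg_R_def by (simp add: case_prod_beta)
qed

end

section \<open>Assembling the time-stepping scheme\<close>

lemma polyhedral_mesh_planes:
  assumes "polyhedral_boundary \<Omega>" "polyhedral_mesh \<Omega> M"
  obtains \<P> where "finite \<P>" "\<P> \<subseteq> planes" "frontier \<Omega> \<subseteq> \<Union>\<P>" "\<And>K. K \<in> M \<Longrightarrow> frontier K \<subseteq> \<Union>\<P>"
proof -
  obtain P0 where P0: "finite P0" "P0 \<subseteq> planes" "frontier \<Omega> \<subseteq> \<Union>P0"
    using assms(1) unfolding polyhedral_boundary_def by blast
  define covers where "covers K P \<longleftrightarrow> finite P \<and> P \<subseteq> planes \<and> frontier K \<subseteq> \<Union>P" for K P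
  have "\<forall>K\<in>M. \<exists>P. covers K P"
  proof
    fix K assume "K \<in> M"
    then have "polyhedral_boundary K" using assms(2) by (simp add: polyhedral_mesh_def polyhedral_element_def)
    then show "\<exists>P. covers K P" unfolding polyhedral_boundary_def covers_def .
  qed
  then obtain P where "\<forall>K\<in>M. covers K (P K)" by (auto dest!: bchoice)
  then have P: "finite (P K)" "P K \<subseteq> planes" "frontier K \<subseteq> \<Union>(P K)" if "K \<in> M" for K
    using that by (auto simp: covers_def)
  have "finite M" using assms(2) by (simp add: polyhedral_mesh_def)
  show thesis
  proof (rule that[of "P0 \<union> (\<Union>K\<in>M. P K)"])
    show "finite (P0 \<union> (\<Union>K\<in>M. P K))" using P0 P \<open>finite M\<close> by blast
    show "P0 \<union> (\<Union>K\<in>M. P K) \<subseteq> planes" using P0 P by blast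
    show "frontier \<Omega> \<subseteq> \<Union>(P0 \<union> (\<Union>K\<in>M. P K))" using P0 by blast
    show "frontier K \<subseteq> \<Union>(P0 \<union> (\<Union>K\<in>M. P K))" if "K \<in> M" for K using P[OF that] that by blast
  qed
qed

text \<open>\<open>V n\<close> holds the inputs for which step \<open>n\<close> is known to be
  uniquely solvable, and each step must lead into the next of these sets. Extensionality fixes the
  values after \<open>N\<close>, on which the steps impose nothing.\<close>

lemma unique_recursive_sequence:
  fixes V :: "nat \<Rightarrow> 'a set" and S :: "nat \<Rightarrow> 'a \<Rightarrow> 'a \<Rightarrow> bool"
  assumes ex1: "\<And>n x. n \<in> {1..N} \<Longrightarrow> x \<in> V n \<Longrightarrow> \<exists>!y. S n x y"
    and V1: "x0 \<in> V 1" and V: "\<And>n x y. n \<in> {1..N} \<Longrightarrow> S n x y \<Longrightarrow> y \<in> V (Suc n)"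
  shows "\<exists>!U. U \<in> extensional {0..N} \<and> U 0 = x0 \<and> (\<forall>n\<in>{1..N}. S n (U (n - 1)) (U n))"
proof -
  \<comment> \<open>Continues after \<open>N\<close> by arbitrary choices; only its restriction to
    \<open>{0..N}\<close> is used as the solution.\<close>
  define W where "W = rec_nat x0 (\<lambda>n x. SOME y. S (Suc n) x y)"
  have W: "W 0 = x0" "W (Suc n) = (SOME y. S (Suc n) (W n) y)" for n by (simp_all add: W_def)
  have WV: "n \<le> N \<Longrightarrow> W n \<in> V (Suc n) \<and> (\<forall>m\<in>{1..n}. S m (W (m - 1)) (W m))" for n
  proof (induction n)
    case 0
    then show ?case using V1 by (simp add: W)
  next
    case (Suc n)
    then have IH: "W n \<in> V (Suc n)" "\<forall>m\<in>{1..n}. S m (W (m - 1)) (W m)" by auto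
    have n: "Suc n \<in> {1..N}" using Suc.prems by simp
    have "S (Suc n) (W n) (W (Suc n))" unfolding W(2) using ex1[OF n IH(1)] by (metis someI_ex)
    moreover from V[OF n this] have "W (Suc n) \<in> V (Suc (Suc n))" .
    moreover have "{1..Suc n} = insert (Suc n) {1..n}" by auto
    ultimately show ?case using IH by simp
  qed
  show ?thesis
  proof (rule ex1I[of _ "restrict W {0..N}"])
    show "restrict W {0..N} \<in> extensional {0..N} \<and> restrict W {0..N} 0 = x0 \<and>
        (\<forall>n\<in>{1..N}. S n (restrict W {0..N} (n - 1)) (restrict W {0..N} n))"
    proof (intro conjI ballI)
      fix n assume "n \<in> {1..N}"
      then have "S n (W (n - 1)) (W n)" "n \<in> {0..N}" "n - 1 \<in> {0..N}" using WV[of N] by auto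
      then show "S n (restrict W {0..N} (n - 1)) (restrict W {0..N} n)" by (simp only: restrict_apply')
    qed (simp_all add: W)
    fix U assume U: "U \<in> extensional {0..N} \<and> U 0 = x0 \<and> (\<forall>n\<in>{1..N}. S n (U (n - 1)) (U n))"
    have "n \<le> N \<Longrightarrow> U n = W n" for n
    proof (induction n)
      case 0
      then show ?case using U W by simp
    next
      case (Suc n)
      then have e: "U n = W n" and n: "Suc n \<in> {1..N}" by auto
      have "S (Suc n) (W n) (U (Suc n))" using U n e by force
      moreover have "S (Suc n) (W n) (W (Suc n))" using WV[of "Suc n"] Suc.prems by force
      moreover have "\<exists>!y. S (Suc n) (W n) y" using ex1[OF n] WV[of n] Suc.prems by simp
      ultimately show ?case by blast
    qed
    then show "U = restrict W {0..N}" using U by (intro extensionalityI[of _ "{0..N}"]) auto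
  qed
qed

theorem theorem18:
  fixes \<Omega> :: "(real^3) set" and M :: "(real^3) set set"
    and \<epsilon> \<mu> :: "(real^3) set \<Rightarrow> real" and \<beta> T :: real
    and N p :: nat and t :: "nat \<Rightarrow> real"
    and E0 H0 :: "real^3 \<Rightarrow> real^3" and g :: "(real^3) \<times> real \<Rightarrow> real^3"
  assumes "bounded \<Omega>" and "lipschitz_domain \<Omega>" and "polyhedral_boundary \<Omega>"
    and "polyhedral_mesh \<Omega> M"
    and "\<And>K. K \<in> M \<Longrightarrow> \<epsilon> K > 0" and "\<And>K. K \<in> M \<Longrightarrow> \<mu> K > 0" and "\<beta> \<ge> 0"
    and "N \<ge> 1" and "t 0 = 0" and "t N = T" and "\<And>n. n < N \<Longrightarrow> t n < t (Suc n)"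
    and "L2_on lebesgue \<Omega> E0" and "L2_on lebesgue \<Omega> H0"
    and "L2_on (face_time_measure (frontier \<Omega>)) (frontier \<Omega> \<times> {0<..<T}) g"
  shows
    \<comment> \<open>well-defined implicit scheme\<close>
    "(\<forall>n\<in>{1..N}. \<forall>u'\<in>previous_fields M \<epsilon> \<mu> p t E0 H0 n. \<exists>!u. dg_step \<Omega> M \<epsilon> \<mu> \<beta> p t g n u' u) \<and>
     (\<exists>!U. U \<in> extensional {0..N} \<and> dg_scheme \<Omega> M \<epsilon> \<mu> \<beta> p N t E0 H0 g U) \<and>
     (\<forall>n\<in>{1..N}. \<forall>g'.
        L2_on (face_time_measure (frontier \<Omega>)) (frontier \<Omega> \<times> {0<..<T}) g' \<and>
        (AE z in face_time_measure (frontier \<Omega>). z \<in> frontier \<Omega> \<times> slab t n \<longrightarrow> g' z = g z) \<longrightarrow>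
        (\<forall>u' u. dg_step \<Omega> M \<epsilon> \<mu> \<beta> p t g' n u' u \<longleftrightarrow> dg_step \<Omega> M \<epsilon> \<mu> \<beta> p t g n u' u)) \<and>
     \<comment> \<open>consistency\<close>
     (\<forall>u. piecewise_smooth_solution \<Omega> M \<epsilon> \<mu> \<beta> N T t E0 H0 g u \<longrightarrow>
        (\<forall>n\<in>{1..N}. \<forall>\<phi>\<in>trefftz_space M \<epsilon> \<mu> p t n.
           dg_B \<Omega> M \<epsilon> \<mu> \<beta> t n u \<phi> = dg_R \<Omega> M \<epsilon> \<mu> t g n u \<phi>)) \<and>
     \<comment> \<open>energy dissipation\<close>
     (\<forall>E H. dg_scheme \<Omega> M \<epsilon> \<mu> \<beta> p N t E0 H0 g (\<lambda>n. (E n, H n)) \<longrightarrow>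
        (\<forall>n\<in>{1..N}.
           energy M \<epsilon> \<mu> (t n) (E n, H n) - energy M \<epsilon> \<mu> (t (n - 1)) (E (n - 1), H (n - 1)) =
           - (\<Sum>K\<in>M. face_time_integral (boundary_face \<Omega> K) (slab t n)
                (\<lambda>z. let \<nu> = outward_normal \<Omega> (fst z)
                     in \<beta> * (norm (cross3 \<nu> (H n K z)))\<^sup>2 + cross3 \<nu> (g z) \<bullet> H n K z))
           - (\<Sum>K\<in>M.
                \<epsilon> K / 2 * (L2_norm_on K (\<lambda>x. E n K (x, t (n - 1)) - E (n - 1) K (x, t (n - 1))))\<^sup>2 +
                \<mu> K / 2 * (L2_norm_on K (\<lambda>x. H n K (x, t (n - 1)) - H (n - 1) K (x, t (n - 1))))\<^sup>2)))"
proof -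
  obtain \<P> where \<P>: "finite \<P>" "\<P> \<subseteq> planes" "frontier \<Omega> \<subseteq> \<Union>\<P>" "\<And>K. K \<in> M \<Longrightarrow> frontier K \<subseteq> \<Union>\<P>"
    using polyhedral_mesh_planes[OF assms(3,4)] by blast
  interpret mesh_family \<P> \<Omega> M
    by unfold_locales (use assms(1,2,4) \<P> in auto)
  note pos = assms(5,6) and t_less = assms(11)
  obtain g' where g': "\<And>i. (\<lambda>z. g' z $ i) \<in> borel_measurable borel"
    "AE z in ST. z \<in> frontier \<Omega> \<times> {0<..<T} \<longrightarrow> g z = g' z"
    "integrable ST (\<lambda>z. indicator (frontier \<Omega> \<times> {0<..<T}) z * (norm (g' z))\<^sup>2)"
    using datum_borel[OF assms(14)] by blast
  interpret dg_data \<P> \<Omega> M g g' T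
    by unfold_locales (fact g')+
  have mono: "m \<le> n \<Longrightarrow> n \<le> N \<Longrightarrow> t m \<le> t n" for m n
  proof (induction n rule: dec_induct)
    case (step n)
    then show ?case using t_less[of n] by simp
  qed simp
  have t: "t (n - 1) < t n" and sl: "slab t n \<subseteq> {0..T}" if "n \<in> {1..N}" for n
  proof -
    have "Suc (n - 1) = n" "n - 1 < N" using that by auto
    then show "t (n - 1) < t n" using t_less[of "n - 1"] by simp
    have "0 \<le> t (n - 1)" "t n \<le> T" using mono[of 0 "n - 1"] mono[of n N] that assms(9,10) by auto
    then show "slab t n \<subseteq> {0..T}" by auto
  qed
  have adm: "admissible s u" if "n \<in> {1..N}" "u \<in> previous_fields M \<epsilon> \<mu> p t E0 H0 n" for n u s
    using that t_less by (intro previous_fields_admissible[OF that(2) _ _ assms(12,13)]) auto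
  have step: "\<exists>!u. dg_step \<Omega> M \<epsilon> \<mu> \<beta> p t g n u' u" if n: "n \<in> {1..N}" and u': "u' \<in> previous_fields M \<epsilon> \<mu> p t E0 H0 n" for n u'
  proof -
    have "\<exists>u. dg_step \<Omega> M \<epsilon> \<mu> \<beta> p t g n u' u"
      by (rule dg_step_exists[OF t[OF n] sl[OF n] assms(7) _ _ adm[OF n u']]) (fact pos)+
    then obtain u where u: "dg_step \<Omega> M \<epsilon> \<mu> \<beta> p t g n u' u" by blast
    show ?thesis
    proof (rule ex1I[of _ u])
      show "dg_step \<Omega> M \<epsilon> \<mu> \<beta> p t g n u' u" by (rule u)
      show "v = u" if v: "dg_step \<Omega> M \<epsilon> \<mu> \<beta> p t g n u' v" for v
        by (rule dg_step_unique[OF t[OF n] assms(7) _ _ v u]) (fact pos)+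
    qed
  qed
  have next_field: "u \<in> previous_fields M \<epsilon> \<mu> p t E0 H0 (Suc n)" if "n \<in> {1..N}" "dg_step \<Omega> M \<epsilon> \<mu> \<beta> p t g n u' u" for n u' u
    using that by (simp add: previous_fields_def dg_step_def)
  have scheme: "\<exists>!U. U \<in> extensional {0..N} \<and> dg_scheme \<Omega> M \<epsilon> \<mu> \<beta> p N t E0 H0 g U"
    unfolding dg_scheme_def
    by (rule unique_recursive_sequence[where V = "previous_fields M \<epsilon> \<mu> p t E0 H0"])
      (use step next_field in \<open>auto simp: previous_fields_def\<close>)
  have local: "dg_step \<Omega> M \<epsilon> \<mu> \<beta> p t g'' n u' u \<longleftrightarrow> dg_step \<Omega> M \<epsilon> \<mu> \<beta> p t g n u' u"
    if "AE z in face_time_measure (frontier \<Omega>). z \<in> frontier \<Omega> \<times> slab t n \<longrightarrow> g'' z = g z" for n g'' u' u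
    unfolding dg_step_def dg_R_datum_cong[OF that] ..
  have energy: "energy M \<epsilon> \<mu> (t n) (E n, H n) - energy M \<epsilon> \<mu> (t (n - 1)) (E (n - 1), H (n - 1)) =
           - (\<Sum>K\<in>M. face_time_integral (boundary_face \<Omega> K) (slab t n)
                (\<lambda>z. let \<nu> = outward_normal \<Omega> (fst z)
                     in \<beta> * (norm (cross3 \<nu> (H n K z)))\<^sup>2 + cross3 \<nu> (g z) \<bullet> H n K z))
           - (\<Sum>K\<in>M.
                \<epsilon> K / 2 * (L2_norm_on K (\<lambda>x. E n K (x, t (n - 1)) - E (n - 1) K (x, t (n - 1))))\<^sup>2 +
                \<mu> K / 2 * (L2_norm_on K (\<lambda>x. H n K (x, t (n - 1)) - H (n - 1) K (x, t (n - 1))))\<^sup>2)"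
    if U: "dg_scheme \<Omega> M \<epsilon> \<mu> \<beta> p N t E0 H0 g (\<lambda>n. (E n, H n))" and n: "n \<in> {1..N}" for E H n
  proof -
    have st: "dg_step \<Omega> M \<epsilon> \<mu> \<beta> p t g m (E (m - 1), H (m - 1)) (E m, H m)" if "m \<in> {1..N}" for m
      using U that unfolding dg_scheme_def by blast
    have "(E (n - 1), H (n - 1)) \<in> previous_fields M \<epsilon> \<mu> p t E0 H0 n"
    proof (cases "n = 1")
      case True
      then show ?thesis using U by (simp add: dg_scheme_def previous_fields_def)
    next
      case False
      then have "n - 1 \<in> {1..N}" "Suc (n - 1) = n" using n by auto
      then show ?thesis using next_field[OF _ st[of "n - 1"]] by simp
    qed
    note prev = adm[OF n this]
    have V: "(E n, H n) \<in> trefftz_space M \<epsilon> \<mu> p t n" using st[OF n] by (simp add: dg_step_def)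
    have "dg_B \<Omega> M \<epsilon> \<mu> \<beta> t n (E n, H n) (E n, H n) = dg_R \<Omega> M \<epsilon> \<mu> t g n (E (n - 1), H (n - 1)) (E n, H n)"
      using st[OF n] V by (simp add: dg_step_def)
    from dg_step_energy[OF trefftz_space_field[OF V t[OF n]] prev less_imp_le[OF t[OF n]] sl[OF n] pos this]
    show ?thesis by simp
  qed
  show ?thesis
    by (intro conjI ballI allI impI)
      ((rule step, assumption+) | rule scheme | (rule local, erule conjunct2)
        | (rule dg_consistent, assumption, rule sl, assumption) | (rule energy, assumption+))+
qed

end
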